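(* Let $I\subseteq S$ be a proper monomial ideal, $F\subseteq\{1,\ldots,n\}$ and $\mathbf b\in\mathbb Z^n$. If $\mathbf a\succeq\mathbf a_I$ and $F\preceq\mathbf b\preceq\mathbf a\cdot F$, then for every $i$ $$\beta_{i,\mathbf b}(I)\ \le\ \sum_{\mathbf c\cdot F=\mathbf b^{\mathbf a}}\beta_{|F|-i-1,\mathbf c}(I^{\mathbf a}),$$ the sum being over all $\mathbf c\in\mathbb Z^n$ with $\mathbf c\cdot F=\mathbf b^{\mathbf a}$.
   Context: $k$ is a field, $n\ge 2$, $S=k[x_1,\ldots,x_n]$, $\mathbb Z^n$-graded; $\preceq$ is the coordinatewise order on $\mathbb Z^n$. A subset $F\subseteq\{1,\ldots,n\}$ is identified with its characteristic vector; $\mathbf c\cdot F$ is the vector with $i$th coordinate $c_i$ if $i\in F$ and $0$ otherwise. For $\mathbf b\in\mathbb N^n$ put $\mathfrak m^{\mathbf b}=\langle x_i^{b_i}\mid b_i\ge 1\rangle$; these are exactly the irreducible monomial ideals. $\mathbf a_I$ is the exponent vector of the least common multiple of the minimal generators of $I$, and $\mathrm{Irr}(I)$ is the set of irreducible components in the unique irredundant decomposition of $I$ as an intersection of irreducible monomial ideals; $\mathfrak m^{\mathbf b}\in\mathrm{Irr}(I)$ implies $\mathbf b\preceq\mathbf a_I$. For $\mathbf 0\preceq\mathbf b\preceq\mathbf a$, $\mathbf b^{\mathbf a}$ is the vector with $i$th coordinate $a_i+1-b_i$ if $b_i\ge1$ and $0$ if $b_i=0$. For $\mathbf a\succeq\mathbf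 a_I$, the Alexander dual ideal is $I^{\mathbf a}=\langle x^{\mathbf b^{\mathbf a}}\mid \mathfrak m^{\mathbf b}\in\mathrm{Irr}(I)\rangle$. Betti numbers: $\beta_{i,\mathbf b}(N)=\dim_k\mathrm{Tor}_i^S(k,N)_{\mathbf b}$ in the $\mathbb Z^n$-grading (zero for $i<0$). *)

theory Defs
  imports
    "HOL-Analysis.Infinite_Sum"
    "HOL-Library.Cardinality"
    "HOL-Library.Function_Algebras"
    "HOL-Library.Indicator_Function"
    "HOL-Library.Poly_Mapping"
begin

text \<open>
  The variables of \<open>S\<close> are indexed by a finite type \<open>'n\<close>. Exponent vectors are functions
  \<open>'n \<Rightarrow> nat\<close> and degrees are functions \<open>'n \<Rightarrow> int\<close>; on both, \<open>+\<close>, \<open>-\<close> and \<open>\<le>\<close> are pointwise.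
\<close>

type_synonym ('n, 'k) mpoly = "('n \<Rightarrow> nat) \<Rightarrow>\<^sub>0 'k"

definition monom :: "('n::finite \<Rightarrow> nat) \<Rightarrow> ('n, 'k::field) mpoly" where
  "monom u = Poly_Mapping.single u 1"

definition var :: "'n::finite \<Rightarrow> ('n, 'k::field) mpoly" where
  "var i = monom (\<lambda>j. if j = i then 1 else 0)"

abbreviation ideal_gen :: "('n::finite, 'k::field) mpoly set \<Rightarrow> ('n, 'k) mpoly set" where
  "ideal_gen B \<equiv> module.span (*) B"

definition monomial_ideal :: "('n::finite, 'k::field) mpoly set \<Rightarrow> bool" where
  "monomial_ideal I \<longleftrightarrow> (\<exists>U. I = ideal_gen (monom ` U))"

definition min_gens :: "('n::finite, 'k::field) mpoly set \<Rightarrow> ('n \<Rightarrow> nat) set" where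
  "min_gens I = {u. monom u \<in> I \<and> (\<forall>v. monom v \<in> I \<and> v \<le> u \<longrightarrow> v = u)}"

text \<open>For \<open>I = 0\<close> there are no generators; their least common multiple is \<open>1\<close>, matching
  \<open>Sup {} = (0::nat)\<close>.\<close>

definition lcm_exp :: "('n::finite, 'k::field) mpoly set \<Rightarrow> 'n \<Rightarrow> nat" where
  "lcm_exp I = (\<lambda>j. SUP u\<in>min_gens I. u j)"

definition irr_ideal :: "('n::finite \<Rightarrow> nat) \<Rightarrow> ('n, 'k::field) mpoly set" where
  "irr_ideal b = ideal_gen {var i ^ b i | i. b i \<ge> 1}"

definition irredundant_irr_decomp ::
  "('n::finite, 'k::field) mpoly set \<Rightarrow> ('n, 'k) mpoly set set \<Rightarrow> bool" where
  "irredundant_irr_decomp I \<Q> \<longleftrightarrow>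
     finite \<Q> \<and> \<Q> \<subseteq> range irr_ideal \<and> I = \<Inter>\<Q> \<and> (\<forall>Q\<in>\<Q>. \<Inter>(\<Q> - {Q}) \<noteq> I)"

definition Irr :: "('n::finite, 'k::field) mpoly set \<Rightarrow> ('n, 'k) mpoly set set" where
  "Irr I = (THE \<Q>. irredundant_irr_decomp I \<Q>)"

text \<open>\<open>b\<^sup>a\<close> for \<open>0 \<le> b \<le> a\<close>; it is used both for exponent vectors and for degrees.\<close>

definition dual_exp :: "('n \<Rightarrow> 'a::linordered_semidom) \<Rightarrow> ('n \<Rightarrow> 'a) \<Rightarrow> 'n \<Rightarrow> 'a" where
  "dual_exp a b = (\<lambda>j. if b j \<ge> 1 then a j + 1 - b j else 0)"

definition alexander_dual ::
  "('n::finite \<Rightarrow> nat) \<Rightarrow> ('n, 'k::field) mpoly set \<Rightarrow> ('n, 'k) mpoly set" where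
  "alexander_dual a I = ideal_gen {monom (dual_exp a b) | b. irr_ideal b \<in> Irr I}"

definition restrict_deg :: "('n \<Rightarrow> 'a::zero) \<Rightarrow> 'n set \<Rightarrow> 'n \<Rightarrow> 'a" (infixl "\<cdot>" 75) where
  "c \<cdot> F = (\<lambda>j. if j \<in> F then c j else 0)"

definition homogeneous :: "('n::finite \<Rightarrow> int) \<Rightarrow> ('n, 'k::field) mpoly \<Rightarrow> bool" where
  "homogeneous b f \<longleftrightarrow> (\<forall>u\<in>Poly_Mapping.keys f. (\<lambda>j. int (u j)) = b)"

text \<open>
  A complex \<open>\<dots> \<rightarrow> P\<^sub>1 \<rightarrow> P\<^sub>0 \<rightarrow> k\<close> of finitely generated graded free \<open>S\<close>-modules with chosen
  homogeneous bases. \<open>P\<^sub>i\<close> has rank \<open>rk i\<close>, its \<open>p\<close>-th basis element has degree \<open>gdeg i p\<close>, and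
  \<open>mat i\<close> is the matrix of \<open>P\<^bsub>i+1\<^esub> \<rightarrow> P\<^sub>i\<close> (row index first). The \<open>p\<close>-th basis element of \<open>P\<^sub>0\<close> is
  mapped to \<open>aug p\<close>.
\<close>

record (overloaded) ('n, 'k::zero) free_complex =
  rk :: "nat \<Rightarrow> nat"
  gdeg :: "nat \<Rightarrow> nat \<Rightarrow> 'n \<Rightarrow> int"
  mat :: "nat \<Rightarrow> nat \<Rightarrow> nat \<Rightarrow> ('n, 'k) mpoly"
  aug :: "nat \<Rightarrow> 'k"

definition free_mod ::
  "('n::finite, 'k::field) free_complex \<Rightarrow> nat \<Rightarrow> (nat \<Rightarrow> ('n, 'k) mpoly) set" where
  "free_mod P i = {v. \<forall>p \<ge> rk P i. v p = 0}"

fun bdry :: "('n::finite, 'k::field) free_complex \<Rightarrow> nat \<Rightarrow>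
    (nat \<Rightarrow> ('n, 'k) mpoly) \<Rightarrow> nat \<Rightarrow> ('n, 'k) mpoly" where
  "bdry P 0 v = (\<lambda>p. 0)"
| "bdry P (Suc i) v = (\<lambda>p. if p < rk P i then \<Sum>q<rk P (Suc i). mat P i p q * v q else 0)"

text \<open>\<open>S\<close> acts on \<open>k\<close> through the constant coefficient.\<close>

definition aug_map ::
  "('n::finite, 'k::field) free_complex \<Rightarrow> (nat \<Rightarrow> ('n, 'k) mpoly) \<Rightarrow> 'k" where
  "aug_map P v = (\<Sum>p<rk P 0. Poly_Mapping.lookup (v p) 0 * aug P p)"

definition graded_free_resolution :: "('n::finite, 'k::field) free_complex \<Rightarrow> bool" where
  "graded_free_resolution P \<longleftrightarrow>
     (\<forall>i. \<forall>p<rk P i. \<forall>q<rk P (Suc i).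
        homogeneous (gdeg P (Suc i) q - gdeg P i p) (mat P i p q)) \<and>
     (\<forall>p<rk P 0. aug P p \<noteq> 0 \<longrightarrow> gdeg P 0 p = 0) \<and>
     aug_map P ` free_mod P 0 = UNIV \<and>
     bdry P 1 ` free_mod P 1 = {v \<in> free_mod P 0. aug_map P v = 0} \<and>
     (\<forall>i\<ge>1. bdry P (Suc i) ` free_mod P (Suc i) = {v \<in> free_mod P i. bdry P i v = 0})"

text \<open>The degree \<open>b\<close> part of \<open>P\<^sub>i \<otimes>\<^sub>S N\<close> for a graded ideal \<open>N\<close>: as \<open>P\<^sub>i\<close> is free, \<open>P\<^sub>i \<otimes>\<^sub>S N\<close> is the
  direct sum of copies of \<open>N\<close>, the \<open>p\<close>-th one shifted by \<open>gdeg P i p\<close>, and the differential of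
  \<open>P \<otimes>\<^sub>S N\<close> is given by the same matrices.\<close>

definition tensor_deg :: "('n::finite, 'k::field) free_complex \<Rightarrow> ('n, 'k) mpoly set \<Rightarrow>
    nat \<Rightarrow> ('n \<Rightarrow> int) \<Rightarrow> (nat \<Rightarrow> ('n, 'k) mpoly) set" where
  "tensor_deg P N i b =
     {v \<in> free_mod P i. \<forall>p<rk P i. v p \<in> N \<and> homogeneous (b - gdeg P i p) (v p)}"

definition tor_cycles where
  "tor_cycles P N i b = {v \<in> tensor_deg P N i b. bdry P i v = 0}"

definition tor_boundaries where
  "tor_boundaries P N i b = bdry P (Suc i) ` tensor_deg P N (Suc i) b"

definition scale_k :: "'k::field \<Rightarrow> (nat \<Rightarrow> ('n::finite, 'k) mpoly) \<Rightarrow> nat \<Rightarrow> ('n, 'k) mpoly" where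
  "scale_k c v = (\<lambda>p. Poly_Mapping.single 0 c * v p)"

abbreviation dim_k :: "(nat \<Rightarrow> ('n::finite, 'k::field) mpoly) set \<Rightarrow> nat" where
  "dim_k V \<equiv> vector_space.dim scale_k V"

text \<open>\<open>Tor\<close> is the homology of \<open>P \<otimes>\<^sub>S N\<close> for a graded free resolution \<open>P\<close> of \<open>k\<close>. All spaces
  \<open>tensor_deg P N i b\<close> are finite-dimensional, so the dimension of the quotient is a difference of
  dimensions.\<close>

definition tor_dim :: "('n::finite, 'k::field) free_complex \<Rightarrow> nat \<Rightarrow> ('n \<Rightarrow> int) \<Rightarrow>
    ('n, 'k) mpoly set \<Rightarrow> nat" where
  "tor_dim P i b N = dim_k (tor_cycles P N i b) - dim_k (tor_boundaries P N i b)"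

text \<open>The dimension does not depend on the choice of resolution.\<close>

definition betti :: "int \<Rightarrow> ('n::finite \<Rightarrow> int) \<Rightarrow> ('n, 'k::field) mpoly set \<Rightarrow> nat" where
  "betti i b N =
     (if i < 0 then 0 else tor_dim (SOME P. graded_free_resolution P) (nat i) b N)"

end

theory Submission
  imports Defs
begin

text \<open>
  Tensoring the Koszul complex with a monomial ideal \<open>N\<close> identifies \<open>\<beta>\<^bsub>i,c\<^esub>(N)\<close> with the dimension of
  a reduced simplicial homology group, that of the complex of all \<open>s \<subseteq> {1,\<dots>,n}\<close> for which the
  monomial of degree \<open>c - s\<close> lies in \<open>N\<close>; a face with \<open>i\<close> vertices sits in homological degree \<open>i\<close>
  (\<open>betti_eq_hdim\<close>). As Betti numbers are defined through an arbitrary graded free resolution of \<open>k\<close>,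
  this needs the comparison theorem, proved here for complexes of vector spaces whose basis elements
  are labelled by degrees (\<open>lhom_le\<close>), and the exactness of the Koszul complex, which in
  every nonzero degree is zero or the chain complex of a cone.

  The complex \<open>K\<close> of \<open>I\<close> in degree \<open>b\<close> has its faces inside \<open>F\<close>, because \<open>b\<close> vanishes outside \<open>F\<close>.
  A monomial \<open>x\<^sup>u\<close> lies in \<open>I\<^sup>a\<close> exactly if \<open>x\<^bsup>a-u\<^esup>\<close>, with truncated subtraction, does not lie in
  \<open>I\<close> (\<open>alexander_dual_eq\<close>). Hence the combinatorial Alexander dual of \<open>K\<close> within \<open>F\<close> is the part over
  \<open>F\<close> of the complex of \<open>I\<^sup>a\<close> in the degree that agrees with \<open>b\<^sup>a\<close> on \<open>F\<close> and with \<open>a\<close> elsewhere.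
  Alexander duality (\<open>Alexander_duality\<close>) turns \<open>i\<close> into \<open>|F| - i - 1\<close>.

  It remains to pass from the faces inside \<open>F\<close> to all faces. Adding a vertex \<open>m\<close> to the vertex set
  gives a long exact sequence whose third term is the same complex in the degree with \<open>c\<^sub>m\<close> lowered by
  one (\<open>hdim_add_vertex\<close>). Iterating it until \<open>c\<^sub>m\<close> is negative and the complex is empty bounds the
  homology over \<open>F\<close> by the sum of the homology over \<open>F \<union> {m}\<close> in the degrees whose
  \<open>m\<close>-th coordinate is replaced by a value between \<open>0\<close> and \<open>c\<^sub>m\<close> (\<open>hdim_faces_telescope\<close>). Doing this for all vertices outside \<open>F\<close> yields the sum
  of the theorem, restricted to the degrees that lie between \<open>0\<close> and \<open>a\<close> outside \<open>F\<close>
  (\<open>hdim_faces_le_box\<close>); in the other degrees the complex is empty or a cone, so the Betti number is zero.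
\<close>

section \<open>Dimensions of subquotients\<close>

text \<open>All homology groups below occur only through the difference \<open>dim Z - dim B\<close>. A linear
  relation from \<open>Z1\<close> to \<open>Z2\<close> that is everywhere defined and relates only elements of \<open>B1\<close> to
  elements of \<open>B2\<close> makes \<open>Z1 / B1\<close> a subquotient of \<open>Z2 / B2\<close>. Allowing a relation instead of a
  map covers the partial inverses that occur in long exact sequences.\<close>

lemma subquotient_dim_le:
  assumes vs: "vector_space s1" "vector_space s2"
    and Z1: "module.subspace s1 Z1" and B1: "module.subspace s1 B1" "B1 \<subseteq> Z1"
    and B2: "module.subspace s2 B2" "B2 \<subseteq> Z2" and Z2: "module.subspace s2 Z2"
    and fin1: "finite T1" "Z1 \<subseteq> module.span s1 T1"
    and fin2: "finite T2" "Z2 \<subseteq> module.span s2 T2"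
    and ex: "\<And>z. z \<in> Z1 \<Longrightarrow> \<exists>y\<in>Z2. R z y"
    and R0: "R 0 0"
    and Radd: "\<And>x y x' y'. R x y \<Longrightarrow> R x' y' \<Longrightarrow> R (x + x') (y + y')"
    and Rscale: "\<And>c x y. R x y \<Longrightarrow> R (s1 c x) (s2 c y)"
    and inj: "\<And>z y. z \<in> Z1 \<Longrightarrow> R z y \<Longrightarrow> y \<in> B2 \<Longrightarrow> z \<in> B1"
  shows "vector_space.dim s1 Z1 - vector_space.dim s1 B1
     \<le> vector_space.dim s2 Z2 - vector_space.dim s2 B2"
proof -
  interpret v1: vector_space s1 by fact
  interpret v2: vector_space s2 by fact
  obtain b where b: "b \<subseteq> B1" "v1.independent b" "B1 \<subseteq> v1.span b"
    using v1.maximal_independent_subset by blast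
  obtain c where c: "b \<subseteq> c" "c \<subseteq> Z1" "v1.independent c" "Z1 \<subseteq> v1.span c"
    using v1.maximal_independent_subset_extend[of b Z1] b B1(2) by blast
  obtain b2 where b2: "b2 \<subseteq> B2" "v2.independent b2" "B2 \<subseteq> v2.span b2"
    using v2.maximal_independent_subset by blast
  have finc: "finite c"
    using v1.independent_span_bound[OF fin1(1) c(3)] c(2) fin1(2) by blast
  have finb2: "finite b2"
    using v2.independent_span_bound[OF fin2(1) b2(2)] b2(1) B2(2) fin2(2) by blast
  have spb: "v1.span b = B1"
    using b v1.span_minimal[OF b(1) B1(1)] by blast
  have spb2: "v2.span b2 = B2"
    using b2 v2.span_minimal[OF b2(1) B2(1)] by blast
  define g where "g z = (SOME y. y \<in> Z2 \<and> R z y)" for z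
  have g: "g z \<in> Z2 \<and> R z (g z)" if "z \<in> Z1" for z
    unfolding g_def by (rule someI_ex) (use ex[OF that] in blast)
  have Rspan: "\<exists>z\<in>v1.span E. R z y" if E: "E \<subseteq> Z1" and y: "y \<in> v2.span (g ` E)" for E y
    using y
  proof (induction rule: v2.span_induct_alt)
    case base
    then show ?case using R0 v1.span_zero by blast
  next
    case (step k x y)
    then obtain e z where "e \<in> E" "x = g e" "z \<in> v1.span E" "R z y" by blast
    then show ?case
      using E g Radd Rscale
      by (intro bexI[of _ "s1 k e + z"]) (auto intro: v1.span_add v1.span_scale v1.span_base)
  qed
  have Rdiff: "R (x - x') (y - y')" if "R x y" "R x' y'" for x y x' y'
    using Radd[OF that(1) Rscale[OF that(2), of "-1"]] by simp
  have key: "v2.independent (b2 \<union> g ` E) \<and> card (b2 \<union> g ` E) = card b2 + card E"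
    if "finite E" "E \<subseteq> c - b" for E
    using that
  proof (induction E rule: finite_induct)
    case empty
    then show ?case using b2 by simp
  next
    case (insert e E)
    have eZ: "e \<in> Z1" and EZ: "E \<subseteq> Z1" using insert c(2) by auto
    have "g e \<notin> v2.span (b2 \<union> g ` E)"
    proof
      assume "g e \<in> v2.span (b2 \<union> g ` E)"
      then obtain x y where xy: "x \<in> B2" "y \<in> v2.span (g ` E)" "g e = x + y"
        unfolding v2.span_Un spb2 by auto
      obtain z where z: "z \<in> v1.span E" "R z y" using Rspan[OF EZ xy(2)] by blast
      have zZ: "z \<in> Z1" using z(1) v1.span_minimal[OF EZ Z1] by blast
      have "R (e - z) (g e - y)" using Rdiff g[OF eZ] z(2) by blast
      then have "e - z \<in> B1"
        using inj[of "e - z" "g e - y"] xy v1.subspace_diff[OF Z1 eZ zZ] by simp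
      then have "(e - z) + z \<in> v1.span (b \<union> E)"
        unfolding v1.span_Un spb using z(1) by blast
      moreover have "b \<union> E \<subseteq> c - {e}" using insert c(1) by auto
      ultimately have "e \<in> v1.span (c - {e})" using v1.span_mono[of "b \<union> E" "c - {e}"] by auto
      then show False using c(3) insert.prems unfolding v1.dependent_def by blast
    qed
    then have ne: "g e \<notin> v2.span (b2 \<union> g ` E)" .
    then have "g e \<notin> b2 \<union> g ` E" using v2.span_base by metis
    moreover have "v2.independent (insert (g e) (b2 \<union> g ` E))"
      using v2.independent_insertI[OF ne] insert.IH insert.prems by simp
    ultimately show ?case
      using insert.IH insert.prems insert.hyps finb2 by simp
  qed
  have k: "v2.independent (b2 \<union> g ` (c - b))" "card (b2 \<union> g ` (c - b)) = card b2 + card (c - b)"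
    using key[of "c - b"] finc by auto
  obtain d where d: "b2 \<union> g ` (c - b) \<subseteq> d" "d \<subseteq> Z2" "v2.independent d" "Z2 \<subseteq> v2.span d"
  proof -
    have "g ` (c - b) \<subseteq> Z2" using c(2) g by (simp add: image_subset_iff subset_eq)
    then have "b2 \<union> g ` (c - b) \<subseteq> Z2" using b2(1) B2(2) by simp
    then show ?thesis
      using v2.maximal_independent_subset_extend[OF _ k(1)] that by metis
  qed
  have find: "finite d"
    using v2.independent_span_bound[OF fin2(1) d(3)] d(2) fin2(2) by blast
  have "card b2 + card (c - b) \<le> card d"
    using card_mono[OF find d(1)] k(2) by simp
  moreover have "card (c - b) = card c - card b"
    using finc c(1) by (simp add: card_Diff_subset finite_subset)
  moreover have "v1.dim Z1 = card c" "v1.dim B1 = card b" "v2.dim Z2 = card d" "v2.dim B2 = card b2"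
    using v1.basis_card_eq_dim v2.basis_card_eq_dim b c d b2 by metis+
  ultimately show ?thesis by simp
qed

lemma subspace_dim_mono:
  assumes "vector_space s" "module.subspace s B" "B \<subseteq> Z" "finite T" "Z \<subseteq> module.span s T"
  shows "vector_space.dim s B \<le> vector_space.dim s Z"
proof -
  interpret v: vector_space s by fact
  obtain b where b: "b \<subseteq> B" "v.independent b" "B \<subseteq> v.span b"
    using v.maximal_independent_subset by blast
  obtain c where c: "b \<subseteq> c" "c \<subseteq> Z" "v.independent c" "Z \<subseteq> v.span c"
    using v.maximal_independent_subset_extend[of b Z] b assms(3) by blast
  have "finite c" using v.independent_span_bound[OF assms(4) c(3)] c(2) assms(5) by blast
  then show ?thesis
    using v.basis_card_eq_dim b c card_mono by metis
qed

section \<open>Scalar vectors\<close>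

definition fscale :: "'k::field \<Rightarrow> ('x \<Rightarrow> 'k) \<Rightarrow> 'x \<Rightarrow> 'k" where
  "fscale c f = (\<lambda>x. c * f x)"

interpretation fs: vector_space "fscale :: 'k::field \<Rightarrow> ('x \<Rightarrow> 'k) \<Rightarrow> 'x \<Rightarrow> 'k"
  by unfold_locales (auto simp: fscale_def fun_eq_iff algebra_simps)

definition supp_in :: "'x set \<Rightarrow> ('x \<Rightarrow> 'k::field) set" where
  "supp_in X = {f. \<forall>x. x \<notin> X \<longrightarrow> f x = 0}"

definition unit_at :: "'x \<Rightarrow> 'x \<Rightarrow> 'k::field" where
  "unit_at x = (\<lambda>y. if y = x then 1 else 0)"

lemma sum_fun_apply: "(\<Sum>a\<in>A. f a) x = (\<Sum>a\<in>A. f a x)"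
  for f :: "'a \<Rightarrow> 'x \<Rightarrow> 'b::comm_monoid_add"
  by (induction A rule: infinite_finite_induct) auto

lemma fscale_apply [simp]: "fscale c f x = c * f x"
  by (simp add: fscale_def)

lemma subspace_supp_in: "fs.subspace (supp_in X)"
  by (auto simp: fs.subspace_def supp_in_def)

lemma supp_in_decomp:
  assumes "finite X" "f \<in> supp_in X"
  shows "f = (\<Sum>x\<in>X. fscale (f x) (unit_at x))"
proof
  fix y
  show "f y = (\<Sum>x\<in>X. fscale (f x) (unit_at x)) y"
    using assms by (auto simp: sum_fun_apply unit_at_def supp_in_def if_distrib cong: if_cong)
qed

lemma supp_in_span: "finite X \<Longrightarrow> supp_in X \<subseteq> fs.span (unit_at ` X)"
proof
  fix f :: "'a \<Rightarrow> 'b" assume X: "finite X" and f: "f \<in> supp_in X"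
  have "(\<Sum>x\<in>X. fscale (f x) (unit_at x)) \<in> fs.span (unit_at ` X)"
    by (intro fs.span_sum fs.span_scale fs.span_base) auto
  then show "f \<in> fs.span (unit_at ` X)" using supp_in_decomp[OF X f] by simp
qed

lemma subset_supp_in_UNIV: "A \<subseteq> supp_in UNIV"
  by (auto simp: supp_in_def)

lemma unit_at_inj: "inj (unit_at :: 'x \<Rightarrow> 'x \<Rightarrow> 'k::field)"
proof (rule injI)
  fix x y :: 'x assume "(unit_at x :: 'x \<Rightarrow> 'k) = unit_at y"
  then have "(unit_at x :: 'x \<Rightarrow> 'k) x = unit_at y x" by simp
  then show "x = y" by (simp add: unit_at_def split: if_splits)
qed

lemma independent_unit_at: "fs.independent (unit_at ` X :: ('x \<Rightarrow> 'k::field) set)"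
proof -
  have "(unit_at x :: 'x \<Rightarrow> 'k) \<notin> fs.span (unit_at ` X - {unit_at x})" for x
  proof
    assume *: "(unit_at x :: 'x \<Rightarrow> 'k) \<in> fs.span (unit_at ` X - {unit_at x})"
    have "unit_at ` X - {unit_at x} \<subseteq> {f :: 'x \<Rightarrow> 'k. f x = 0}"
      by (auto simp: unit_at_def)
    moreover have "fs.subspace {f :: 'x \<Rightarrow> 'k. f x = 0}"
      by (auto simp: fs.subspace_def)
    ultimately have "(unit_at x :: 'x \<Rightarrow> 'k) \<in> {f. f x = 0}"
      using * fs.span_minimal by blast
    then show False by (simp add: unit_at_def)
  qed
  then show ?thesis unfolding fs.dependent_def by auto
qed

lemma dim_supp_in: "finite X \<Longrightarrow> fs.dim (supp_in X :: ('x \<Rightarrow> 'k::field) set) = card X"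
proof -
  assume X: "finite X"
  have "card (unit_at ` X :: ('x \<Rightarrow> 'k) set) = card X"
    by (intro card_image inj_on_subset[OF unit_at_inj]) simp
  moreover have "(unit_at ` X :: ('x \<Rightarrow> 'k) set) \<subseteq> supp_in X"
    by (auto simp: unit_at_def supp_in_def)
  ultimately show ?thesis
    using fs.basis_card_eq_dim[OF _ supp_in_span[OF X] independent_unit_at] by metis
qed

lemma subquotient_dim_le_map:
  fixes f :: "('x \<Rightarrow> 'k::field) \<Rightarrow> 'y \<Rightarrow> 'k"
  assumes "fs.subspace Z1" "fs.subspace B1" "B1 \<subseteq> Z1"
    and "fs.subspace Z2" "fs.subspace B2" "B2 \<subseteq> Z2"
    and "finite X1" "Z1 \<subseteq> supp_in X1" "finite X2" "Z2 \<subseteq> supp_in X2"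
    and lin: "Vector_Spaces.linear fscale fscale f"
    and f: "\<And>z. z \<in> Z1 \<Longrightarrow> f z \<in> Z2" "\<And>z. z \<in> Z1 \<Longrightarrow> f z \<in> B2 \<Longrightarrow> z \<in> B1"
  shows "fs.dim Z1 - fs.dim B1 \<le> fs.dim Z2 - fs.dim B2"
proof -
  interpret f: Vector_Spaces.linear fscale fscale f by fact
  have sp: "Z1 \<subseteq> fs.span (unit_at ` X1)" "Z2 \<subseteq> fs.span (unit_at ` X2)"
    using supp_in_span[OF assms(7)] supp_in_span[OF assms(9)] assms(8,10)
    by (meson order_trans)+
  show ?thesis
    by (rule subquotient_dim_le[where R = "\<lambda>z y. y = f z", OF fs.vector_space_axioms
          fs.vector_space_axioms assms(1-3) assms(5,6,4) finite_imageI[OF assms(7)] sp(1)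
          finite_imageI[OF assms(9)] sp(2)])
      (use f f.add f.scale f.zero in metis)+
qed

section \<open>Orthogonal complements\<close>

text \<open>Over an arbitrary field the standard pairing may be isotropic, but it is still perfect: for
  independent vectors there is a dual system, which splits the whole space into the common kernel
  and a space of complementary dimension.\<close>

definition pairing :: "('x::finite \<Rightarrow> 'k::field) \<Rightarrow> ('x \<Rightarrow> 'k) \<Rightarrow> 'k" where
  "pairing f g = (\<Sum>x\<in>UNIV. f x * g x)"

lemma pairing_add_left: "pairing (f + g) h = pairing f h + pairing g h"
  and pairing_add_right: "pairing h (f + g) = pairing h f + pairing h g"
  and pairing_scale_left: "pairing (fscale c f) h = c * pairing f h"
  and pairing_scale_right: "pairing h (fscale c f) = c * pairing h f"
  and pairing_zero_left [simp]: "pairing 0 h = 0"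
  and pairing_zero_right [simp]: "pairing h 0 = 0"
  by (auto simp: pairing_def algebra_simps sum.distrib sum_distrib_left)

lemma pairing_sum_right: "pairing h (\<Sum>a\<in>A. f a) = (\<Sum>a\<in>A. pairing h (f a))"
  unfolding pairing_def sum_fun_apply sum_distrib_left by (rule sum.swap)

definition perp_in :: "'x::finite set \<Rightarrow> ('x \<Rightarrow> 'k::field) set \<Rightarrow> ('x \<Rightarrow> 'k) set" where
  "perp_in X P = {f \<in> supp_in X. \<forall>p\<in>P. pairing p f = 0}"

lemma subspace_perp_in: "fs.subspace (perp_in X P)"
  using subspace_supp_in[of X]
  by (auto simp: perp_in_def fs.subspace_def pairing_add_right pairing_scale_right)

lemma dual_system:
  fixes b :: "('x::finite \<Rightarrow> 'k::field) set"
  assumes "fs.independent b" "p \<in> b" "b \<subseteq> supp_in X"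
  shows "\<exists>x\<in>supp_in X. \<forall>q\<in>b. pairing q x = (if q = p then 1 else 0)"
proof -
  interpret k: vector_space "(*) :: 'k \<Rightarrow> 'k \<Rightarrow> 'k"
    by unfold_locales (auto simp: algebra_simps)
  interpret pr: vector_space_pair "fscale :: 'k \<Rightarrow> ('x \<Rightarrow> 'k) \<Rightarrow> 'x \<Rightarrow> 'k" "(*) :: 'k \<Rightarrow> 'k \<Rightarrow> 'k"
    by unfold_locales
  obtain \<phi> where lin: "Vector_Spaces.linear fscale (*) \<phi>"
    and \<phi>: "\<forall>q\<in>b. \<phi> q = (if q = p then 1 else 0)"
    using pr.linear_independent_extend[OF assms(1), of "\<lambda>q. if q = p then 1 else 0"] by blast
  interpret \<phi>: Vector_Spaces.linear fscale "(*)" \<phi> by fact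
  define x where "x = (\<lambda>y. if y \<in> X then \<phi> (unit_at y) else 0)"
  have "pairing q x = \<phi> q" if "q \<in> supp_in X" for q
  proof -
    have "\<phi> q = (\<Sum>y\<in>X. q y * \<phi> (unit_at y))"
      by (subst supp_in_decomp[of X q]) (use that in \<open>auto simp: \<phi>.sum \<phi>.scale\<close>)
    also have "\<dots> = pairing q x"
      unfolding pairing_def x_def by (rule sum.mono_neutral_cong_left) auto
    finally show ?thesis by simp
  qed
  moreover have "x \<in> supp_in X" by (auto simp: x_def supp_in_def)
  ultimately show ?thesis using \<phi> assms(3) by (metis subsetD)
qed

lemma dim_perp_in:
  fixes P :: "('x::finite \<Rightarrow> 'k::field) set"
  assumes "fs.subspace P" "P \<subseteq> supp_in X"
  shows "fs.dim (perp_in X P) + fs.dim P = card X"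
proof -
  obtain b where b: "b \<subseteq> P" "fs.independent b" "P \<subseteq> fs.span b"
    using fs.maximal_independent_subset by blast
  have finX: "finite X" by simp
  have finb: "finite b"
  proof -
    have "b \<subseteq> fs.span (unit_at ` X)"
      using b(1) assms(2) supp_in_span[OF finX] by (rule order_trans[OF order_trans])
    then show ?thesis
      using fs.independent_span_bound[OF finite_imageI[OF finX] b(2)] by simp
  qed
  have dimP: "fs.dim P = card b" using fs.basis_card_eq_dim[OF b(1,3,2)] by simp
  have perp_iff: "f \<in> perp_in X P \<longleftrightarrow> f \<in> supp_in X \<and> (\<forall>q\<in>b. pairing q f = 0)" for f
  proof -
    have "fs.subspace {p. pairing p f = 0}"
      by (auto simp: fs.subspace_def pairing_add_left pairing_scale_left)
    then have "pairing p f = 0" if "\<forall>q\<in>b. pairing q f = 0" "p \<in> fs.span b" for p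
      using fs.span_minimal[of b "{p. pairing p f = 0}"] that by blast
    then show ?thesis using b unfolding perp_in_def by blast
  qed
  obtain x where x: "\<And>p. p \<in> b \<Longrightarrow> x p \<in> supp_in X"
    "\<And>p q. p \<in> b \<Longrightarrow> q \<in> b \<Longrightarrow> pairing q (x p) = (if q = p then 1 else 0)"
  proof -
    have "\<forall>p\<in>b. \<exists>x. x \<in> supp_in X \<and> (\<forall>q\<in>b. pairing q x = (if q = p then 1 else 0))"
      using dual_system[OF b(2) _ order_trans[OF b(1) assms(2)]] by blast
    from bchoice[OF this] show ?thesis using that by blast
  qed
  define T where "T f = (\<lambda>q. if q \<in> b then pairing q f else 0)" for f
  define S where "S g = (\<Sum>p\<in>b. fscale (g p) (x p))" for g :: "('x \<Rightarrow> 'k) \<Rightarrow> 'k"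
  have PS: "pairing q (S g) = g q" if "q \<in> b" for q g
  proof -
    have "pairing q (S g) = (\<Sum>p\<in>b. g p * pairing q (x p))"
      by (simp only: S_def pairing_sum_right pairing_scale_right)
    also have "\<dots> = (\<Sum>p\<in>b. if p = q then g p else 0)"
      using x(2) that by (intro sum.cong) auto
    finally show ?thesis using finb that by simp
  qed
  have dims: "fs.dim (supp_in X :: ('x \<Rightarrow> 'k) set) = card X"
    "fs.dim (supp_in b :: (('x \<Rightarrow> 'k) \<Rightarrow> 'k) set) = card b"
    by (rule dim_supp_in[OF finX], rule dim_supp_in[OF finb])
  have zero: "fs.dim ({0} :: (('x \<Rightarrow> 'k) \<Rightarrow> 'k) set) = 0"
    using fs.dim_span_eq_card_independent[OF fs.independent_empty] by (simp only: fs.span_empty card.empty)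
  have sub: "perp_in X P \<subseteq> supp_in X" "{0} \<subseteq> (supp_in b :: (('x \<Rightarrow> 'k) \<Rightarrow> 'k) set)"
    by (auto simp: perp_in_def supp_in_def)
  have "fs.dim (supp_in X :: ('x \<Rightarrow> 'k) set) - fs.dim (perp_in X P)
      \<le> fs.dim (supp_in b :: (('x \<Rightarrow> 'k) \<Rightarrow> 'k) set) - fs.dim ({0} :: (('x \<Rightarrow> 'k) \<Rightarrow> 'k) set)"
  proof (rule subquotient_dim_le_map[where f = T, OF subspace_supp_in subspace_perp_in sub(1)
        subspace_supp_in fs.subspace_single_0 sub(2) finX order_refl finb order_refl])
    show "Vector_Spaces.linear fscale fscale T"
      by unfold_locales (auto simp: T_def fun_eq_iff pairing_add_right pairing_scale_right)
    fix z assume "z \<in> supp_in X" "T z \<in> {0}"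
    then show "z \<in> perp_in X P"
      unfolding perp_iff T_def by (auto simp: fun_eq_iff split: if_splits)
  qed (simp add: T_def supp_in_def)
  moreover have "fs.dim (supp_in b :: (('x \<Rightarrow> 'k) \<Rightarrow> 'k) set) - fs.dim ({0} :: (('x \<Rightarrow> 'k) \<Rightarrow> 'k) set)
      \<le> fs.dim (supp_in X :: ('x \<Rightarrow> 'k) set) - fs.dim (perp_in X P)"
  proof (rule subquotient_dim_le_map[where f = S, OF subspace_supp_in fs.subspace_single_0 sub(2)
        subspace_supp_in subspace_perp_in sub(1) finb order_refl finX order_refl])
    show "Vector_Spaces.linear fscale fscale S"
      by unfold_locales
        (auto simp: S_def fun_eq_iff sum_fun_apply algebra_simps sum.distrib sum_distrib_left)
    fix z :: "('x \<Rightarrow> 'k) \<Rightarrow> 'k" assume z: "z \<in> supp_in b" "S z \<in> perp_in X P"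
    have "z q = 0" for q
      using z PS[of q z] by (cases "q \<in> b") (auto simp: perp_iff supp_in_def)
    then show "z \<in> {0}" by auto
  next
    fix z :: "('x \<Rightarrow> 'k) \<Rightarrow> 'k"
    show "S z \<in> supp_in X"
      unfolding S_def using x(1)
      by (intro fs.subspace_sum[OF subspace_supp_in] fs.subspace_scale[OF subspace_supp_in]) auto
  qed
  moreover have "fs.dim (perp_in X P) \<le> fs.dim (supp_in X :: ('x \<Rightarrow> 'k) set)"
    by (rule subspace_dim_mono[OF fs.vector_space_axioms subspace_perp_in sub(1)
          finite_imageI[OF finX] supp_in_span[OF finX]])
  ultimately show ?thesis using dims zero dimP by linarith
qed

lemma dim_mono_supp_in:
  assumes "fs.subspace B" "B \<subseteq> Z" "finite X" "Z \<subseteq> supp_in X"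
  shows "fs.dim B \<le> fs.dim Z"
  by (rule subspace_dim_mono[OF fs.vector_space_axioms assms(1,2) finite_imageI[OF assms(3)]
        order_trans[OF assms(4) supp_in_span[OF assms(3)]]])

section \<open>Simplicial chains\<close>

text \<open>Chains on the full simplex with vertex set \<open>'n\<close> are functions on \<open>'n set\<close>. A face with
  \<open>j\<close> vertices has homological degree \<open>j\<close>, and the empty face is included, so the homology is
  reduced homology shifted by one. Any enumeration of the vertices serves to fix the signs.\<close>

definition sg :: "'n::finite \<Rightarrow> 'n set \<Rightarrow> 'k::field" where
  "sg m t = (-1) ^ card {x \<in> t. to_nat x < to_nat m}"

lemma sg_square [simp]: "sg m t * sg m t = 1"
  by (simp add: sg_def power_add[symmetric] mult_2[symmetric])

lemma sg_nonzero [simp]: "sg m t \<noteq> 0"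
  using sg_square[of m t] by (metis mult_zero_left zero_neq_one)

lemma sg_disjoint_union:
  assumes "s \<inter> t = {}"
  shows "(sg m (s \<union> t) :: 'k::field) = sg m s * sg m t"
proof -
  have "card {x \<in> s \<union> t. to_nat x < to_nat m}
      = card {x \<in> s. to_nat x < to_nat m} + card {x \<in> t. to_nat x < to_nat m}"
    by (subst card_Un_disjoint[symmetric]) (use assms in \<open>auto intro: arg_cong[where f = card]\<close>)
  then show ?thesis by (simp add: sg_def power_add)
qed

lemma sg_single: "sg m {x} = (if to_nat x < to_nat m then -1 else 1)"
proof -
  have "{y \<in> {x}. to_nat y < to_nat m} = (if to_nat x < to_nat m then {x} else {})" by auto
  then show ?thesis by (simp add: sg_def)
qed

lemma sg_insert: "x \<notin> t \<Longrightarrow> sg m (insert x t) = (if to_nat x < to_nat m then - sg m t else sg m t)"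
  using sg_disjoint_union[of "{x}" t m, where 'k = 'b]
  by (cases "to_nat x < to_nat m") (simp_all add: sg_single)

lemma sg_swap:
  assumes "m \<noteq> m'" "m \<notin> t" "m' \<notin> t"
  shows "sg m t * sg m' (insert m t) = - (sg m' t * sg m (insert m' t))"
proof -
  have "to_nat m \<noteq> to_nat m'" using assms(1) by simp
  then show ?thesis using assms by (simp add: sg_insert)
qed

definition bd :: "('n::finite set \<Rightarrow> 'k::field) \<Rightarrow> 'n set \<Rightarrow> 'k" where
  "bd f t = (\<Sum>m\<in>-t. sg m t * f (insert m t))"

lemma bd_add: "bd (f + g) = bd f + bd g"
  by (rule ext) (simp add: bd_def distrib_left sum.distrib)

lemma bd_scale: "bd (fscale c f) = fscale c (bd f)"
  by (rule ext) (simp add: bd_def sum_distrib_left mult.left_commute)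

lemma bd_diff: "bd (f - g) = bd f - bd g"
  by (rule ext) (simp add: bd_def right_diff_distrib sum_subtractf)

text \<open>In characteristic two a sum that equals its negative need not vanish; therefore the pairs of
  vertices are split by their order before they are matched.\<close>

lemma bd_bd: "bd (bd f) = 0"
proof
  fix t :: "'a set"
  define g where "g = (\<lambda>(m, m'). sg m t * sg m' (insert m t) * f (insert m' (insert m t)))"
  define S where "S = {(m, m'). m \<notin> t \<and> m' \<notin> t \<and> to_nat m < to_nat m'}"
  have S_eq: "Sigma (-t) (\<lambda>m. - insert m t) = S \<union> prod.swap ` S"
  proof -
    have "m \<noteq> m' \<longleftrightarrow> to_nat m < to_nat m' \<or> to_nat m' < to_nat m" for m m' :: 'a
      using inj_eq[OF inj_to_nat, of m m'] by linarith
    then show ?thesis unfolding S_def by (auto simp: image_iff)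
  qed
  have "bd (bd f) t = (\<Sum>m\<in>-t. \<Sum>m'\<in>-insert m t. g (m, m'))"
    by (simp add: bd_def g_def sum_distrib_left mult.assoc)
  also have "\<dots> = sum g (S \<union> prod.swap ` S)"
    by (simp add: sum.Sigma S_eq)
  also have "\<dots> = sum g S + sum g (prod.swap ` S)"
    by (rule sum.union_disjoint) (auto simp: S_def)
  also have "sum g (prod.swap ` S) = sum (g \<circ> prod.swap) S"
    by (rule sum.reindex) auto
  also have "sum (g \<circ> prod.swap) S = (\<Sum>p\<in>S. - g p)"
  proof (rule sum.cong[OF refl])
    fix p assume "p \<in> S"
    then obtain m m' where p: "p = (m, m')" "m \<notin> t" "m' \<notin> t" "m \<noteq> m'"
      unfolding S_def by auto
    have "insert m' (insert m t) = insert m (insert m' t)" by blast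
    then show "(g \<circ> prod.swap) p = - g p"
      using p sg_swap[of m m' t, where 'b = 'b] by (simp add: g_def)
  qed
  finally show "bd (bd f) t = 0 t" by (simp add: sum_negf)
qed

definition cone :: "'n::finite \<Rightarrow> ('n set \<Rightarrow> 'k::field) \<Rightarrow> 'n set \<Rightarrow> 'k" where
  "cone v f s = (if v \<in> s then sg v (s - {v}) * f (s - {v}) else 0)"

lemma cone_add: "cone v (f + g) = cone v f + cone v g"
  by (rule ext) (simp add: cone_def distrib_left)

lemma cone_scale: "cone v (fscale c f) = fscale c (cone v f)"
  by (rule ext) (simp add: cone_def mult.left_commute)

text \<open>Joining with \<open>v\<close> contracts the full simplex.\<close>

lemma cone_homotopy: "bd (cone v f) + cone v (bd f) = f"
proof
  fix t
  show "(bd (cone v f) + cone v (bd f)) t = f t"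
  proof (cases "v \<in> t")
    case False
    have "bd (cone v f) t = (\<Sum>m\<in>{v}. sg m t * cone v f (insert m t))"
      unfolding bd_def by (rule sum.mono_neutral_right) (use False in \<open>auto simp: cone_def\<close>)
    also have "\<dots> = f t"
      using False by (simp add: cone_def mult.assoc[symmetric])
    finally show ?thesis using False by (simp add: cone_def)
  next
    case True
    define r where "r = t - {v}"
    have t: "t = insert v r" "v \<notin> r" using True by (auto simp: r_def)
    have "bd (cone v f) t = (\<Sum>m\<in>-t. sg m t * (sg v (insert m r) * f (insert m r)))"
    proof -
      have "cone v f (insert m t) = sg v (insert m r) * f (insert m r)" if "m \<in> -t" for m
      proof -
        have "insert m t - {v} = insert m r" using that t by auto
        then show ?thesis using True by (simp add: cone_def)
      qed
      then show ?thesis by (simp add: bd_def)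
    qed
    also have "\<dots> = (\<Sum>m\<in>-t. - (sg v r * (sg m r * f (insert m r))))"
    proof (rule sum.cong[OF refl])
      fix m assume "m \<in> -t"
      then have "sg v r * sg m (insert v r) = - (sg m r * sg v (insert m r) :: 'b)"
        using sg_swap[of v m r] t by auto
      moreover have "(sg m r * sg m r :: 'b) = 1" "(sg v r * sg v r :: 'b) = 1"
        "(sg v (insert m r) * sg v (insert m r) :: 'b) = 1" by simp_all
      ultimately have E: "sg m (insert v r) * sg v (insert m r) = - (sg v r * sg m r :: 'b)"
        by algebra
      then show "sg m t * (sg v (insert m r) * f (insert m r)) = - (sg v r * (sg m r * f (insert m r)))"
        unfolding t by (simp only: mult.assoc[symmetric] E) simp
    qed
    finally have 1: "bd (cone v f) t = - (\<Sum>m\<in>-t. sg v r * (sg m r * f (insert m r)))"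
      by (simp add: sum_negf)
    have "-r = insert v (-t)" using t by auto
    then have "cone v (bd f) t = sg v r * (sg v r * f t + (\<Sum>m\<in>-t. sg m r * f (insert m r)))"
      using True t by (simp add: cone_def bd_def r_def[symmetric])
    then have "cone v (bd f) t = f t + (\<Sum>m\<in>-t. sg v r * (sg m r * f (insert m r)))"
      by (simp add: distrib_left sum_distrib_left mult.assoc[symmetric])
    then show ?thesis using 1 by simp
  qed
qed

text \<open>For a simplicial complex \<open>X\<close> the restriction to \<open>X\<close> in the differential has no effect. It
  matters for the complement of a simplicial complex in a simplex, where it gives the relative
  chain complex.\<close>

definition bdX :: "'n::finite set set \<Rightarrow> ('n set \<Rightarrow> 'k::field) \<Rightarrow> 'n set \<Rightarrow> 'k" where
  "bdX X f = (\<lambda>t. if t \<in> X then bd f t else 0)"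

definition schains :: "'n::finite set set \<Rightarrow> nat \<Rightarrow> ('n set \<Rightarrow> 'k::field) set" where
  "schains X j = supp_in {s \<in> X. card s = j}"

definition cyc :: "'n::finite set set \<Rightarrow> nat \<Rightarrow> ('n set \<Rightarrow> 'k::field) set" where
  "cyc X j = {f \<in> schains X j. bdX X f = 0}"

definition bnd :: "'n::finite set set \<Rightarrow> nat \<Rightarrow> ('n set \<Rightarrow> 'k::field) set" where
  "bnd X j = bdX X ` schains X (Suc j)"

definition hdim :: "'k::field itself \<Rightarrow> 'n::finite set set \<Rightarrow> nat \<Rightarrow> nat" where
  "hdim _ X j = fs.dim (cyc X j :: ('n set \<Rightarrow> 'k) set) - fs.dim (bnd X j :: ('n set \<Rightarrow> 'k) set)"

definition simplicial :: "'a set set \<Rightarrow> bool" where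
  "simplicial X \<longleftrightarrow> (\<forall>s\<in>X. \<forall>t\<subseteq>s. t \<in> X)"

lemma simplicialD: "simplicial X \<Longrightarrow> s \<in> X \<Longrightarrow> t \<subseteq> s \<Longrightarrow> t \<in> X"
  unfolding simplicial_def by blast

lemma schainsD: "f \<in> schains X j \<Longrightarrow> f s \<noteq> 0 \<Longrightarrow> s \<in> X \<and> card s = j"
  unfolding schains_def supp_in_def by blast

lemma schainsI: "(\<And>s. f s \<noteq> 0 \<Longrightarrow> s \<in> X \<and> card s = j) \<Longrightarrow> f \<in> schains X j"
  unfolding schains_def supp_in_def by blast

lemma subspace_chains: "fs.subspace (schains X j)"
  unfolding schains_def by (rule subspace_supp_in)

lemma linear_bdX: "Vector_Spaces.linear fscale fscale (bdX X)"
  by unfold_locales (auto simp: bdX_def bd_add bd_scale fun_eq_iff)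

lemma subspace_cyc: "fs.subspace (cyc X j :: ('n::finite set \<Rightarrow> 'k::field) set)"
proof -
  interpret b: Vector_Spaces.linear fscale fscale "bdX X :: ('n set \<Rightarrow> 'k) \<Rightarrow> 'n set \<Rightarrow> 'k"
    by (rule linear_bdX)
  have "fs.subspace {f :: 'n set \<Rightarrow> 'k. bdX X f = 0}"
    by (auto simp: fs.subspace_def b.add b.scale b.zero)
  then have "fs.subspace (schains X j \<inter> {f :: 'n set \<Rightarrow> 'k. bdX X f = 0})"
    by (rule fs.subspace_inter[OF subspace_chains])
  moreover have "schains X j \<inter> {f :: 'n set \<Rightarrow> 'k. bdX X f = 0} = cyc X j" by (auto simp: cyc_def)
  ultimately show ?thesis by simp
qed

lemma subspace_bnd: "fs.subspace (bnd X j :: ('n::finite set \<Rightarrow> 'k::field) set)"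
proof -
  interpret b: Vector_Spaces.linear fscale fscale "bdX X :: ('n set \<Rightarrow> 'k) \<Rightarrow> 'n set \<Rightarrow> 'k"
    by (rule linear_bdX)
  show ?thesis unfolding bnd_def by (rule b.subspace_image[OF subspace_chains])
qed

lemma bd_chains_card:
  assumes "f \<in> schains X (Suc j)" "bd f t \<noteq> 0"
  shows "\<exists>m. m \<notin> t \<and> insert m t \<in> X \<and> card t = j"
proof -
  obtain m where "m \<in> -t" "sg m t * f (insert m t) \<noteq> 0"
    using assms(2) unfolding bd_def by (meson sum.not_neutral_contains_not_neutral)
  then have "m \<notin> t" "insert m t \<in> X \<and> card (insert m t) = Suc j"
    using schainsD[OF assms(1), of "insert m t"] by auto
  then show ?thesis by (metis card_insert_disjoint finite nat.inject)
qed

lemma bdX_chains: "f \<in> schains X (Suc j) \<Longrightarrow> bdX Y f \<in> schains Y j"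
  by (rule schainsI) (metis bd_chains_card bdX_def)

lemma bdX_simplicial: "simplicial X \<Longrightarrow> f \<in> schains X j \<Longrightarrow> bdX X f = bd f"
proof
  fix t assume X: "simplicial X" and f: "f \<in> schains X j"
  have "f (insert m t) = 0" if "t \<notin> X" for m
    using that schainsD[OF f, of "insert m t"] simplicialD[OF X, of "insert m t" t] by blast
  then show "bdX X f t = bd f t" by (simp add: bdX_def bd_def)
qed

lemma bnd_subset_cyc:
  assumes convex: "\<And>s r t. s \<in> X \<Longrightarrow> t \<in> X \<Longrightarrow> t \<subseteq> r \<Longrightarrow> r \<subseteq> s \<Longrightarrow> r \<in> X"
  shows "bnd X j \<subseteq> cyc X j"
proof
  fix z :: "'a set \<Rightarrow> 'b" assume "z \<in> bnd X j"
  then obtain f where f: "f \<in> schains X (Suc j)" "z = bdX X f" by (auto simp: bnd_def)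
  have "bdX X z t = 0" for t
  proof (cases "t \<in> X")
    case True
    have "z (insert m t) = bd f (insert m t)" for m
    proof (cases "insert m t \<in> X")
      case False
      have "bd f (insert m t) = 0"
      proof (rule ccontr)
        assume "bd f (insert m t) \<noteq> 0"
        then obtain m' where "insert m' (insert m t) \<in> X" using bd_chains_card[OF f(1)] by blast
        then show False using convex[OF _ True, of _ "insert m t"] False by blast
      qed
      then show ?thesis using f(2) by (simp add: bdX_def)
    qed (use f(2) in \<open>simp add: bdX_def\<close>)
    then have "bd z t = bd (bd f) t" by (simp add: bd_def[of z] bd_def[of "bd f"])
    then show ?thesis by (simp add: bdX_def bd_bd)
  qed (simp add: bdX_def)
  then show "z \<in> cyc X j"
    using bdX_chains[OF f(1), of X] unfolding cyc_def f(2) by (simp add: fun_eq_iff f(2))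
qed

lemma bnd_subset_cyc_simplicial: "simplicial X \<Longrightarrow> bnd X j \<subseteq> cyc X j"
  by (rule bnd_subset_cyc) (meson simplicialD)

lemma cyc_subset: "cyc X j \<subseteq> schains X j"
  unfolding cyc_def by blast

lemma cone_chains:
  assumes "f \<in> schains X j" "\<And>s. s \<in> X \<Longrightarrow> insert v s \<in> Y"
  shows "cone v f \<in> schains Y (Suc j)"
proof (rule schainsI)
  fix s assume s: "cone v f s \<noteq> 0"
  then have v: "v \<in> s" and "f (s - {v}) \<noteq> 0" by (auto simp: cone_def split: if_splits)
  then have X: "s - {v} \<in> X" and c: "card (s - {v}) = j" using schainsD[OF assms(1)] by auto
  have "insert v (s - {v}) = s" using v by blast
  then have "s \<in> Y" using assms(2)[OF X] by simp
  moreover have "card s = Suc (card (s - {v}))" by (rule card_Suc_Diff1[OF finite v, symmetric])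
  ultimately show "s \<in> Y \<and> card s = Suc j" using c by simp
qed

text \<open>If \<open>X\<close> is closed under adding \<open>v\<close>, the contraction stays inside \<open>X\<close>.\<close>

lemma hdim_cone:
  assumes X: "simplicial X" and v: "\<And>s. s \<in> X \<Longrightarrow> insert v s \<in> X"
  shows "hdim TYPE('k::field) X j = 0"
proof -
  have "cyc X j \<subseteq> (bnd X j :: ('a set \<Rightarrow> 'k) set)"
  proof
    fix z :: "'a set \<Rightarrow> 'k" assume z: "z \<in> cyc X j"
    then have zc: "z \<in> schains X j" and "bdX X z = 0" by (simp_all add: cyc_def)
    then have "bd z = 0" using bdX_simplicial[OF X zc] by simp
    then have "bd (cone v z) = z"
    proof -
      have "cone v (0 :: 'a set \<Rightarrow> 'k) = 0" by (simp add: fun_eq_iff cone_def)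
      then show ?thesis using cone_homotopy[of v z] \<open>bd z = 0\<close> by simp
    qed
    moreover have "cone v z \<in> schains X (Suc j)" by (rule cone_chains[OF zc v])
    ultimately show "z \<in> bnd X j"
      unfolding bnd_def using bdX_simplicial[OF X, of "cone v z" "Suc j"] by (intro image_eqI) simp_all
  qed
  then have "cyc X j = (bnd X j :: ('a set \<Rightarrow> 'k) set)"
    by (rule subset_antisym[OF _ bnd_subset_cyc_simplicial[OF X]])
  then show ?thesis by (simp add: hdim_def)
qed

lemma bnd_subset_cyc_relative:
  assumes K: "simplicial K"
  shows "bnd (Pow F - K) j \<subseteq> cyc (Pow F - K) j"
proof (rule bnd_subset_cyc)
  fix s r t assume "s \<in> Pow F - K" "t \<in> Pow F - K" "t \<subseteq> r" "r \<subseteq> s"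
  then show "r \<in> Pow F - K" using simplicialD[OF K, of r t] by blast
qed

lemma hdim_no_faces:
  assumes "\<And>s. s \<in> X \<Longrightarrow> card s \<noteq> j"
  shows "hdim TYPE('k::field) X j = 0"
proof -
  have "cyc X j \<subseteq> ({0} :: ('a set \<Rightarrow> 'k) set)"
  proof
    fix z :: "'a set \<Rightarrow> 'k" assume "z \<in> cyc X j"
    then have "z \<in> schains X j" by (simp add: cyc_def)
    then have "z s = 0" for s using schainsD[of z X j s] assms[of s] by blast
    then show "z \<in> {0}" by (simp add: fun_eq_iff)
  qed
  then have "fs.dim (cyc X j :: ('a set \<Rightarrow> 'k) set) \<le> fs.dim ({0} :: ('a set \<Rightarrow> 'k) set)"
    using dim_mono_supp_in[OF subspace_cyc, of X j "{0}" UNIV] by (simp add: supp_in_def)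
  also have "\<dots> = 0"
    using fs.dim_span_eq_card_independent[OF fs.independent_empty]
    by (simp only: fs.span_empty card.empty)
  finally show ?thesis by (simp add: hdim_def)
qed

section \<open>Adding a vertex\<close>

text \<open>The long exact sequence of the inclusion of \<open>X1\<close> in \<open>X2\<close>, read at one place: a cycle of \<open>X1\<close>
  that bounds in \<open>X2\<close> is, up to a boundary of \<open>X1\<close>, the link part of the chain that it bounds, and
  this is a cycle of \<open>X0\<close>.\<close>

lemma hdim_add_vertex:
  fixes m :: "'n::finite"
  assumes X1: "simplicial X1" and X0: "simplicial X0" "X0 \<subseteq> X1"
    and m: "\<And>s. s \<in> X1 \<Longrightarrow> m \<notin> s"
    and sX2: "simplicial X2" and X2: "X2 = X1 \<union> insert m ` X0"
  shows "hdim TYPE('k::field) X1 j \<le> hdim TYPE('k) X0 j + hdim TYPE('k) X2 j"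
proof -
  let ?Z0 = "cyc X0 j :: ('n set \<Rightarrow> 'k) set" and ?B0 = "bnd X0 j :: ('n set \<Rightarrow> 'k) set"
  let ?Z1 = "cyc X1 j :: ('n set \<Rightarrow> 'k) set" and ?B1 = "bnd X1 j :: ('n set \<Rightarrow> 'k) set"
  let ?Z2 = "cyc X2 j :: ('n set \<Rightarrow> 'k) set" and ?B2 = "bnd X2 j :: ('n set \<Rightarrow> 'k) set"
  let ?J = "?Z1 \<inter> ?B2"
  have J: "fs.subspace ?J" by (rule fs.subspace_inter[OF subspace_cyc subspace_bnd])
  note all = subset_supp_in_UNIV
  have id: "Vector_Spaces.linear fscale fscale (\<lambda>f :: 'n set \<Rightarrow> 'k. f)"
    by unfold_locales auto
  have schains12: "f \<in> schains X2 i" if "f \<in> schains X1 i" for f :: "'n set \<Rightarrow> 'k" and i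
    using that X2 by (auto simp: schains_def supp_in_def)
  have cyc_iff: "f \<in> cyc X i \<longleftrightarrow> f \<in> schains X i \<and> bd f = 0" if "simplicial X"
    for f :: "'n set \<Rightarrow> 'k" and X i
    using bdX_simplicial[OF that, of f i] by (auto simp: cyc_def)
  have Z12: "?Z1 \<subseteq> ?Z2"
    using schains12 by (auto simp: cyc_iff[OF X1] cyc_iff[OF sX2])
  have bnd_iff: "f \<in> bnd X i \<longleftrightarrow> (\<exists>w\<in>schains X (Suc i). f = bd w)" if "simplicial X"
    for f :: "'n set \<Rightarrow> 'k" and X i
    using bdX_simplicial[OF that] by (auto simp: bnd_def image_iff)
  have B12: "?B1 \<subseteq> ?B2"
    unfolding subset_iff bnd_iff[OF X1] bnd_iff[OF sX2] using schains12 by blast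
  have B01: "?B0 \<subseteq> ?B1"
  proof -
    have "f \<in> schains X1 i" if "f \<in> schains X0 i" for f :: "'n set \<Rightarrow> 'k" and i
      using that X0(2) by (auto simp: schains_def supp_in_def)
    then show ?thesis unfolding subset_iff bnd_iff[OF X1] bnd_iff[OF X0(1)] by blast
  qed
  have BZ: "?B0 \<subseteq> ?Z0" "?B1 \<subseteq> ?Z1" "?B2 \<subseteq> ?Z2"
    using bnd_subset_cyc_simplicial X0(1) X1 sX2 by metis+
  have "fs.dim ?Z1 - fs.dim ?J \<le> fs.dim ?Z2 - fs.dim ?B2"
    by (rule subquotient_dim_le_map[where f = "\<lambda>f. f", OF subspace_cyc J Int_lower1
          subspace_cyc subspace_bnd BZ(3) finite all finite all id]) (use Z12 in auto)
  \<comment> \<open>\<open>?J\<close> consists of the cycles of \<open>X1\<close> that become boundaries in \<open>X2\<close>.\<close>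
  moreover have "fs.dim ?J - fs.dim ?B1 \<le> fs.dim ?Z0 - fs.dim ?B0"
  proof (rule subquotient_dim_le[where R = "\<lambda>z y. z - y \<in> ?B1", OF fs.vector_space_axioms
        fs.vector_space_axioms J subspace_bnd _ subspace_bnd BZ(1) subspace_cyc
        finite_imageI[OF finite] order_trans[OF all supp_in_span[OF finite]]
        finite_imageI[OF finite] order_trans[OF all supp_in_span[OF finite]]])
    show "?B1 \<subseteq> ?J" using B12 BZ(2) by blast
    show "0 - 0 \<in> ?B1" using fs.subspace_0[OF subspace_bnd] by simp
    fix x y x' y' :: "'n set \<Rightarrow> 'k" and c :: 'k
    assume xy: "x - y \<in> ?B1"
    have "(fscale c x) - (fscale c y) = fscale c (x - y)"
      by (simp add: fun_eq_iff right_diff_distrib)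
    then show "(fscale c x) - (fscale c y) \<in> ?B1"
      using fs.subspace_scale[OF subspace_bnd xy] by simp
    {
      assume "x' - y' \<in> ?B1"
      then have "(x - y) + (x' - y') \<in> ?B1" by (rule fs.subspace_add[OF subspace_bnd xy])
      then show "x + x' - (y + y') \<in> ?B1" by (simp add: algebra_simps)
    }
    {
      assume "y \<in> ?B0"
      then have "(x - y) + y \<in> ?B1" using fs.subspace_add[OF subspace_bnd xy] B01 by blast
      then show "x \<in> ?B1" by simp
    }
  next
    fix z assume z: "z \<in> ?J"
    then obtain w where w: "w \<in> schains X2 (Suc j)" "z = bd w"
      using bnd_iff[OF sX2] by blast
    have zc: "z \<in> schains X1 j" using z by (auto simp: cyc_def)
    define w0 where "w0 s = (if m \<in> s then 0 else w s)" for s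
    define w1 where "w1 s = (if m \<in> s then 0 else sg m s * w (insert m s))" for s
    have "w0 \<in> schains X1 (Suc j)"
    proof (rule schainsI)
      fix s assume "w0 s \<noteq> 0"
      then have "m \<notin> s" "w s \<noteq> 0" by (auto simp: w0_def split: if_splits)
      then show "s \<in> X1 \<and> card s = Suc j" using schainsD[OF w(1)] X2 by blast
    qed
    have w1c: "w1 \<in> schains X0 j"
    proof (rule schainsI)
      fix s assume "w1 s \<noteq> 0"
      then have s: "m \<notin> s" "w (insert m s) \<noteq> 0" by (auto simp: w1_def split: if_splits)
      then have "insert m s \<in> X2" "card (insert m s) = Suc j" using schainsD[OF w(1)] by auto
      moreover have "insert m s \<notin> X1" using m[of "insert m s"] by blast
      ultimately obtain r where r: "r \<in> X0" "insert m s = insert m r" using X2 by blast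
      have "m \<notin> r" using m[of r] r(1) X0(2) by blast
      then have "r = s" using r(2) s(1) by (metis insert_ident)
      then show "s \<in> X0 \<and> card s = j"
        using r(1) s(1) \<open>card (insert m s) = Suc j\<close> by simp
    qed
    have "w = w0 + cone m w1"
      by (rule ext) (auto simp: w0_def w1_def cone_def insert_absorb mult.assoc[symmetric])
    then have z_eq: "z = bd w0 + bd (cone m w1)" using w(2) by (simp add: bd_add)
    have cone_eq: "bd (cone m w1) = w1 - cone m (bd w1)"
      using cone_homotopy[of m w1] by (simp add: algebra_simps)
    \<comment> \<open>Off the vertex \<open>m\<close> the boundary of \<open>w1\<close> is visible as the \<open>m\<close>-part of \<open>z\<close>, which is zero.\<close>
    have "bd w1 t = 0" for t
    proof (cases "m \<in> t")
      case True
      then show ?thesis by (simp add: bd_def w1_def)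
    next
      case False
      have "z (insert m t) = 0" using schainsD[OF zc, of "insert m t"] m by blast
      moreover have "bd w0 (insert m t) = 0" by (simp add: bd_def w0_def)
      moreover have "w1 (insert m t) = 0" by (simp add: w1_def)
      ultimately have "cone m (bd w1) (insert m t) = 0"
        using fun_cong[OF z_eq, of "insert m t"] fun_cong[OF cone_eq, of "insert m t"] by simp
      then show ?thesis using False by (simp add: cone_def)
    qed
    then have bw1: "bd w1 = 0" by (simp add: fun_eq_iff)
    then have "cone m (bd w1) = 0" by (simp add: cone_def fun_eq_iff)
    then have "z - w1 = bd w0" using z_eq cone_eq by simp
    then have "z - w1 \<in> ?B1" using \<open>w0 \<in> schains X1 (Suc j)\<close> bnd_iff[OF X1] by blast
    moreover have "w1 \<in> ?Z0" using w1c bw1 cyc_iff[OF X0(1)] by blast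
    ultimately show "\<exists>y\<in>?Z0. z - y \<in> ?B1" by blast
  qed
  ultimately show ?thesis unfolding hdim_def by linarith
qed

section \<open>Combinatorial Alexander duality\<close>

text \<open>The chains of the simplex on \<open>F\<close> that live on the complement \<open>Pow F - K\<close> form the relative
  complex. As the full simplex is acyclic, the connecting map is injective on homology; it is
  induced by the inverse of the boundary operator that coning provides.\<close>

lemma hdim_le_relative:
  fixes F :: "'n::finite set"
  assumes K: "simplicial K" "K \<subseteq> Pow F" and v: "v \<in> F"
  shows "hdim TYPE('k::field) K i \<le> hdim TYPE('k) (Pow F - K) (Suc i)"
proof -
  define U where "U = Pow F - K"
  let ?Z1 = "cyc K i :: ('n set \<Rightarrow> 'k) set" and ?B1 = "bnd K i :: ('n set \<Rightarrow> 'k) set"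
  let ?Z2 = "cyc U (Suc i) :: ('n set \<Rightarrow> 'k) set" and ?B2 = "bnd U (Suc i) :: ('n set \<Rightarrow> 'k) set"
  note all = subset_supp_in_UNIV
  have BZ1: "?B1 \<subseteq> ?Z1" by (rule bnd_subset_cyc_simplicial[OF K(1)])
  have BZ2: "?B2 \<subseteq> ?Z2" unfolding U_def by (rule bnd_subset_cyc_relative[OF K(1)])
  define f where "f z s = (if s \<in> U then cone v z s else 0)" for z :: "'n set \<Rightarrow> 'k" and s
  have lin: "Vector_Spaces.linear fscale fscale f"
    by unfold_locales (auto simp: f_def cone_add cone_scale fun_eq_iff)
  have cone_Pow: "cone v z \<in> schains (Pow F) (Suc i)" if "z \<in> ?Z1" for z
    by (rule cone_chains[of z K]) (use that K(2) v in \<open>auto simp: cyc_def\<close>)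
  have bd_cone: "bd (cone v z) = z" if "z \<in> ?Z1" for z
  proof -
    have "bd z = 0" using that bdX_simplicial[OF K(1), of z i] by (simp add: cyc_def)
    moreover have "cone v (0 :: 'n set \<Rightarrow> 'k) = 0" by (simp add: fun_eq_iff cone_def)
    ultimately show ?thesis using cone_homotopy[of v z] by simp
  qed
  have "fs.dim ?Z1 - fs.dim ?B1 \<le> fs.dim ?Z2 - fs.dim ?B2"
  proof (rule subquotient_dim_le_map[OF subspace_cyc subspace_bnd BZ1 subspace_cyc subspace_bnd
        BZ2 finite all finite all lin])
    fix z assume z: "z \<in> ?Z1"
    have "f z \<in> schains U (Suc i)"
      by (rule schainsI) (use schainsD[OF cone_Pow[OF z]] in \<open>auto simp: f_def split: if_splits\<close>)
    moreover have "bdX U (f z) t = 0" for t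
    proof (cases "t \<in> U")
      case True
      have "f z (insert m t) = cone v z (insert m t)" for m
      proof (cases "insert m t \<in> U")
        case False
        then have "insert m t \<notin> Pow F"
          using True simplicialD[OF K(1), of "insert m t" t] unfolding U_def by blast
        then have "cone v z (insert m t) = 0" using schainsD[OF cone_Pow[OF z]] by blast
        then show ?thesis using False by (simp add: f_def)
      qed (simp add: f_def)
      then have "bd (f z) t = bd (cone v z) t" by (simp add: bd_def)
      also have "\<dots> = z t" using bd_cone[OF z] by simp
      also have "\<dots> = 0"
      proof -
        have "t \<notin> K" using True by (simp add: U_def)
        then show ?thesis using schainsD[of z K i t] z by (auto simp: cyc_def)
      qed
      finally show ?thesis by (simp add: bdX_def)
    qed (simp add: bdX_def)
    ultimately show "f z \<in> ?Z2" by (simp add: cyc_def fun_eq_iff)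
    assume "f z \<in> ?B2"
    then obtain u where u: "u \<in> schains U (Suc (Suc i))" "f z = bdX U u" by (auto simp: bnd_def)
    have uP: "u \<in> schains (Pow F) (Suc (Suc i))"
      using u(1) by (auto simp: schains_def supp_in_def U_def)
    define w where "w = cone v z - bd u"
    have "bd w = z" by (simp add: w_def bd_diff bd_bd bd_cone[OF z])
    moreover have "w \<in> schains K (Suc i)"
    proof (rule schainsI)
      fix s assume s: "w s \<noteq> 0"
      have "simplicial (Pow F)" by (auto simp: simplicial_def)
      then have "bd u \<in> schains (Pow F) (Suc i)"
        using bdX_chains[OF uP, of "Pow F"] bdX_simplicial[OF _ uP] by simp
      then have "w \<in> schains (Pow F) (Suc i)"
        unfolding w_def by (rule fs.subspace_diff[OF subspace_chains cone_Pow[OF z]])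
      then have s': "s \<in> Pow F" "card s = Suc i" using schainsD s by blast+
      have "s \<notin> U"
      proof
        assume "s \<in> U"
        then have "w s = 0" using fun_cong[OF u(2), of s] by (simp add: w_def f_def bdX_def)
        then show False using s by simp
      qed
      then show "s \<in> K \<and> card s = Suc i" using s' by (simp add: U_def)
    qed
    ultimately show "z \<in> ?B1"
      unfolding bnd_def using bdX_simplicial[OF K(1), of w "Suc i"] by (intro image_eqI[of _ _ w]) simp_all
  qed
  then show ?thesis unfolding hdim_def U_def .
qed

definition cobd :: "('n::finite set \<Rightarrow> 'k::field) \<Rightarrow> 'n set \<Rightarrow> 'k" where
  "cobd h s = (\<Sum>m\<in>s. sg m (s - {m}) * h (s - {m}))"

lemma cobd_adjoint:
  fixes g h :: "'n::finite set \<Rightarrow> 'k::field"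
  shows "pairing (bd g) h = pairing g (cobd h)"
proof -
  let ?f = "\<lambda>(t, m). sg m t * g (insert m t) * h t"
  let ?A = "Sigma (UNIV :: 'n set set) (\<lambda>t. - t)" and ?B = "Sigma (UNIV :: 'n set set) (\<lambda>s. s)"
  have "pairing (bd g) h = (\<Sum>t\<in>UNIV. \<Sum>m\<in>-t. ?f (t, m))"
    by (simp add: pairing_def bd_def sum_distrib_right)
  also have "\<dots> = sum ?f ?A"
    by (subst sum.Sigma) auto
  also have "\<dots> = (\<Sum>(s, m)\<in>?B. g s * (sg m (s - {m}) * h (s - {m})))"
  proof (rule sum.reindex_bij_witness[of _ "\<lambda>(s, m). (s - {m}, m)" "\<lambda>(t, m). (insert m t, m)"])
    fix p assume "p \<in> ?A"
    then obtain t m where p: "p = (t, m)" "m \<notin> t" by auto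
    then have "insert m t - {m} = t" by simp
    then show "(case case p of (t, m) \<Rightarrow> (insert m t, m) of (s, m) \<Rightarrow> (s - {m}, m)) = p"
      and "(case case p of (t, m) \<Rightarrow> (insert m t, m) of (s, m) \<Rightarrow>
          g s * (sg m (s - {m}) * h (s - {m}))) = ?f p"
      using p by (simp_all add: ac_simps)
    show "(case p of (t, m) \<Rightarrow> (insert m t, m)) \<in> ?B" using p by simp
  next
    fix p assume "p \<in> ?B"
    then obtain s m where p: "p = (s, m)" "m \<in> s" by auto
    then show "(case case p of (s, m) \<Rightarrow> (s - {m}, m) of (t, m) \<Rightarrow> (insert m t, m)) = p"
      and "(case p of (s, m) \<Rightarrow> (s - {m}, m)) \<in> ?A"
      by (auto simp: insert_absorb)
  qed
  also have "\<dots> = (\<Sum>s\<in>UNIV. \<Sum>m\<in>s. g s * (sg m (s - {m}) * h (s - {m})))"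
    by (subst sum.Sigma) auto
  also have "\<dots> = pairing g (cobd h)"
    by (simp add: pairing_def cobd_def sum_distrib_left)
  finally show ?thesis .
qed

lemma pairing_unit_at: "pairing (unit_at t) f = f t"
proof -
  have "pairing (unit_at t) f = (\<Sum>x\<in>UNIV. if x = t then f x else 0)"
    unfolding pairing_def by (rule sum.cong) (auto simp: unit_at_def)
  then show ?thesis by simp
qed

text \<open>Complementation in \<open>F\<close> exchanges faces and cofaces. The sign is chosen so that it
  exchanges the boundary and the coboundary exactly: the faces \<open>s - {m}\<close>, \<open>{m}\<close> and \<open>F - s\<close>
  partition \<open>F\<close>, so the signs of \<open>m\<close> with respect to the first and the last multiply to that with
  respect to \<open>F\<close>.\<close>

definition dual_sign :: "'n::finite set \<Rightarrow> 'n set \<Rightarrow> 'k::field" where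
  "dual_sign F s = (\<Prod>x\<in>s. sg x F)"

definition dualize :: "'n::finite set \<Rightarrow> ('n set \<Rightarrow> 'k::field) \<Rightarrow> 'n set \<Rightarrow> 'k" where
  "dualize F f s = (if s \<subseteq> F then dual_sign F s * f (F - s) else 0)"

lemma dual_sign_square: "dual_sign F s * dual_sign F s = (1 :: 'k::field)"
  unfolding dual_sign_def prod.distrib[symmetric] by simp

lemma dual_sign_swap:
  assumes "m \<in> s" "s \<subseteq> F"
  shows "sg m (s - {m}) * dual_sign F (s - {m}) = dual_sign F s * (sg m (F - s) :: 'k::field)"
proof -
  have "{x \<in> F. to_nat x < to_nat m} = {x \<in> (s - {m}) \<union> (F - s). to_nat x < to_nat m}"
    using assms by auto
  then have "(sg m F :: 'k) = sg m ((s - {m}) \<union> (F - s))" by (simp only: sg_def)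
  also have "\<dots> = sg m (s - {m}) * sg m (F - s)" by (rule sg_disjoint_union) auto
  finally have 1: "(sg m F :: 'k) = sg m (s - {m}) * sg m (F - s)" .
  have 2: "(dual_sign F s :: 'k) = sg m F * dual_sign F (s - {m})"
    unfolding dual_sign_def by (rule prod.remove[OF finite assms(1)])
  have 3: "(sg m (F - s) * sg m (F - s) :: 'k) = 1" by simp
  show ?thesis using 1 2 3 by algebra
qed

lemma cobd_dualize:
  assumes f: "\<And>s. \<not> s \<subseteq> F \<Longrightarrow> f s = 0" and s: "s \<subseteq> F"
  shows "cobd (dualize F f) s = dualize F (bd f) s"
proof -
  have "cobd (dualize F f) s = (\<Sum>m\<in>s. dual_sign F s * (sg m (F - s) * f (insert m (F - s))))"
    unfolding cobd_def
  proof (rule sum.cong[OF refl])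
    fix m assume m: "m \<in> s"
    then have "F - (s - {m}) = insert m (F - s)" "s - {m} \<subseteq> F" using s by auto
    then have "sg m (s - {m}) * dualize F f (s - {m})
        = (sg m (s - {m}) * dual_sign F (s - {m})) * f (insert m (F - s))"
      by (simp add: dualize_def)
    then show "sg m (s - {m}) * dualize F f (s - {m})
        = dual_sign F s * (sg m (F - s) * f (insert m (F - s)))"
      by (simp only: dual_sign_swap[OF m s] mult.assoc)
  qed
  also have "\<dots> = dual_sign F s * (\<Sum>m\<in>s. sg m (F - s) * f (insert m (F - s)))"
    by (rule sum_distrib_left[symmetric])
  also have "(\<Sum>m\<in>s. sg m (F - s) * f (insert m (F - s)))
      = (\<Sum>m\<in>-(F - s). sg m (F - s) * f (insert m (F - s)))"
    by (rule sum.mono_neutral_left) (use s f in auto)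
  finally have 1: "cobd (dualize F f) s
      = dual_sign F s * (\<Sum>m\<in>-(F - s). sg m (F - s) * f (insert m (F - s)))" .
  have "dualize F (bd f) s = dual_sign F s * bd f (F - s)"
    using s by (simp add: dualize_def)
  then show ?thesis using 1 by (simp only: bd_def)
qed

text \<open>A relative cycle becomes a cochain that annihilates boundaries. Since cycles and coboundaries,
  as well as boundaries and cocycles, are orthogonal complements of one another, the dimensions of
  homology and cohomology agree.\<close>

lemma hdim_relative_le_dual:
  fixes F :: "'n::finite set"
  assumes K: "simplicial K" "K \<subseteq> Pow F" and ij: "i + j = card F"
  shows "hdim TYPE('k::field) (Pow F - K) i
    \<le> hdim TYPE('k) {t. t \<subseteq> F \<and> F - t \<notin> K} j"
proof -
  define U where "U = Pow F - K"
  define D where "D = {t. t \<subseteq> F \<and> F - t \<notin> K}"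
  have D_iff: "t \<in> D \<longleftrightarrow> t \<subseteq> F \<and> F - t \<in> U" for t by (auto simp: D_def U_def)
  have UD: "s \<in> U \<Longrightarrow> F - s \<in> D" for s
    using D_iff[of "F - s"] double_diff[of s F F] by (auto simp: U_def)
  have card_compl: "card (F - s) + card s = card F" if "s \<subseteq> F" for s
    using that by (simp add: card_Diff_subset finite_subset card_mono)
  have sD: "simplicial D"
    unfolding simplicial_def
  proof (intro ballI allI impI)
    fix s t assume "s \<in> D" "t \<subseteq> s"
    then show "t \<in> D" using simplicialD[OF K(1), of "F - t" "F - s"] by (auto simp: D_def)
  qed
  define Y where "Y = {t \<in> D. card t = j}"
  \<comment> \<open>\<open>Q\<close> is the space of coboundaries, written so that it also makes sense for \<open>j = 0\<close>.\<close>
  define \<delta> where "\<delta> g s = (if s \<in> D then cobd g s else 0)" for g :: "'n set \<Rightarrow> 'k" and s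
  define C where "C = (supp_in {s \<in> D. Suc (card s) = j} :: ('n set \<Rightarrow> 'k) set)"
  define Q where "Q = \<delta> ` C"
  let ?P = "bnd D j :: ('n set \<Rightarrow> 'k) set"
  note all = subset_supp_in_UNIV
  have PY: "?P \<subseteq> supp_in Y"
    using bnd_subset_cyc_simplicial[OF sD] cyc_subset
    unfolding Y_def schains_def[symmetric] by (rule order_trans)
  have lin\<delta>: "Vector_Spaces.linear fscale fscale \<delta>"
    by unfold_locales
      (auto simp: \<delta>_def cobd_def fun_eq_iff distrib_left sum.distrib sum_distrib_left mult.left_commute)
  interpret \<delta>: Vector_Spaces.linear fscale fscale \<delta> by (rule lin\<delta>)
  have subQ: "fs.subspace Q" unfolding Q_def C_def by (rule \<delta>.subspace_image[OF subspace_supp_in])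
  have QY: "Q \<subseteq> supp_in Y"
  proof -
    have "\<delta> g s = 0" if g: "g \<in> C" and s: "s \<notin> Y" for g s
    proof (cases "s \<in> D")
      case True
      have "g (s - {m}) = 0" if "m \<in> s" for m
      proof -
        have "Suc (card (s - {m})) \<noteq> j"
          using card_Suc_Diff1[OF finite that] s True by (simp add: Y_def)
        then show ?thesis using g by (simp add: C_def supp_in_def)
      qed
      then show ?thesis by (simp add: \<delta>_def cobd_def)
    qed (simp add: \<delta>_def)
    then show ?thesis unfolding Q_def by (auto simp: supp_in_def)
  qed
  have pair\<delta>: "pairing (\<delta> g) h = pairing (bd h) g" if "h \<in> schains D j" for g h
  proof -
    have "pairing (\<delta> g) h = (\<Sum>s\<in>UNIV. h s * cobd g s)"
      unfolding pairing_def
    proof (rule sum.cong[OF refl])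
      fix s show "\<delta> g s * h s = h s * cobd g s"
        using schainsD[OF that, of s] by (cases "h s = 0") (auto simp: \<delta>_def)
    qed
    also have "\<dots> = pairing h (cobd g)" by (simp only: pairing_def)
    finally show ?thesis by (simp only: cobd_adjoint)
  qed
  have cyc_perp: "cyc D j = perp_in Y Q"
  proof (intro set_eqI iffI)
    fix h :: "'n set \<Rightarrow> 'k" assume "h \<in> cyc D j"
    then have h: "h \<in> schains D j" "bd h = 0"
      using bdX_simplicial[OF sD, of h j] by (auto simp: cyc_def)
    then show "h \<in> perp_in Y Q"
      by (auto simp: perp_in_def Q_def pair\<delta> Y_def schains_def)
  next
    fix h assume h: "h \<in> perp_in Y Q"
    then have hc: "h \<in> schains D j" by (simp add: perp_in_def Y_def schains_def)
    have "bd h t = 0" for t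
    proof (cases "t \<in> D \<and> Suc (card t) = j")
      case True
      then have "unit_at t \<in> C" by (simp add: C_def supp_in_def unit_at_def)
      then have "pairing (\<delta> (unit_at t)) h = 0" using h by (auto simp: perp_in_def Q_def)
      then have "pairing (unit_at t) (bd h) = 0"
        using pair\<delta>[OF hc] by (simp add: pairing_def mult.commute)
      then show ?thesis by (simp add: pairing_unit_at)
    next
      case False
      have "h (insert m t) = 0" if "m \<notin> t" for m
      proof (rule ccontr)
        assume "h (insert m t) \<noteq> 0"
        then have "insert m t \<in> D" "card (insert m t) = j" using schainsD[OF hc] by blast+
        then show False using False that simplicialD[OF sD, of "insert m t" t] by auto
      qed
      then show ?thesis by (simp add: bd_def)
    qed
    then show "h \<in> cyc D j" using hc by (simp add: cyc_def bdX_def fun_eq_iff)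
  qed
  have Qperp: "Q \<subseteq> perp_in Y ?P"
  proof
    fix q assume q: "q \<in> Q"
    have "pairing p q = 0" if "p \<in> ?P" for p
    proof -
      have "p \<in> perp_in Y Q" using that bnd_subset_cyc_simplicial[OF sD, of j] cyc_perp by blast
      then have "pairing q p = 0" using q by (simp add: perp_in_def)
      then show ?thesis by (simp add: pairing_def mult.commute)
    qed
    then show "q \<in> perp_in Y ?P" using q QY by (auto simp: perp_in_def)
  qed
  have BZ: "(bnd U i :: ('n set \<Rightarrow> 'k) set) \<subseteq> cyc U i"
    unfolding U_def by (rule bnd_subset_cyc_relative[OF K(1)])
  have "fs.dim (cyc U i :: ('n set \<Rightarrow> 'k) set) - fs.dim (bnd U i :: ('n set \<Rightarrow> 'k) set)
      \<le> fs.dim (perp_in Y ?P) - fs.dim Q"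
  proof (rule subquotient_dim_le_map[where f = "dualize F", OF subspace_cyc subspace_bnd BZ
        subspace_perp_in subQ Qperp finite all finite all])
    show "Vector_Spaces.linear fscale fscale (dualize F :: ('n set \<Rightarrow> 'k) \<Rightarrow> _)"
      by unfold_locales (auto simp: dualize_def fun_eq_iff distrib_left)
    fix z :: "'n set \<Rightarrow> 'k" assume z: "z \<in> cyc U i"
    then have zc: "z \<in> schains U i" and zb: "bdX U z = 0" by (simp_all add: cyc_def)
    have zF: "\<not> s \<subseteq> F \<Longrightarrow> z s = 0" for s using schainsD[OF zc, of s] by (auto simp: U_def)
    have "dualize F z s = 0" if "s \<notin> Y" for s
    proof (cases "s \<subseteq> F \<and> z (F - s) \<noteq> 0")
      case True
      then have "F - s \<in> U" "card (F - s) = i" using schainsD[OF zc] by blast+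
      then have "s \<in> Y" using True card_compl[of s] ij by (simp add: Y_def D_iff)
      then show ?thesis using that by simp
    qed (auto simp: dualize_def)
    moreover have "pairing p (dualize F z) = 0" if p: "p \<in> ?P" for p
    proof -
      obtain g where g: "g \<in> schains D (Suc j)" "p = bd g"
        using p bdX_simplicial[OF sD] by (auto simp: bnd_def)
      have "g s * cobd (dualize F z) s = 0" for s
      proof (cases "s \<in> D")
        case True
        then have s: "s \<subseteq> F" "F - s \<in> U" using D_iff by blast+
        then have "bd z (F - s) = 0" using fun_cong[OF zb, of "F - s"] by (simp add: bdX_def)
        then show ?thesis using cobd_dualize[of F z s] zF s by (simp add: dualize_def)
      next
        case False
        then show ?thesis using schainsD[OF g(1), of s] by auto
      qed
      then have "pairing g (cobd (dualize F z)) = 0"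
        unfolding pairing_def by (intro sum.neutral) simp
      then show ?thesis by (simp only: g(2) cobd_adjoint)
    qed
    ultimately show "dualize F z \<in> perp_in Y ?P" unfolding perp_in_def supp_in_def by blast
    assume "dualize F z \<in> Q"
    then obtain g where g: "g \<in> C" "dualize F z = \<delta> g" by (auto simp: Q_def)
    \<comment> \<open>\<open>u\<close> is the preimage of \<open>g\<close> under dualization.\<close>
    define u where "u s = (if s \<subseteq> F then dual_sign F (F - s) * g (F - s) else 0)" for s
    have gD: "s \<in> D \<and> Suc (card s) = j" if "g s \<noteq> 0" for s
      using that g(1) by (auto simp: C_def supp_in_def)
    have du: "dualize F u = g"
    proof
      fix s show "dualize F u s = g s"
      proof (cases "s \<subseteq> F")
        case True
        then have "F - (F - s) = s" by blast
        then show ?thesis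
          using True dual_sign_square[of F s, where 'k = 'k]
          by (simp add: dualize_def u_def mult.assoc[symmetric])
      next
        case False
        then show ?thesis using gD[of s] D_iff[of s] by (auto simp: dualize_def)
      qed
    qed
    have uc: "u \<in> schains U (Suc i)"
    proof (rule schainsI)
      fix s assume "u s \<noteq> 0"
      then have s: "s \<subseteq> F" "g (F - s) \<noteq> 0" by (auto simp: u_def split: if_splits)
      then have "F - s \<in> D" "Suc (card (F - s)) = j" using gD by blast+
      moreover have "F - (F - s) = s" using s by blast
      ultimately show "s \<in> U \<and> card s = Suc i"
        using D_iff[of "F - s"] card_compl[OF s(1)] ij by simp
    qed
    have "bdX U u = z"
    proof
      fix t show "bdX U u t = z t"
      proof (cases "t \<in> U")
        case True
        then have t: "t \<subseteq> F" "F - t \<in> D" "F - (F - t) = t" using UD by (auto simp: U_def)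
        have "dual_sign F (F - t) * z t = dualize F z (F - t)" using t by (simp add: dualize_def)
        also have "\<dots> = cobd (dualize F u) (F - t)" using g(2) du t by (simp add: \<delta>_def)
        also have "\<dots> = dualize F (bd u) (F - t)" by (rule cobd_dualize) (auto simp: u_def)
        also have "\<dots> = dual_sign F (F - t) * bd u t" using t by (simp add: dualize_def)
        finally have "z t = bd u t"
          using dual_sign_square[of F "F - t", where 'k = 'k] by (metis mult.assoc mult_1)
        then show ?thesis using True by (simp add: bdX_def)
      next
        case False
        then show ?thesis using schainsD[OF zc, of t] by (auto simp: bdX_def)
      qed
    qed
    then show "z \<in> bnd U i" unfolding bnd_def using uc by (intro image_eqI[of _ _ u]) simp_all
  qed
  moreover have "fs.dim (perp_in Y ?P) + fs.dim ?P = card Y"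
    by (rule dim_perp_in[OF subspace_bnd PY])
  moreover have "fs.dim (cyc D j :: ('n set \<Rightarrow> 'k) set) + fs.dim Q = card Y"
    unfolding cyc_perp by (rule dim_perp_in[OF subQ QY])
  ultimately have "hdim TYPE('k) U i \<le> hdim TYPE('k) D j" unfolding hdim_def by linarith
  then show ?thesis unfolding U_def D_def .
qed

lemma Alexander_duality:
  fixes F :: "'n::finite set"
  assumes "simplicial K" "K \<subseteq> Pow F" "F \<noteq> {}" "Suc i + j = card F"
  shows "hdim TYPE('k::field) K i \<le> hdim TYPE('k) {t. t \<subseteq> F \<and> F - t \<notin> K} j"
proof -
  obtain v where v: "v \<in> F" using assms(3) by blast
  show ?thesis
    by (rule order_trans[OF hdim_le_relative[OF assms(1,2) v] hdim_relative_le_dual[OF assms(1,2,4)]])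
qed

section \<open>Labelled complexes of vector spaces\<close>

text \<open>Fixing bases, a multigraded free resolution is a complex of scalar matrices whose basis elements
  carry degrees as labels: an entry of a homogeneous matrix is determined by its coefficient. Its
  part in degree \<open>d\<close> is the subcomplex on the labels \<open>\<le> d\<close>, and after tensoring with a monomial
  ideal it is the subcomplex on a down-closed set of labels.\<close>

definition comb :: "'x set \<Rightarrow> ('x \<Rightarrow> 'y \<Rightarrow> 'k::field) \<Rightarrow> ('x \<Rightarrow> 'k) \<Rightarrow> 'y \<Rightarrow> 'k" where
  "comb X \<Phi> f = (\<lambda>y. \<Sum>x\<in>X. f x * \<Phi> x y)"

lemma comb_add: "comb X \<Phi> (f + g) = comb X \<Phi> f + comb X \<Phi> g"
  and comb_diff: "comb X \<Phi> (f - g) = comb X \<Phi> f - comb X \<Phi> g"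
  and comb_scale: "comb X \<Phi> (fscale c f) = fscale c (comb X \<Phi> f)"
  and comb_zero: "comb X \<Phi> 0 = 0"
  by (auto simp: comb_def fun_eq_iff distrib_right left_diff_distrib sum.distrib sum_subtractf
      sum_distrib_left mult.assoc)

lemma comb_diff_columns: "comb X (\<lambda>x. \<Phi> x - \<Psi> x) f = comb X \<Phi> f - comb X \<Psi> f"
  by (auto simp: comb_def fun_eq_iff right_diff_distrib sum_subtractf)

lemma linear_comb: "Vector_Spaces.linear fscale fscale (comb X \<Phi>)"
  by unfold_locales (simp_all add: comb_add comb_scale)

lemma comb_comb: "comb Y \<Psi> (comb X \<Phi> f) = comb X (\<lambda>x. comb Y \<Psi> (\<Phi> x)) f"
  unfolding comb_def
  by (rule ext) (simp add: sum_distrib_left sum_distrib_right mult.assoc sum.swap[of _ Y])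

lemma comb_cong: "(\<And>x. x \<in> X \<Longrightarrow> \<Phi> x = \<Psi> x) \<Longrightarrow> comb X \<Phi> f = comb X \<Psi> f"
  unfolding comb_def by (rule ext) (rule sum.cong, simp_all)

lemma comb_unit_at: "finite X \<Longrightarrow> f \<in> supp_in X \<Longrightarrow> comb X unit_at f = f"
proof
  fix y assume X: "finite X" "f \<in> supp_in X"
  have "comb X unit_at f y = (\<Sum>x\<in>X. if x = y then f x else 0)"
    unfolding comb_def by (rule sum.cong) (auto simp: unit_at_def)
  then show "comb X unit_at f y = f y" using X by (simp add: supp_in_def)
qed

lemma comb_of_unit: "finite X \<Longrightarrow> x \<in> X \<Longrightarrow> comb X \<Phi> (unit_at x) = \<Phi> x"
proof
  fix y assume X: "finite X" "x \<in> X"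
  have "comb X \<Phi> (unit_at x) y = (\<Sum>x'\<in>X. if x' = x then \<Phi> x' y else 0)"
    unfolding comb_def by (rule sum.cong) (auto simp: unit_at_def)
  then show "comb X \<Phi> (unit_at x) y = \<Phi> x y" using X by simp
qed

lemma comb_supp_in:
  assumes "\<And>x. x \<in> X \<Longrightarrow> f x \<noteq> 0 \<Longrightarrow> \<Phi> x \<in> supp_in S"
  shows "comb X \<Phi> f \<in> supp_in S"
proof -
  have "f x * \<Phi> x y = 0" if "x \<in> X" "y \<notin> S" for x y
    using assms[OF that(1)] that(2) by (cases "f x = 0") (auto simp: supp_in_def)
  then show ?thesis unfolding comb_def supp_in_def by (auto intro: sum.neutral)
qed

text \<open>\<open>df i q p\<close> is the coefficient of \<open>p\<close> in the boundary of \<open>q\<close>, and \<open>ep\<close> is the augmentation.\<close>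

record ('a, 'n, 'k) labelled_complex =
  gens :: "nat \<Rightarrow> 'a set"
  lab :: "nat \<Rightarrow> 'a \<Rightarrow> 'n \<Rightarrow> int"
  df :: "nat \<Rightarrow> 'a \<Rightarrow> 'a \<Rightarrow> 'k"
  ep :: "'a \<Rightarrow> 'k"

definition below :: "('a, 'n, 'k::field) labelled_complex \<Rightarrow> nat \<Rightarrow> ('n \<Rightarrow> int) set \<Rightarrow> ('a \<Rightarrow> 'k) set" where
  "below L i D = supp_in {p \<in> gens L i. lab L i p \<in> D}"

definition ldiff :: "('a, 'n, 'k::field) labelled_complex \<Rightarrow> nat \<Rightarrow> ('a \<Rightarrow> 'k) \<Rightarrow> 'a \<Rightarrow> 'k" where
  "ldiff L i = comb (gens L (Suc i)) (df L i)"

definition leps :: "('a, 'n, 'k::field) labelled_complex \<Rightarrow> ('a \<Rightarrow> 'k) \<Rightarrow> 'k" where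
  "leps L z = (\<Sum>p\<in>gens L 0. z p * ep L p)"

text \<open>The residue field is concentrated in degree zero, so in any other degree the augmentation
  imposes no condition.\<close>

fun lcycle :: "('a, 'n, 'k::field) labelled_complex \<Rightarrow> ('n \<Rightarrow> int) \<Rightarrow> nat \<Rightarrow> ('a \<Rightarrow> 'k) \<Rightarrow> bool" where
  "lcycle L d 0 z \<longleftrightarrow> (d = 0 \<longrightarrow> leps L z = 0)"
| "lcycle L d (Suc i) z \<longleftrightarrow> ldiff L i z = 0"

definition labelled_resolution :: "('a, 'n, 'k::field) labelled_complex \<Rightarrow> bool" where
  "labelled_resolution L \<longleftrightarrow>
     (\<forall>i. finite (gens L i)) \<and>
     (\<forall>i. \<forall>q\<in>gens L (Suc i). df L i q \<in> below L i {..lab L (Suc i) q}) \<and>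
     (\<forall>p\<in>gens L 0. ep L p \<noteq> 0 \<longrightarrow> lab L 0 p = 0) \<and>
     (\<forall>i. \<forall>q\<in>gens L (Suc i). lcycle L (lab L (Suc i) q) i (df L i q)) \<and>
     (\<exists>u\<in>below L 0 {..0}. leps L u = 1) \<and>
     (\<forall>d i. \<forall>z\<in>below L i {..d}. lcycle L d i z \<longrightarrow> (\<exists>w\<in>below L (Suc i) {..d}. ldiff L i w = z))"

definition downset :: "('n \<Rightarrow> int) set \<Rightarrow> bool" where
  "downset D \<longleftrightarrow> (\<forall>d\<in>D. \<forall>d'\<le>d. d' \<in> D)"

definition lhom :: "('a, 'n, 'k::field) labelled_complex \<Rightarrow> ('n \<Rightarrow> int) set \<Rightarrow> nat \<Rightarrow> nat" where
  "lhom L D i = fs.dim {z \<in> below L i D. \<forall>j. i = Suc j \<longrightarrow> ldiff L j z = 0}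
     - fs.dim (ldiff L i ` below L (Suc i) D)"

lemma subspace_below: "fs.subspace (below L i D)"
  unfolding below_def by (rule subspace_supp_in)

lemma belowD: "z \<in> below L i D \<Longrightarrow> z p \<noteq> 0 \<Longrightarrow> p \<in> gens L i \<and> lab L i p \<in> D"
  unfolding below_def supp_in_def by blast

lemma below_gens: "z \<in> below L i D \<Longrightarrow> z \<in> supp_in (gens L i)"
  unfolding below_def supp_in_def by blast

lemma below_mono: "D \<subseteq> D' \<Longrightarrow> z \<in> below L i D \<Longrightarrow> z \<in> below L i D'"
  unfolding below_def supp_in_def by blast

lemma leps_comb: "leps Q (comb X \<Phi> f) = (\<Sum>x\<in>X. f x * leps Q (\<Phi> x))"
proof -
  have "leps Q (comb X \<Phi> f) = (\<Sum>p\<in>gens Q 0. \<Sum>x\<in>X. f x * (\<Phi> x p * ep Q p))"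
    by (simp add: leps_def comb_def sum_distrib_right mult.assoc)
  also have "\<dots> = (\<Sum>x\<in>X. \<Sum>p\<in>gens Q 0. f x * (\<Phi> x p * ep Q p))" by (rule sum.swap)
  also have "\<dots> = (\<Sum>x\<in>X. f x * leps Q (\<Phi> x))" by (simp add: leps_def sum_distrib_left)
  finally show ?thesis .
qed

lemma ldiff_comb: "ldiff Q i (comb X \<Phi> f) = comb X (\<lambda>x. ldiff Q i (\<Phi> x)) f"
  unfolding ldiff_def by (rule comb_comb)

lemma comb_ldiff: "comb (gens P i) \<Phi> (ldiff P i f) = comb (gens P (Suc i)) (\<lambda>q. comb (gens P i) \<Phi> (df P i q)) f"
  unfolding ldiff_def by (rule comb_comb)

text \<open>A map whose columns respect the labels maps the part on any down-closed set of labels into the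
  corresponding part. This is why maps and homotopies between resolutions induce maps and homotopies
  after tensoring with a monomial ideal.\<close>

lemma comb_below:
  assumes D: "downset D" and f: "f \<in> below P i D"
    and \<Phi>: "\<And>p. p \<in> gens P i \<Longrightarrow> \<Phi> p \<in> below Q j {..lab P i p}"
  shows "comb (gens P i) \<Phi> f \<in> below Q j D"
  unfolding below_def
proof (rule comb_supp_in)
  fix p assume p: "p \<in> gens P i" "f p \<noteq> 0"
  then have "lab P i p \<in> D" using belowD[OF f] by blast
  then have "{..lab P i p} \<subseteq> D" using D by (auto simp: downset_def)
  then show "\<Phi> p \<in> supp_in {q \<in> gens Q j. lab Q j q \<in> D}"
    using below_mono[OF _ \<Phi>[OF p(1)]] unfolding below_def by blast
qed

lemma downset_atMost: "downset {..d}"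
  by (auto simp: downset_def)

section \<open>The comparison theorem\<close>

definition chain_map :: "('a, 'n, 'k::field) labelled_complex \<Rightarrow> ('b, 'n, 'k) labelled_complex
    \<Rightarrow> (nat \<Rightarrow> 'a \<Rightarrow> 'b \<Rightarrow> 'k) \<Rightarrow> bool" where
  "chain_map P Q \<Phi> \<longleftrightarrow>
     (\<forall>i. \<forall>p\<in>gens P i. \<Phi> i p \<in> below Q i {..lab P i p}) \<and>
     (\<forall>p\<in>gens P 0. leps Q (\<Phi> 0 p) = ep P p) \<and>
     (\<forall>i. \<forall>q\<in>gens P (Suc i). ldiff Q i (\<Phi> (Suc i) q) = comb (gens P i) (\<Phi> i) (df P i q))"

lemma
  assumes "chain_map P Q \<Phi>"
  shows chain_map_below: "p \<in> gens P i \<Longrightarrow> \<Phi> i p \<in> below Q i {..lab P i p}"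
    and chain_map_leps: "p \<in> gens P 0 \<Longrightarrow> leps Q (\<Phi> 0 p) = ep P p"
    and chain_map_ldiff: "q \<in> gens P (Suc i) \<Longrightarrow>
      ldiff Q i (\<Phi> (Suc i) q) = comb (gens P i) (\<Phi> i) (df P i q)"
  using assms by (simp_all add: chain_map_def)

lemma
  assumes "labelled_resolution L"
  shows finite_gens: "finite (gens L i)"
    and df_below: "q \<in> gens L (Suc i) \<Longrightarrow> df L i q \<in> below L i {..lab L (Suc i) q}"
  using assms by (simp_all add: labelled_resolution_def)

lemma lift_columns:
  assumes Q: "labelled_resolution Q"
    and T: "\<And>q. q \<in> A \<Longrightarrow> T q \<in> below Q i {..e q} \<and> lcycle Q (e q) i (T q)"
  shows "\<exists>G. \<forall>q\<in>A. G q \<in> below Q (Suc i) {..e q} \<and> ldiff Q i (G q) = T q"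
proof (rule bchoice, rule ballI)
  fix q assume "q \<in> A"
  then show "\<exists>w. w \<in> below Q (Suc i) {..e q} \<and> ldiff Q i w = T q"
    using T[of q] Q unfolding labelled_resolution_def by meson
qed

lemma ldiff_df:
  assumes "labelled_resolution P" "q \<in> gens P (Suc (Suc i))"
  shows "ldiff P i (df P (Suc i) q) = 0"
proof -
  have "lcycle P (lab P (Suc (Suc i)) q) (Suc i) (df P (Suc i) q)"
    using assms unfolding labelled_resolution_def by blast
  then show ?thesis by simp
qed

text \<open>On the generators in homological degree \<open>0\<close> the map is fixed by the augmentation, and each
  further column is obtained by lifting its boundary through the exact target, in the degree given by
  its label.\<close>

lemma chain_map_exists:
  assumes P: "labelled_resolution P" and Q: "labelled_resolution Q"
  shows "\<exists>\<Phi>. chain_map P Q \<Phi>"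
proof -
  obtain u where u: "u \<in> below Q 0 {..0}" "leps Q u = 1"
    using Q unfolding labelled_resolution_def by blast
  note dfP = df_below[OF P]
  define good where "good i \<phi> \<longleftrightarrow>
    (\<forall>p\<in>gens P i. \<phi> p \<in> below Q i {..lab P i p}) \<and>
    (\<forall>q\<in>gens P (Suc i). lcycle Q (lab P (Suc i) q) i (comb (gens P i) \<phi> (df P i q))) \<and>
    (i = 0 \<longrightarrow> (\<forall>p\<in>gens P 0. leps Q (\<phi> p) = ep P p))" for i \<phi>
  have "\<exists>\<Phi>. \<forall>i. good i (\<Phi> i) \<and>
      (\<forall>q\<in>gens P (Suc i). ldiff Q i (\<Phi> (Suc i) q) = comb (gens P i) (\<Phi> i) (df P i q))"
  proof (rule dependent_nat_choice)
    define \<phi> where "\<phi> p = fscale (ep P p) u" for p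
    have eps: "leps Q (\<phi> p) = ep P p" for p
      using u(2) by (simp add: \<phi>_def leps_def mult.assoc sum_distrib_left[symmetric])
    have "\<phi> p \<in> below Q 0 {..lab P 0 p}" if p: "p \<in> gens P 0" for p
    proof (cases "ep P p = 0")
      case True
      then have "\<phi> p = 0" by (simp add: \<phi>_def fun_eq_iff)
      then show ?thesis using fs.subspace_0[OF subspace_below] by metis
    next
      case False
      then have "lab P 0 p = 0" using P p unfolding labelled_resolution_def by blast
      then show ?thesis unfolding \<phi>_def using fs.subspace_scale[OF subspace_below u(1)] by simp
    qed
    moreover have "lcycle Q (lab P (Suc 0) q) 0 (comb (gens P 0) \<phi> (df P 0 q))"
      if "q \<in> gens P (Suc 0)" for q
    proof -
      have "lcycle P (lab P (Suc 0) q) 0 (df P 0 q)"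
        using P that unfolding labelled_resolution_def by blast
      then show ?thesis by (simp add: leps_comb eps leps_def[of P])
    qed
    ultimately show "\<exists>\<phi>. good 0 \<phi>" using eps unfolding good_def by blast
  next
    fix \<phi> i assume g: "good i \<phi>"
    have "comb (gens P i) \<phi> (df P i q) \<in> below Q i {..lab P (Suc i) q}" if "q \<in> gens P (Suc i)" for q
      by (rule comb_below[OF downset_atMost dfP[OF that]]) (use g in \<open>simp add: good_def\<close>)
    then have "\<exists>\<psi>. \<forall>q\<in>gens P (Suc i). \<psi> q \<in> below Q (Suc i) {..lab P (Suc i) q}
        \<and> ldiff Q i (\<psi> q) = comb (gens P i) \<phi> (df P i q)"
      by (intro lift_columns[OF Q]) (use g in \<open>simp add: good_def\<close>)
    then obtain \<psi> where \<psi>: "\<And>q. q \<in> gens P (Suc i) \<Longrightarrow> \<psi> q \<in> below Q (Suc i) {..lab P (Suc i) q}"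
      "\<And>q. q \<in> gens P (Suc i) \<Longrightarrow> ldiff Q i (\<psi> q) = comb (gens P i) \<phi> (df P i q)"
      by blast
    have "ldiff Q i (comb (gens P (Suc i)) \<psi> (df P (Suc i) q)) = 0" if "q \<in> gens P (Suc (Suc i))" for q
    proof -
      have "ldiff Q i (comb (gens P (Suc i)) \<psi> (df P (Suc i) q))
          = comb (gens P (Suc i)) (\<lambda>r. comb (gens P i) \<phi> (df P i r)) (df P (Suc i) q)"
        unfolding ldiff_comb by (rule comb_cong) (rule \<psi>(2))
      also have "\<dots> = comb (gens P i) \<phi> (ldiff P i (df P (Suc i) q))" by (rule comb_ldiff[symmetric])
      also have "\<dots> = 0" unfolding ldiff_df[OF P that] by (rule comb_zero)
      finally show ?thesis .
    qed
    then have "good (Suc i) \<psi>" using \<psi>(1) unfolding good_def by simp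
    then show "\<exists>\<psi>. good (Suc i) \<psi> \<and>
        (\<forall>q\<in>gens P (Suc i). ldiff Q i (\<psi> q) = comb (gens P i) \<phi> (df P i q))"
      using \<psi>(2) by blast
  qed
  then obtain \<Phi> where G: "\<And>i. good i (\<Phi> i)"
    and S: "\<forall>i. \<forall>q\<in>gens P (Suc i). ldiff Q i (\<Phi> (Suc i) q) = comb (gens P i) (\<Phi> i) (df P i q)"
    by metis
  have "\<forall>i. \<forall>p\<in>gens P i. \<Phi> i p \<in> below Q i {..lab P i p}"
    using G by (simp add: good_def)
  moreover have "\<forall>p\<in>gens P 0. leps Q (\<Phi> 0 p) = ep P p"
    using G[of 0] by (simp add: good_def)
  ultimately show ?thesis using S unfolding chain_map_def by (intro exI[of _ \<Phi>] conjI)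
qed

lemma chain_map_compose:
  assumes \<Phi>: "chain_map P Q \<Phi>" and \<Psi>: "chain_map Q R \<Psi>"
  shows "chain_map P R (\<lambda>i p. comb (gens Q i) (\<Psi> i) (\<Phi> i p))"
proof -
  have \<Phi>1: "\<Phi> i p \<in> below Q i {..lab P i p}" if "p \<in> gens P i" for i p
    by (rule chain_map_below[OF \<Phi> that])
  have \<Psi>1: "\<Psi> i p \<in> below R i {..lab Q i p}" if "p \<in> gens Q i" for i p
    by (rule chain_map_below[OF \<Psi> that])
  have 1: "comb (gens Q i) (\<Psi> i) (\<Phi> i p) \<in> below R i {..lab P i p}" if "p \<in> gens P i" for i p
    by (rule comb_below[OF downset_atMost \<Phi>1[OF that] \<Psi>1])
  have 2: "leps R (comb (gens Q 0) (\<Psi> 0) (\<Phi> 0 p)) = ep P p" if "p \<in> gens P 0" for p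
  proof -
    have "leps R (comb (gens Q 0) (\<Psi> 0) (\<Phi> 0 p)) = leps Q (\<Phi> 0 p)"
      unfolding leps_comb leps_def[of Q]
      by (rule sum.cong) (simp_all only: chain_map_leps[OF \<Psi>])
    then show ?thesis by (simp only: chain_map_leps[OF \<Phi> that])
  qed
  have 3: "ldiff R i (comb (gens Q (Suc i)) (\<Psi> (Suc i)) (\<Phi> (Suc i) q))
      = comb (gens P i) (\<lambda>p. comb (gens Q i) (\<Psi> i) (\<Phi> i p)) (df P i q)" if "q \<in> gens P (Suc i)" for i q
  proof -
    have "ldiff R i (comb (gens Q (Suc i)) (\<Psi> (Suc i)) (\<Phi> (Suc i) q))
        = comb (gens Q (Suc i)) (\<lambda>r. comb (gens Q i) (\<Psi> i) (df Q i r)) (\<Phi> (Suc i) q)"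
      unfolding ldiff_comb by (rule comb_cong) (rule chain_map_ldiff[OF \<Psi>])
    also have "\<dots> = comb (gens Q i) (\<Psi> i) (ldiff Q i (\<Phi> (Suc i) q))" by (rule comb_ldiff[symmetric])
    also have "ldiff Q i (\<Phi> (Suc i) q) = comb (gens P i) (\<Phi> i) (df P i q)"
      by (rule chain_map_ldiff[OF \<Phi> that])
    finally show ?thesis by (simp only: comb_comb)
  qed
  show ?thesis
    unfolding chain_map_def by (intro conjI allI ballI) (rule 1 2 3, assumption)+
qed

lemma chain_map_id:
  assumes P: "labelled_resolution P"
  shows "chain_map P P (\<lambda>i. unit_at)"
proof -
  note fin = finite_gens[OF P]
  have dfP: "df P i q \<in> supp_in (gens P i)" if "q \<in> gens P (Suc i)" for i q
    by (rule below_gens[OF df_below[OF P that]])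
  have 1: "unit_at p \<in> below P i {..lab P i p}" if "p \<in> gens P i" for i p
    using that by (simp add: below_def supp_in_def unit_at_def)
  have 2: "leps P (unit_at p) = ep P p" if "p \<in> gens P 0" for p
  proof -
    have "leps P (unit_at p) = (\<Sum>x\<in>gens P 0. if x = p then ep P x else 0)"
      unfolding leps_def by (rule sum.cong) (auto simp: unit_at_def)
    then show ?thesis using fin that by simp
  qed
  have 3: "ldiff P i (unit_at q) = comb (gens P i) unit_at (df P i q)" if "q \<in> gens P (Suc i)" for i q
    unfolding ldiff_def comb_of_unit[OF fin that] comb_unit_at[OF fin dfP[OF that]] ..
  show ?thesis
    unfolding chain_map_def by (intro conjI allI ballI) (rule 1 2 3, assumption)+
qed

lemma chain_homotopy_exists:
  assumes P: "labelled_resolution P" and Q: "labelled_resolution Q"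
    and \<Phi>: "chain_map P Q \<Phi>" and \<Psi>: "chain_map P Q \<Psi>"
  shows "\<exists>h. (\<forall>i. \<forall>p\<in>gens P i. h i p \<in> below Q (Suc i) {..lab P i p}) \<and>
    (\<forall>p\<in>gens P 0. ldiff Q 0 (h 0 p) = \<Phi> 0 p - \<Psi> 0 p) \<and>
    (\<forall>i. \<forall>q\<in>gens P (Suc i). ldiff Q (Suc i) (h (Suc i) q)
      = \<Phi> (Suc i) q - \<Psi> (Suc i) q - comb (gens P i) (h i) (df P i q))"
proof -
  note dfP = df_below[OF P]
  have diff: "\<Phi> i p - \<Psi> i p \<in> below Q i {..lab P i p}" if "p \<in> gens P i" for i p
    by (rule fs.subspace_diff[OF subspace_below chain_map_below[OF \<Phi> that] chain_map_below[OF \<Psi> that]])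
  have comm: "ldiff Q i (\<Phi> (Suc i) q - \<Psi> (Suc i) q)
      = comb (gens P i) (\<lambda>p. \<Phi> i p - \<Psi> i p) (df P i q)" if "q \<in> gens P (Suc i)" for i q
    using chain_map_ldiff[OF \<Phi> that] chain_map_ldiff[OF \<Psi> that]
    by (simp only: comb_diff_columns ldiff_def comb_diff)
  define T where "T i h q = \<Phi> (Suc i) q - \<Psi> (Suc i) q - comb (gens P i) h (df P i q)" for i h q
  define good where "good i h \<longleftrightarrow>
    (\<forall>p\<in>gens P i. h p \<in> below Q (Suc i) {..lab P i p}) \<and>
    (\<forall>q\<in>gens P (Suc i). ldiff Q i (T i h q) = 0) \<and>
    (i = 0 \<longrightarrow> (\<forall>p\<in>gens P 0. ldiff Q 0 (h p) = \<Phi> 0 p - \<Psi> 0 p))" for i h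
  have "\<exists>h. \<forall>i. good i (h i) \<and>
      (\<forall>q\<in>gens P (Suc i). ldiff Q (Suc i) (h (Suc i) q) = T i (h i) q)"
  proof (rule dependent_nat_choice)
    have "leps Q (\<Phi> 0 p - \<Psi> 0 p) = 0" if "p \<in> gens P 0" for p
    proof -
      have "leps Q (\<Phi> 0 p - \<Psi> 0 p) = leps Q (\<Phi> 0 p) - leps Q (\<Psi> 0 p)"
        by (simp add: leps_def left_diff_distrib sum_subtractf)
      then show ?thesis by (simp only: chain_map_leps[OF \<Phi> that] chain_map_leps[OF \<Psi> that] diff_self)
    qed
    then have "\<exists>h. \<forall>p\<in>gens P 0. h p \<in> below Q (Suc 0) {..lab P 0 p}
        \<and> ldiff Q 0 (h p) = \<Phi> 0 p - \<Psi> 0 p"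
      by (intro lift_columns[OF Q]) (use diff in simp)
    then obtain h where h: "\<And>p. p \<in> gens P 0 \<Longrightarrow> h p \<in> below Q (Suc 0) {..lab P 0 p}"
      "\<And>p. p \<in> gens P 0 \<Longrightarrow> ldiff Q 0 (h p) = \<Phi> 0 p - \<Psi> 0 p"
      by blast
    have "ldiff Q 0 (T 0 h q) = 0" if "q \<in> gens P (Suc 0)" for q
    proof -
      have "ldiff Q 0 (comb (gens P 0) h (df P 0 q))
          = comb (gens P 0) (\<lambda>p. \<Phi> 0 p - \<Psi> 0 p) (df P 0 q)"
        unfolding ldiff_comb by (rule comb_cong) (rule h(2))
      moreover have "ldiff Q 0 (T 0 h q)
          = ldiff Q 0 (\<Phi> (Suc 0) q - \<Psi> (Suc 0) q) - ldiff Q 0 (comb (gens P 0) h (df P 0 q))"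
        unfolding T_def ldiff_def by (rule comb_diff)
      ultimately show ?thesis using comm[OF that] by simp
    qed
    then show "\<exists>h. good 0 h" using h unfolding good_def by blast
  next
    fix h i assume g: "good i h"
    have "T i h q \<in> below Q (Suc i) {..lab P (Suc i) q}" if q: "q \<in> gens P (Suc i)" for q
      unfolding T_def
      by (rule fs.subspace_diff[OF subspace_below diff[OF q]
            comb_below[OF downset_atMost dfP[OF q]]]) (use g in \<open>simp add: good_def\<close>)
    then have "\<exists>h'. \<forall>q\<in>gens P (Suc i). h' q \<in> below Q (Suc (Suc i)) {..lab P (Suc i) q}
        \<and> ldiff Q (Suc i) (h' q) = T i h q"
      by (intro lift_columns[OF Q]) (use g in \<open>simp add: good_def\<close>)
    then obtain h' where h': "\<And>q. q \<in> gens P (Suc i) \<Longrightarrow> h' q \<in> below Q (Suc (Suc i)) {..lab P (Suc i) q}"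
      "\<And>q. q \<in> gens P (Suc i) \<Longrightarrow> ldiff Q (Suc i) (h' q) = T i h q"
      by blast
    have "ldiff Q (Suc i) (T (Suc i) h' r) = 0" if r: "r \<in> gens P (Suc (Suc i))" for r
    proof -
      let ?d = "df P (Suc i) r"
      have "ldiff Q (Suc i) (comb (gens P (Suc i)) h' ?d) = comb (gens P (Suc i)) (T i h) ?d"
        unfolding ldiff_comb by (rule comb_cong) (rule h'(2))
      also have "\<dots> = comb (gens P (Suc i)) (\<lambda>q. \<Phi> (Suc i) q - \<Psi> (Suc i) q) ?d
          - comb (gens P (Suc i)) (\<lambda>q. comb (gens P i) h (df P i q)) ?d"
        unfolding T_def by (rule comb_diff_columns)
      also have "comb (gens P (Suc i)) (\<lambda>q. comb (gens P i) h (df P i q)) ?d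
          = comb (gens P i) h (ldiff P i ?d)"
        by (rule comb_ldiff[symmetric])
      also have "\<dots> = 0" unfolding ldiff_df[OF P r] by (rule comb_zero)
      finally have "ldiff Q (Suc i) (comb (gens P (Suc i)) h' ?d)
          = comb (gens P (Suc i)) (\<lambda>q. \<Phi> (Suc i) q - \<Psi> (Suc i) q) ?d"
        by (simp only: diff_zero)
      moreover have "ldiff Q (Suc i) (T (Suc i) h' r)
          = ldiff Q (Suc i) (\<Phi> (Suc (Suc i)) r - \<Psi> (Suc (Suc i)) r)
            - ldiff Q (Suc i) (comb (gens P (Suc i)) h' ?d)"
        unfolding T_def ldiff_def by (rule comb_diff)
      ultimately show ?thesis using comm[OF r] by simp
    qed
    then have "good (Suc i) h'" using h'(1) unfolding good_def by simp
    then show "\<exists>h'. good (Suc i) h' \<and>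
        (\<forall>q\<in>gens P (Suc i). ldiff Q (Suc i) (h' q) = T i h q)"
      using h'(2) by blast
  qed
  then obtain h where G: "\<And>i. good i (h i)"
    and S: "\<forall>i. \<forall>q\<in>gens P (Suc i). ldiff Q (Suc i) (h (Suc i) q) = T i (h i) q"
    by metis
  have "\<forall>i. \<forall>p\<in>gens P i. h i p \<in> below Q (Suc i) {..lab P i p}"
    using G by (simp add: good_def)
  moreover have "\<forall>p\<in>gens P 0. ldiff Q 0 (h 0 p) = \<Phi> 0 p - \<Psi> 0 p"
    using G[of 0] by (simp add: good_def)
  ultimately show ?thesis using S unfolding T_def by (intro exI[of _ h] conjI)
qed

text \<open>For chain maps \<open>\<Phi>\<close> from \<open>P\<close> to \<open>Q\<close> and \<open>\<Psi>\<close> back, \<open>\<Psi>\<close> after \<open>\<Phi>\<close> is homotopic to the identity.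
  Hence a cycle of \<open>P\<close> that \<open>\<Phi>\<close> makes a boundary is a boundary itself.\<close>

lemma lhom_le:
  fixes P :: "('a, 'n, 'k::field) labelled_complex" and Q :: "('b, 'n, 'k) labelled_complex"
  assumes P: "labelled_resolution P" and Q: "labelled_resolution Q" and D: "downset D"
  shows "lhom P D i \<le> lhom Q D i"
proof -
  have finP: "finite (gens P i)" and finQ: "finite (gens Q i)" for i
    by (rule finite_gens[OF P], rule finite_gens[OF Q])
  note dfP = df_below[OF P]
  obtain \<Phi> where \<Phi>: "chain_map P Q \<Phi>" using chain_map_exists[OF P Q] by blast
  obtain \<Psi> where \<Psi>: "chain_map Q P \<Psi>" using chain_map_exists[OF Q P] by blast
  let ?\<Theta> = "\<lambda>i p. comb (gens Q i) (\<Psi> i) (\<Phi> i p)"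
  obtain h where h: "\<forall>i. \<forall>p\<in>gens P i. h i p \<in> below P (Suc i) {..lab P i p}"
    "\<forall>p\<in>gens P 0. ldiff P 0 (h 0 p) = ?\<Theta> 0 p - unit_at p"
    "\<forall>i. \<forall>q\<in>gens P (Suc i). ldiff P (Suc i) (h (Suc i) q)
      = ?\<Theta> (Suc i) q - unit_at q - comb (gens P i) (h i) (df P i q)"
    using chain_homotopy_exists[OF P P chain_map_compose[OF \<Phi> \<Psi>] chain_map_id[OF P]] by blast
  define ZP where "ZP = {z \<in> below P i D. \<forall>j. i = Suc j \<longrightarrow> ldiff P j z = 0}"
  define ZQ where "ZQ = {z \<in> below Q i D. \<forall>j. i = Suc j \<longrightarrow> ldiff Q j z = 0}"
  define BP where "BP = ldiff P i ` below P (Suc i) D"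
  define BQ where "BQ = ldiff Q i ` below Q (Suc i) D"
  have subZ: "fs.subspace {z \<in> below L i D. \<forall>j. i = Suc j \<longrightarrow> ldiff L j z = 0}"
    for L :: "('c, 'n, 'k) labelled_complex"
    using subspace_below[of L i D]
    by (auto simp: fs.subspace_def ldiff_def comb_add comb_scale comb_zero)
  have subB: "fs.subspace (ldiff L i ` below L (Suc i) D)" for L :: "('c, 'n, 'k) labelled_complex"
  proof -
    interpret l: Vector_Spaces.linear fscale fscale "ldiff L i"
      unfolding ldiff_def by (rule linear_comb)
    show ?thesis by (rule l.subspace_image[OF subspace_below])
  qed
  have BZ: "ldiff L i ` below L (Suc i) D \<subseteq> {z \<in> below L i D. \<forall>j. i = Suc j \<longrightarrow> ldiff L j z = 0}"
    if L: "labelled_resolution L" for L :: "('c, 'n, 'k) labelled_complex"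
  proof (rule image_subsetI)
    fix w assume w: "w \<in> below L (Suc i) D"
    have "ldiff L i w \<in> below L i D"
      unfolding ldiff_def
      by (rule comb_below[OF D w df_below[OF L]])
    moreover have "ldiff L j (ldiff L i w) = 0" if "i = Suc j" for j
    proof -
      have "ldiff L j (ldiff L i w) = comb (gens L (Suc i)) (\<lambda>q. ldiff L j (df L i q)) w"
        unfolding ldiff_def[of L i] by (rule ldiff_comb)
      also have "\<dots> = comb (gens L (Suc i)) (\<lambda>q. 0) w"
        by (rule comb_cong) (use ldiff_df[OF L] that in simp)
      also have "\<dots> = 0" by (simp add: comb_def fun_eq_iff)
      finally show ?thesis .
    qed
    ultimately show "ldiff L i w \<in> {z \<in> below L i D. \<forall>j. i = Suc j \<longrightarrow> ldiff L j z = 0}" by blast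
  qed
  have ZPs: "ZP \<subseteq> supp_in (gens P i)" and ZQs: "ZQ \<subseteq> supp_in (gens Q i)"
    unfolding ZP_def ZQ_def using below_gens by blast+
  have "fs.dim ZP - fs.dim BP \<le> fs.dim ZQ - fs.dim BQ"
  proof (rule subquotient_dim_le_map[where f = "comb (gens P i) (\<Phi> i)", OF
        subZ[of P, folded ZP_def] subB[of P, folded BP_def] BZ[OF P, folded BP_def ZP_def]
        subZ[of Q, folded ZQ_def] subB[of Q, folded BQ_def] BZ[OF Q, folded BQ_def ZQ_def]
        finP ZPs finQ ZQs linear_comb])
    fix z assume z: "z \<in> ZP"
    then have zD: "z \<in> below P i D" and zc: "\<And>j. i = Suc j \<Longrightarrow> ldiff P j z = 0"
      by (auto simp: ZP_def)
    have "comb (gens P i) (\<Phi> i) z \<in> below Q i D"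
      by (rule comb_below[OF D zD chain_map_below[OF \<Phi>]])
    moreover have "ldiff Q j (comb (gens P i) (\<Phi> i) z) = 0" if j: "i = Suc j" for j
    proof -
      have "ldiff Q j (comb (gens P i) (\<Phi> i) z)
          = comb (gens P i) (\<lambda>q. comb (gens P j) (\<Phi> j) (df P j q)) z"
        unfolding ldiff_comb j by (rule comb_cong) (rule chain_map_ldiff[OF \<Phi>])
      also have "\<dots> = comb (gens P j) (\<Phi> j) (ldiff P j z)"
        unfolding j by (rule comb_ldiff[symmetric])
      also have "\<dots> = 0" unfolding zc[OF j] by (rule comb_zero)
      finally show ?thesis .
    qed
    ultimately show "comb (gens P i) (\<Phi> i) z \<in> ZQ" by (simp add: ZQ_def)
    assume "comb (gens P i) (\<Phi> i) z \<in> BQ"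
    then obtain w where w: "w \<in> below Q (Suc i) D" "comb (gens P i) (\<Phi> i) z = ldiff Q i w"
      unfolding BQ_def by blast
    define w1 where "w1 = comb (gens Q (Suc i)) (\<Psi> (Suc i)) w"
    define w2 where "w2 = comb (gens P i) (h i) z"
    have w1: "w1 \<in> below P (Suc i) D"
      unfolding w1_def by (rule comb_below[OF D w(1) chain_map_below[OF \<Psi>]])
    have w2: "w2 \<in> below P (Suc i) D"
      unfolding w2_def by (rule comb_below[OF D zD]) (use h(1) in simp)
    have "ldiff P i w1 = comb (gens Q (Suc i)) (\<lambda>q. comb (gens Q i) (\<Psi> i) (df Q i q)) w"
      unfolding w1_def ldiff_comb by (rule comb_cong) (rule chain_map_ldiff[OF \<Psi>])
    also have "\<dots> = comb (gens Q i) (\<Psi> i) (ldiff Q i w)" by (rule comb_ldiff[symmetric])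
    also have "\<dots> = comb (gens P i) (?\<Theta> i) z" unfolding w(2)[symmetric] by (rule comb_comb)
    finally have e1: "ldiff P i w1 = comb (gens P i) (?\<Theta> i) z" .
    have zz: "comb (gens P i) unit_at z = z" by (rule comb_unit_at[OF finP below_gens[OF zD]])
    have e2: "ldiff P i w2 = comb (gens P i) (?\<Theta> i) z - z"
    proof (cases i)
      case 0
      have "ldiff P i w2 = comb (gens P i) (\<lambda>p. ?\<Theta> i p - unit_at p) z"
        unfolding w2_def ldiff_comb by (rule comb_cong) (use h(2) 0 in simp)
      then show ?thesis by (simp only: comb_diff_columns zz)
    next
      case (Suc j)
      have "ldiff P i w2 = comb (gens P i)
          (\<lambda>q. (?\<Theta> i q - unit_at q) - comb (gens P j) (h j) (df P j q)) z"
        unfolding w2_def ldiff_comb by (rule comb_cong) (use h(3) Suc in simp)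
      also have "\<dots> = comb (gens P i) (\<lambda>q. ?\<Theta> i q - unit_at q) z
          - comb (gens P i) (\<lambda>q. comb (gens P j) (h j) (df P j q)) z"
        by (rule comb_diff_columns)
      also have "comb (gens P i) (\<lambda>q. comb (gens P j) (h j) (df P j q)) z
          = comb (gens P j) (h j) (ldiff P j z)"
        unfolding Suc by (rule comb_ldiff[symmetric])
      also have "\<dots> = 0" unfolding zc[OF Suc] by (rule comb_zero)
      finally show ?thesis by (simp only: comb_diff_columns zz diff_zero)
    qed
    have "ldiff P i (w1 - w2) = ldiff P i w1 - ldiff P i w2"
      unfolding ldiff_def by (rule comb_diff)
    then have "z = ldiff P i (w1 - w2)" using e1 e2 by simp
    then show "z \<in> BP"
      unfolding BP_def by (rule image_eqI[OF _ fs.subspace_diff[OF subspace_below w1 w2]])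
  qed
  then show ?thesis unfolding lhom_def ZP_def ZQ_def BP_def BQ_def .
qed

section \<open>The Koszul complex\<close>

definition indic :: "'n set \<Rightarrow> 'n \<Rightarrow> int" where
  "indic s = (\<lambda>j. if j \<in> s then 1 else 0)"

definition koszul :: "('n::finite set, 'n, 'k::field) labelled_complex" where
  "koszul = \<lparr>gens = \<lambda>i. {s. card s = i}, lab = \<lambda>i. indic, df = \<lambda>i s. bd (unit_at s),
     ep = \<lambda>s. 1\<rparr>"

lemma koszul_simps [simp]:
  "gens koszul i = {s. card s = i}" "lab koszul i = indic" "df koszul i s = bd (unit_at s)"
  "ep koszul s = 1"
  by (simp_all add: koszul_def)

lemma indic_mono: "s \<subseteq> t \<Longrightarrow> indic s \<le> indic t"
  by (auto simp: indic_def le_fun_def)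

lemma indic_nonneg: "0 \<le> indic s"
  by (auto simp: indic_def le_fun_def)

lemma indic_eq_0_iff: "indic s = 0 \<longleftrightarrow> s = {}"
proof
  assume 0: "indic s = 0"
  have "j \<notin> s" for j using fun_cong[OF 0, of j] by (auto simp: indic_def)
  then show "s = {}" by blast
qed (simp add: indic_def fun_eq_iff)

lemma bd_comb: "bd (comb X \<Phi> f) = comb X (\<lambda>x. bd (\<Phi> x)) f"
proof
  fix t
  have "bd (comb X \<Phi> f) t = (\<Sum>m\<in>-t. \<Sum>x\<in>X. f x * (sg m t * \<Phi> x (insert m t)))"
    by (simp add: bd_def comb_def sum_distrib_left mult.left_commute)
  also have "\<dots> = (\<Sum>x\<in>X. \<Sum>m\<in>-t. f x * (sg m t * \<Phi> x (insert m t)))" by (rule sum.swap)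
  also have "\<dots> = comb X (\<lambda>x. bd (\<Phi> x)) f t" by (simp add: bd_def comb_def sum_distrib_left)
  finally show "bd (comb X \<Phi> f) t = comb X (\<lambda>x. bd (\<Phi> x)) f t" .
qed

lemma below_koszul: "below koszul i D = schains {s. indic s \<in> D} i"
proof -
  have "{s. card s = i \<and> indic s \<in> D} = {s \<in> {s. indic s \<in> D}. card s = i}" by blast
  then show ?thesis by (simp add: below_def schains_def)
qed

lemma ldiff_koszul: "f \<in> supp_in {s. card s = Suc i} \<Longrightarrow> ldiff koszul i f = bd f"
proof -
  assume f: "f \<in> supp_in {s. card s = Suc i}"
  have "ldiff koszul i f = bd (comb {s. card s = Suc i} unit_at f)"
    unfolding bd_comb ldiff_def by (simp only: koszul_def labelled_complex.select_convs)
  then show ?thesis by (simp only: comb_unit_at[OF finite f])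
qed

lemma leps_koszul: "leps (koszul :: ('n::finite set, 'n, 'k::field) labelled_complex) z = z {}"
proof -
  have "gens (koszul :: ('n set, 'n, 'k) labelled_complex) 0 = {{}}" by auto
  then show ?thesis by (simp add: leps_def del: koszul_simps(1))
qed

lemma bd_unit_below: "card s = Suc i \<Longrightarrow> bd (unit_at s) \<in> schains {t. indic t \<le> indic s} i"
proof (rule schainsI)
  fix t assume s: "card s = Suc i" and t: "bd (unit_at s) t \<noteq> 0"
  have "unit_at s \<in> schains {s} (Suc i)" using s by (auto simp: schains_def supp_in_def unit_at_def)
  then obtain m where "m \<notin> t" "insert m t \<in> {s}" "card t = i" using bd_chains_card t by blast
  then show "t \<in> {t. indic t \<le> indic s} \<and> card t = i" using indic_mono[of t s] by blast
qed

lemma bd_of_empty: "z \<in> schains X 0 \<Longrightarrow> bd z = 0"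
proof
  fix t assume z: "z \<in> schains X 0"
  have "z (insert m t) = 0" for m using schainsD[OF z, of "insert m t"] by auto
  then show "bd z t = 0 t" by (simp add: bd_def)
qed

text \<open>In a degree \<open>d \<ge> 0\<close> with \<open>d v \<ge> 1\<close> the Koszul complex is a cone with apex \<open>v\<close>; in degree \<open>0\<close>
  only the empty face is left.\<close>

lemma koszul_resolution: "labelled_resolution (koszul :: ('n::finite set, 'n, 'k::field) labelled_complex)"
proof -
  let ?K = "koszul :: ('n set, 'n, 'k) labelled_complex"
  have ldiff: "ldiff ?K i z = bd z" if "z \<in> schains X (Suc i)" for i z X
    by (rule ldiff_koszul) (use that in \<open>auto simp: schains_def supp_in_def\<close>)
  have 1: "df ?K i q \<in> below ?K i {..lab ?K (Suc i) q}" if "q \<in> gens ?K (Suc i)" for i q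
    using bd_unit_below[of q i] that by (simp add: below_koszul)
  have 2: "ep ?K p \<noteq> 0 \<longrightarrow> lab ?K 0 p = 0" if "p \<in> gens ?K 0" for p
    using that by (simp add: indic_eq_0_iff)
  have 3: "lcycle ?K (lab ?K (Suc i) q) i (df ?K i q)" if q: "q \<in> gens ?K (Suc i)" for i q
  proof (cases i)
    case 0
    have "q \<noteq> {}" using q by auto
    then show ?thesis using 0 by (simp add: indic_eq_0_iff)
  next
    case (Suc j)
    have "bd (unit_at q) \<in> schains {t. indic t \<le> indic q} (Suc j)"
      using bd_unit_below[of q i] q Suc by simp
    then have "ldiff ?K j (bd (unit_at q)) = bd (bd (unit_at q))" by (rule ldiff)
    then show ?thesis using Suc by (simp add: bd_bd)
  qed
  have 4: "\<exists>u\<in>below ?K 0 {..0}. leps ?K u = 1"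
  proof
    show "leps ?K (unit_at {}) = 1" by (simp add: leps_koszul unit_at_def)
    show "unit_at {} \<in> below ?K 0 {..0}"
      by (auto simp: below_koszul schains_def supp_in_def unit_at_def indic_def le_fun_def)
  qed
  have 5: "\<exists>w\<in>below ?K (Suc i) {..d}. ldiff ?K i w = z"
    if z: "z \<in> below ?K i {..d}" and lc: "lcycle ?K d i z" for d i z
  proof (cases "z = 0")
    case True
    have "0 \<in> below ?K (Suc i) {..d}" by (rule fs.subspace_0[OF subspace_below])
    moreover have "ldiff ?K i 0 = 0" unfolding ldiff_def by (rule comb_zero)
    ultimately show ?thesis using True by blast
  next
    case False
    have zc: "z \<in> schains {s. indic s \<le> d} i" using z by (simp add: below_koszul)
    obtain s where s: "z s \<noteq> 0" using False by (auto simp: fun_eq_iff)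
    then have sd: "indic s \<le> d" "card s = i" using schainsD[OF zc] by blast+
    have d0: "0 \<le> d" using order_trans[OF indic_nonneg sd(1)] .
    have bz: "bd z = 0"
    proof (cases i)
      case 0
      then show ?thesis using bd_of_empty zc by simp
    next
      case (Suc j)
      then show ?thesis using ldiff[of z "{s. indic s \<le> d}" j] lc zc by simp
    qed
    show ?thesis
    proof (cases "\<exists>v. 1 \<le> d v")
      case True
      then obtain v where v: "1 \<le> d v" by blast
      have "cone v z \<in> schains {s. indic s \<le> d} (Suc i)"
      proof (rule cone_chains[OF zc])
        fix s assume "s \<in> {s. indic s \<le> d}"
        then have s: "indic s x \<le> d x" for x by (simp add: le_fun_def)
        have "indic (insert v s) x \<le> d x" for x
          using s[of x] v by (cases "x = v") (simp_all add: indic_def)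
        then show "insert v s \<in> {s. indic s \<le> d}" by (simp add: le_fun_def)
      qed
      moreover have "bd (cone v z) = z"
      proof -
        have "cone v (0 :: 'n set \<Rightarrow> 'k) = 0" by (simp add: fun_eq_iff cone_def)
        then show ?thesis using cone_homotopy[of v z] bz by simp
      qed
      ultimately show ?thesis using ldiff by (auto simp: below_koszul intro!: bexI[of _ "cone v z"])
    next
      case no_vertex: False
      have "s = {}"
      proof (rule ccontr)
        assume "s \<noteq> {}"
        then obtain v where "v \<in> s" by blast
        then have "1 \<le> d v" using le_funD[OF sd(1), of v] by (simp add: indic_def)
        then show False using no_vertex by blast
      qed
      moreover have "d = 0"
      proof
        fix v show "d v = 0 v" using no_vertex le_funD[OF d0, of v] by (metis int_one_le_iff_zero_less linorder_not_less order_antisym zero_fun_apply)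
      qed
      ultimately have False using lc s sd(2) by (simp add: leps_koszul)
      then show ?thesis ..
    qed
  qed
  show ?thesis
    unfolding labelled_resolution_def
    by (intro conjI allI ballI impI; (rule 1 2[rule_format] 3 4 5; assumption)?) simp_all
qed

lemma lhom_koszul:
  assumes D: "downset D"
  shows "lhom (koszul :: ('n::finite set, 'n, 'k::field) labelled_complex) D i
    = hdim TYPE('k) {s. indic s \<in> D} i"
proof -
  let ?K = "koszul :: ('n set, 'n, 'k) labelled_complex"
  let ?X = "{s. indic s \<in> D}"
  have X: "simplicial ?X"
    using D indic_mono unfolding simplicial_def downset_def by blast
  have ldiff: "ldiff ?K i z = bd z" if "z \<in> schains ?X (Suc i)" for i z
    by (rule ldiff_koszul) (use that in \<open>auto simp: schains_def supp_in_def\<close>)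
  have "{z \<in> below ?K i D. \<forall>j. i = Suc j \<longrightarrow> ldiff ?K j z = 0} = cyc ?X i"
  proof (rule set_eqI)
    fix z :: "'n set \<Rightarrow> 'k"
    have "(\<forall>j. i = Suc j \<longrightarrow> ldiff ?K j z = 0) \<longleftrightarrow> bdX ?X z = 0" if z: "z \<in> schains ?X i"
    proof (cases i)
      case 0
      then show ?thesis using bdX_simplicial[OF X z] bd_of_empty[of z ?X] z by simp
    next
      case (Suc j)
      then show ?thesis using bdX_simplicial[OF X z] ldiff[of z j] z by simp
    qed
    then show "z \<in> {z \<in> below ?K i D. \<forall>j. i = Suc j \<longrightarrow> ldiff ?K j z = 0} \<longleftrightarrow> z \<in> cyc ?X i"
      unfolding cyc_def below_koszul by blast
  qed
  moreover have "ldiff ?K i ` below ?K (Suc i) D = bnd ?X i"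
    unfolding bnd_def below_koszul
    by (rule image_cong[OF refl]) (simp only: ldiff bdX_simplicial[OF X])
  ultimately show ?thesis by (simp only: lhom_def hdim_def)
qed

section \<open>Graded polynomials\<close>

text \<open>Coefficients are extended by zero to all integer degrees, so that degrees can be subtracted freely.\<close>

definition pcoeff :: "('n::finite, 'k::field) mpoly \<Rightarrow> ('n \<Rightarrow> int) \<Rightarrow> 'k" where
  "pcoeff f d = (if 0 \<le> d then Poly_Mapping.lookup f (nat \<circ> d) else 0)"

definition hsingle :: "('n \<Rightarrow> int) \<Rightarrow> 'k \<Rightarrow> ('n::finite, 'k::field) mpoly" where
  "hsingle d c = Poly_Mapping.single (nat \<circ> d) c"

lemma nat_comp_eq_iff: "0 \<le> d \<Longrightarrow> nat \<circ> d = u \<longleftrightarrow> d = (\<lambda>j. int (u j))"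
  unfolding fun_eq_iff le_fun_def o_apply zero_fun_apply by (metis int_nat_eq nat_int)

lemma nat_comp_int [simp]: "nat \<circ> (\<lambda>j. int (u j)) = u"
  by (simp add: fun_eq_iff)

lemma int_comp_nat: "0 \<le> d \<Longrightarrow> (\<lambda>j. int ((nat \<circ> d) j)) = d"
  by (simp add: fun_eq_iff le_fun_def)

lemma pcoeff_sum: "pcoeff (\<Sum>x\<in>A. f x) d = (\<Sum>x\<in>A. pcoeff (f x) d)"
  by (simp add: pcoeff_def lookup_sum)

lemma pcoeff_zero [simp]: "pcoeff 0 d = 0"
  by (simp add: pcoeff_def)

lemma pcoeff_hsingle: "0 \<le> e \<Longrightarrow> pcoeff (hsingle e c) d = (if d = e then c else 0)"
proof (cases "0 \<le> d")
  case True
  assume e: "0 \<le> e"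
  have "nat \<circ> e = nat \<circ> d \<longleftrightarrow> d = e"
    using nat_comp_eq_iff[OF e, of "nat \<circ> d"] int_comp_nat[OF True] by auto
  then show ?thesis using True by (simp add: pcoeff_def hsingle_def lookup_single when_def)
qed (auto simp: pcoeff_def)

lemma homogeneous_hsingle: "0 \<le> e \<Longrightarrow> homogeneous e (hsingle e c)"
  using int_comp_nat[of e] by (simp add: homogeneous_def hsingle_def)

lemma homogeneous_eq_hsingle:
  assumes "homogeneous e f"
  shows "f = (if 0 \<le> e then hsingle e (pcoeff f e) else 0)"
proof (rule poly_mapping_eqI)
  fix u
  show "Poly_Mapping.lookup f u = Poly_Mapping.lookup (if 0 \<le> e then hsingle e (pcoeff f e) else 0) u"
  proof (cases "u \<in> Poly_Mapping.keys f")
    case True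
    then have e: "e = (\<lambda>j. int (u j))" using assms by (auto simp: homogeneous_def)
    then have "0 \<le> e" by (simp add: le_fun_def)
    then show ?thesis by (simp add: e hsingle_def pcoeff_def)
  next
    case False
    then have 0: "Poly_Mapping.lookup f u = 0" by (simp add: in_keys_iff)
    show ?thesis
    proof (cases "0 \<le> e \<and> nat \<circ> e = u")
      case True
      then show ?thesis using 0 by (simp add: hsingle_def pcoeff_def)
    next
      case False
      then show ?thesis using 0 by (auto simp: hsingle_def lookup_single when_def)
    qed
  qed
qed

lemma homogeneous_sum: "(\<And>x. x \<in> A \<Longrightarrow> homogeneous d (f x)) \<Longrightarrow> homogeneous d (\<Sum>x\<in>A. f x)"
proof -
  assume h: "\<And>x. x \<in> A \<Longrightarrow> homogeneous d (f x)"
  show ?thesis unfolding homogeneous_def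
  proof
    fix u assume "u \<in> Poly_Mapping.keys (\<Sum>x\<in>A. f x)"
    then obtain x where "x \<in> A" "u \<in> Poly_Mapping.keys (f x)" using keys_sum[of f A] by blast
    then show "(\<lambda>j. int (u j)) = d" using h by (auto simp: homogeneous_def)
  qed
qed

lemma homogeneous_mult: "homogeneous d f \<Longrightarrow> homogeneous e g \<Longrightarrow> homogeneous (d + e) (f * g)"
  unfolding homogeneous_def
proof
  fix u assume f: "\<forall>u\<in>Poly_Mapping.keys f. (\<lambda>j. int (u j)) = d"
    and g: "\<forall>u\<in>Poly_Mapping.keys g. (\<lambda>j. int (u j)) = e"
    and "u \<in> Poly_Mapping.keys (f * g)"
  then obtain a b where "a \<in> Poly_Mapping.keys f" "b \<in> Poly_Mapping.keys g" "u = a + b"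
    using keys_mult[of f g] by blast
  then show "(\<lambda>j. int (u j)) = d + e" using f g by (auto simp: fun_eq_iff)
qed

lemma poly_mapping_sum_single: "f = (\<Sum>u\<in>Poly_Mapping.keys f. Poly_Mapping.single u (Poly_Mapping.lookup f u))"
proof (rule poly_mapping_eqI)
  fix u
  have "Poly_Mapping.lookup (\<Sum>u\<in>Poly_Mapping.keys f. Poly_Mapping.single u (Poly_Mapping.lookup f u)) u
      = (\<Sum>v\<in>Poly_Mapping.keys f. if v = u then Poly_Mapping.lookup f v else 0)"
    unfolding lookup_sum by (rule sum.cong) (auto simp: lookup_single when_def)
  then show "Poly_Mapping.lookup f u
      = Poly_Mapping.lookup (\<Sum>u\<in>Poly_Mapping.keys f. Poly_Mapping.single u (Poly_Mapping.lookup f u)) u"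
    by (auto simp: in_keys_iff)
qed

lemma pcoeff_hsingle_mult:
  assumes e: "0 \<le> e"
  shows "pcoeff (hsingle e c * f) d = c * pcoeff f (d - e)"
proof -
  have "pcoeff (hsingle e c * Poly_Mapping.single u a) d = c * pcoeff (Poly_Mapping.single u a) (d - e)"
    for u a
  proof -
    define w where "w = (\<lambda>j. int (u j))"
    have w: "0 \<le> w" "Poly_Mapping.single u a = hsingle w a"
      by (simp_all add: w_def le_fun_def hsingle_def)
    have "(nat \<circ> e) + u = nat \<circ> (e + w)"
      using e by (simp add: fun_eq_iff w_def le_fun_def nat_add_distrib)
    then have "hsingle e c * Poly_Mapping.single u a = hsingle (e + w) (c * a)"
      by (simp only: hsingle_def mult_single)
    moreover have "0 \<le> e + w" using e w(1) by (rule add_nonneg_nonneg)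
    moreover have "d = e + w \<longleftrightarrow> d - e = w" by (auto simp: algebra_simps)
    ultimately show ?thesis using w by (simp add: pcoeff_hsingle)
  qed
  then show ?thesis
    by (subst (1 2) poly_mapping_sum_single[of f]) (simp add: sum_distrib_left pcoeff_sum)
qed

lemma pcoeff_homogeneous_mult:
  assumes "homogeneous e g"
  shows "pcoeff (g * f) d = pcoeff g e * pcoeff f (d - e)"
proof (cases "0 \<le> e")
  case True
  then have "g = hsingle e (pcoeff g e)" using homogeneous_eq_hsingle[OF assms] by simp
  then show ?thesis using pcoeff_hsingle_mult[OF True, of "pcoeff g e" f d] by simp
next
  case False
  then have "g = 0" using homogeneous_eq_hsingle[OF assms] by simp
  then show ?thesis by simp
qed

section \<open>Graded free complexes and labelled complexes\<close>

definition graded_complex :: "('n::finite, 'k::field) free_complex \<Rightarrow> bool" where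
  "graded_complex P \<longleftrightarrow>
     (\<forall>i. \<forall>p<rk P i. \<forall>q<rk P (Suc i).
        homogeneous (gdeg P (Suc i) q - gdeg P i p) (mat P i p q)) \<and>
     (\<forall>p<rk P 0. aug P p \<noteq> 0 \<longrightarrow> gdeg P 0 p = 0)"

definition labelled_of :: "('n::finite, 'k::field) free_complex \<Rightarrow> (nat, 'n, 'k) labelled_complex" where
  "labelled_of P = \<lparr>gens = \<lambda>i. {..<rk P i}, lab = gdeg P,
     df = \<lambda>i q p. if p < rk P i then pcoeff (mat P i p q) (gdeg P (Suc i) q - gdeg P i p) else 0,
     ep = aug P\<rparr>"

lemma labelled_of_simps [simp]:
  "gens (labelled_of P) i = {..<rk P i}" "lab (labelled_of P) i = gdeg P i" "ep (labelled_of P) = aug P"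
  by (simp_all add: labelled_of_def)

text \<open>The degree \<open>d\<close> part of a free module is identified with scalar vectors on the labels \<open>\<le> d\<close>:
  \<open>hcomp\<close> takes the component of degree \<open>d\<close>, and \<open>hlift\<close> is its inverse on homogeneous vectors.\<close>

definition hcomp :: "('n::finite, 'k::field) free_complex \<Rightarrow> nat \<Rightarrow> ('n \<Rightarrow> int)
    \<Rightarrow> (nat \<Rightarrow> ('n, 'k) mpoly) \<Rightarrow> nat \<Rightarrow> 'k" where
  "hcomp P i d v = (\<lambda>p. if p < rk P i then pcoeff (v p) (d - gdeg P i p) else 0)"

definition hlift :: "('n::finite, 'k::field) free_complex \<Rightarrow> nat \<Rightarrow> ('n \<Rightarrow> int)
    \<Rightarrow> (nat \<Rightarrow> 'k) \<Rightarrow> nat \<Rightarrow> ('n, 'k) mpoly" where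
  "hlift P i d f = (\<lambda>p. hsingle (d - gdeg P i p) (f p))"

lemma hsingle_zero [simp]: "hsingle d 0 = 0"
  by (simp add: hsingle_def)

lemma hcomp_below: "hcomp P i d v \<in> below (labelled_of P) i {..d}"
  by (auto simp: below_def supp_in_def hcomp_def pcoeff_def le_fun_def)

lemma hlift_free_mod: "f \<in> below (labelled_of P) i D \<Longrightarrow> hlift P i d f \<in> free_mod P i"
proof -
  assume f: "f \<in> below (labelled_of P) i D"
  have "f p = 0" if "rk P i \<le> p" for p
    using belowD[OF f, of p] that by (cases "f p = 0") auto
  then show ?thesis by (simp add: free_mod_def hlift_def)
qed

lemma below_degree:
  assumes "f \<in> below (labelled_of P) i {..d}" "f p \<noteq> 0"
  shows "p < rk P i" "0 \<le> d - gdeg P i p"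
  using belowD[OF assms] by (auto simp: le_fun_def)

lemma hcomp_hlift:
  assumes f: "f \<in> below (labelled_of P) i {..d}"
  shows "hcomp P i e (hlift P i d f) = (if e = d then f else 0)"
proof
  fix p
  show "hcomp P i e (hlift P i d f) p = (if e = d then f else 0) p"
  proof (cases "f p = 0")
    case True
    then show ?thesis by (simp add: hcomp_def hlift_def)
  next
    case False
    note b = below_degree[OF f False]
    have "e - gdeg P i p = d - gdeg P i p \<longleftrightarrow> e = d" by simp
    then show ?thesis using b by (simp add: hcomp_def hlift_def pcoeff_hsingle)
  qed
qed

lemma hlift_comp:
  assumes v: "v \<in> free_mod P i" and h: "\<And>p. p < rk P i \<Longrightarrow> homogeneous (d - gdeg P i p) (v p)"
  shows "hlift P i d (hcomp P i d v) = v"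
proof
  fix p
  show "hlift P i d (hcomp P i d v) p = v p"
  proof (cases "p < rk P i")
    case True
    show ?thesis
    proof (cases "0 \<le> d - gdeg P i p")
      case True
      then show ?thesis
        using homogeneous_eq_hsingle[OF h[OF \<open>p < rk P i\<close>]] \<open>p < rk P i\<close>
        by (simp add: hlift_def hcomp_def)
    next
      case False
      then show ?thesis
        using homogeneous_eq_hsingle[OF h[OF True]] by (simp add: hlift_def hcomp_def pcoeff_def)
    qed
  next
    case False
    then show ?thesis using v by (simp add: hlift_def hcomp_def free_mod_def)
  qed
qed

lemma hlift_homogeneous:
  assumes f: "f \<in> below (labelled_of P) i {..d}"
  shows "homogeneous (d - gdeg P i p) (hlift P i d f p)"
proof (cases "f p = 0")
  case True
  then show ?thesis by (simp add: hlift_def homogeneous_def)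
next
  case False
  then show ?thesis unfolding hlift_def by (intro homogeneous_hsingle below_degree(2)[OF f])
qed

definition degrees :: "('n::finite, 'k::field) free_complex \<Rightarrow> nat
    \<Rightarrow> (nat \<Rightarrow> ('n, 'k) mpoly) \<Rightarrow> ('n \<Rightarrow> int) set" where
  "degrees P i v = (\<Union>p<rk P i. (\<lambda>u. gdeg P i p + (\<lambda>j. int (u j))) ` Poly_Mapping.keys (v p))"

lemma finite_degrees: "finite (degrees P i v)"
  by (simp add: degrees_def)

lemma sum_components:
  assumes v: "v \<in> free_mod P i"
  shows "v p = (\<Sum>d\<in>degrees P i v. hlift P i d (hcomp P i d v) p)"
proof (cases "p < rk P i")
  case False
  then show ?thesis using v by (simp add: hlift_def hcomp_def free_mod_def)
next
  case True
  let ?g = "gdeg P i p"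
  have deg: "?g + (\<lambda>j. int (u j)) \<in> degrees P i v" if "u \<in> Poly_Mapping.keys (v p)" for u
    using that True by (auto simp: degrees_def)
  show ?thesis
  proof (rule poly_mapping_eqI)
    fix u
    have "Poly_Mapping.lookup (hlift P i d (hcomp P i d v) p) u
        = (if d = ?g + (\<lambda>j. int (u j)) then Poly_Mapping.lookup (v p) u else 0)" for d
    proof (cases "0 \<le> d - ?g")
      case True
      have "d = ?g + (\<lambda>j. int (u j)) \<longleftrightarrow> d - ?g = (\<lambda>j. int (u j))"
        by (auto simp: algebra_simps)
      then show ?thesis
        using True \<open>p < rk P i\<close> nat_comp_eq_iff[OF True, of u]
        by (auto simp: hlift_def hcomp_def pcoeff_def hsingle_def lookup_single when_def)
    next
      case False
      then have "d \<noteq> ?g + (\<lambda>j. int (u j))" by (auto simp: le_fun_def)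
      then show ?thesis using False by (simp add: hlift_def hcomp_def pcoeff_def)
    qed
    then have "Poly_Mapping.lookup (\<Sum>d\<in>degrees P i v. hlift P i d (hcomp P i d v) p) u
        = (\<Sum>d\<in>degrees P i v. if d = ?g + (\<lambda>j. int (u j)) then Poly_Mapping.lookup (v p) u else 0)"
      by (simp add: lookup_sum)
    also have "\<dots> = Poly_Mapping.lookup (v p) u"
      using deg[of u] finite_degrees[of P i v] by (auto simp: in_keys_iff)
    finally show "Poly_Mapping.lookup (v p) u
        = Poly_Mapping.lookup (\<Sum>d\<in>degrees P i v. hlift P i d (hcomp P i d v) p) u" by simp
  qed
qed

lemma free_mod_eq_0:
  assumes "v \<in> free_mod P i" "\<And>d. hcomp P i d v = 0"
  shows "v = 0"
proof
  fix p show "v p = 0 p"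
    using sum_components[OF assms(1), of p] assms(2) by (simp add: hlift_def)
qed

lemma hcomp_zero: "hcomp P i d 0 = 0"
  by (simp add: hcomp_def fun_eq_iff)

lemma bdry_free_mod: "bdry P (Suc i) v \<in> free_mod P i"
  by (simp add: free_mod_def)

lemma hcomp_bdry:
  assumes P: "graded_complex P"
  shows "hcomp P i d (bdry P (Suc i) v) = ldiff (labelled_of P) i (hcomp P (Suc i) d v)"
proof
  fix p
  show "hcomp P i d (bdry P (Suc i) v) p = ldiff (labelled_of P) i (hcomp P (Suc i) d v) p"
  proof (cases "p < rk P i")
    case True
    have "pcoeff (mat P i p q * v q) (d - gdeg P i p)
        = pcoeff (mat P i p q) (gdeg P (Suc i) q - gdeg P i p) * pcoeff (v q) (d - gdeg P (Suc i) q)"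
      if "q < rk P (Suc i)" for q
    proof -
      have "homogeneous (gdeg P (Suc i) q - gdeg P i p) (mat P i p q)"
        using P True that by (simp add: graded_complex_def)
      from pcoeff_homogeneous_mult[OF this, of "v q" "d - gdeg P i p"] show ?thesis by simp
    qed
    then have "hcomp P i d (bdry P (Suc i) v) p = (\<Sum>q<rk P (Suc i).
        pcoeff (mat P i p q) (gdeg P (Suc i) q - gdeg P i p) * pcoeff (v q) (d - gdeg P (Suc i) q))"
      using True by (simp add: hcomp_def pcoeff_sum)
    then show ?thesis
      using True by (simp add: ldiff_def comb_def labelled_of_def hcomp_def mult.commute)
  next
    case False
    then show ?thesis by (simp add: ldiff_def comb_def labelled_of_def hcomp_def)
  qed
qed

lemma hlift_ldiff:
  assumes P: "graded_complex P" and f: "f \<in> below (labelled_of P) (Suc i) {..d}"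
  shows "bdry P (Suc i) (hlift P (Suc i) d f) = hlift P i d (ldiff (labelled_of P) i f)"
proof -
  have "homogeneous (d - gdeg P i p) (bdry P (Suc i) (hlift P (Suc i) d f) p)" if p: "p < rk P i" for p
  proof -
    have "homogeneous (d - gdeg P i p) (mat P i p q * hlift P (Suc i) d f q)" if "q < rk P (Suc i)" for q
    proof -
      have "homogeneous (gdeg P (Suc i) q - gdeg P i p) (mat P i p q)"
        using P p that by (simp add: graded_complex_def)
      from homogeneous_mult[OF this hlift_homogeneous[OF f, of q]] show ?thesis by simp
    qed
    then show ?thesis using p by (auto intro: homogeneous_sum)
  qed
  then have "hlift P i d (hcomp P i d (bdry P (Suc i) (hlift P (Suc i) d f)))
      = bdry P (Suc i) (hlift P (Suc i) d f)"
    by (rule hlift_comp[OF bdry_free_mod])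
  then show ?thesis by (simp only: hcomp_bdry[OF P] hcomp_hlift[OF f] simp_thms if_True)
qed

lemma aug_map_comp:
  assumes P: "graded_complex P"
  shows "aug_map P v = leps (labelled_of P) (hcomp P 0 0 v)"
proof -
  have "Poly_Mapping.lookup (v p) 0 * aug P p = hcomp P 0 0 v p * aug P p" if "p < rk P 0" for p
  proof (cases "aug P p = 0")
    case False
    then have "gdeg P 0 p = 0" using P that by (simp add: graded_complex_def)
    moreover have "nat \<circ> (0 :: 'a \<Rightarrow> int) = 0" by (simp add: fun_eq_iff)
    ultimately show ?thesis using that by (simp add: hcomp_def pcoeff_def)
  qed simp
  then show ?thesis unfolding aug_map_def leps_def labelled_of_simps by (intro sum.cong) auto
qed

lemma graded_complex_of_resolution: "graded_free_resolution P \<Longrightarrow> graded_complex P"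
  by (simp add: graded_free_resolution_def graded_complex_def)

lemma df_labelled_of_below:
  "q \<in> gens (labelled_of P) (Suc i)
    \<Longrightarrow> df (labelled_of P) i q \<in> below (labelled_of P) i {..lab (labelled_of P) (Suc i) q}"
  unfolding below_def supp_in_def by (auto simp: labelled_of_def pcoeff_def)

lemma labelled_resolution_of_resolution:
  assumes res: "graded_free_resolution P"
  shows "labelled_resolution (labelled_of P)"
proof -
  let ?L = "labelled_of P"
  note P = graded_complex_of_resolution[OF res]
  have surj: "aug_map P ` free_mod P 0 = UNIV"
    and ex0: "bdry P (Suc 0) ` free_mod P (Suc 0) = {v \<in> free_mod P 0. aug_map P v = 0}"
    using res by (simp_all add: graded_free_resolution_def)
  have exS: "bdry P (Suc (Suc i)) ` free_mod P (Suc (Suc i))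
      = {v \<in> free_mod P (Suc i). bdry P (Suc i) v = 0}" for i
  proof -
    have "1 \<le> Suc i" by simp
    then show ?thesis using res unfolding graded_free_resolution_def by (simp only:)
  qed
  have 2: "ep ?L p \<noteq> 0 \<Longrightarrow> lab ?L 0 p = 0" if "p \<in> gens ?L 0" for p
    using P that by (simp add: graded_complex_def)
  have 3: "lcycle ?L (lab ?L (Suc i) q) i (df ?L i q)" if q: "q \<in> gens ?L (Suc i)" for i q
  proof -
    let ?d = "gdeg P (Suc i) q"
    \<comment> \<open>The basis vector \<open>q\<close>, whose boundary is the column \<open>q\<close> of the matrix.\<close>
    define v :: "nat \<Rightarrow> ('a, 'b) mpoly" where "v p = (if p = q then 1 else 0)" for p
    have vf: "v \<in> free_mod P (Suc i)" using q by (simp add: free_mod_def v_def)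
    have one: "pcoeff (1 :: ('a, 'b) mpoly) 0 = 1"
    proof -
      have "nat \<circ> (0 :: 'a \<Rightarrow> int) = 0" by (simp add: fun_eq_iff)
      then show ?thesis by (simp add: pcoeff_def)
    qed
    have "hcomp P (Suc i) ?d v = unit_at q"
      using q one by (auto simp: hcomp_def v_def unit_at_def fun_eq_iff)
    then have "hcomp P i ?d (bdry P (Suc i) v) = ldiff ?L i (unit_at q)"
      by (simp only: hcomp_bdry[OF P])
    also have "\<dots> = df ?L i q"
      unfolding ldiff_def by (rule comb_of_unit) (use q in simp_all)
    finally have df: "df ?L i q = hcomp P i ?d (bdry P (Suc i) v)" ..
    show ?thesis
    proof (cases i)
      case 0
      have "bdry P (Suc 0) v \<in> {v \<in> free_mod P 0. aug_map P v = 0}"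
        unfolding ex0[symmetric] using vf 0 by blast
      then have "leps ?L (hcomp P 0 0 (bdry P (Suc 0) v)) = 0"
        using aug_map_comp[OF P] by simp
      moreover have df0: "df ?L 0 q = hcomp P 0 (gdeg P (Suc 0) q) (bdry P (Suc 0) v)"
        using df unfolding 0 .
      ultimately have "leps ?L (df ?L 0 q) = 0" if "gdeg P (Suc 0) q = 0"
        using that by (simp only:)
      then show ?thesis using 0 by simp
    next
      case (Suc j)
      have "bdry P (Suc (Suc j)) v \<in> {v \<in> free_mod P (Suc j). bdry P (Suc j) v = 0}"
        unfolding exS[symmetric] using vf Suc by blast
      then have b0: "bdry P (Suc j) (bdry P (Suc (Suc j)) v) = 0" by simp
      have dfS: "df ?L (Suc j) q
          = hcomp P (Suc j) (gdeg P (Suc (Suc j)) q) (bdry P (Suc (Suc j)) v)"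
        using df unfolding Suc .
      have "ldiff ?L j (df ?L (Suc j) q)
          = hcomp P j (gdeg P (Suc (Suc j)) q) (bdry P (Suc j) (bdry P (Suc (Suc j)) v))"
        unfolding dfS by (rule hcomp_bdry[OF P, symmetric])
      also have "\<dots> = 0" unfolding b0 by (rule hcomp_zero)
      finally show ?thesis using Suc by simp
    qed
  qed
  have 4: "\<exists>u\<in>below ?L 0 {..0}. leps ?L u = 1"
  proof -
    have "1 \<in> aug_map P ` free_mod P 0" unfolding surj by simp
    then obtain v where "aug_map P v = 1" by auto
    then show ?thesis using aug_map_comp[OF P, of v] hcomp_below[of P 0 0 v] by (intro bexI) simp_all
  qed
  have 5: "\<exists>w\<in>below ?L (Suc i) {..d}. ldiff ?L i w = z"
    if z: "z \<in> below ?L i {..d}" and lc: "lcycle ?L d i z" for d i z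
  proof -
    let ?V = "hlift P i d z"
    have Vf: "?V \<in> free_mod P i" by (rule hlift_free_mod[OF z])
    have "?V \<in> bdry P (Suc i) ` free_mod P (Suc i)"
    proof (cases i)
      case 0
      have z0: "z \<in> below ?L 0 {..d}" using z 0 by simp
      have "aug_map P ?V = leps ?L (if 0 = d then z else 0)"
        unfolding aug_map_comp[OF P] 0 hcomp_hlift[OF z0] ..
      also have "\<dots> = 0" using lc 0 by (simp add: leps_def)
      finally show ?thesis unfolding 0 ex0 using Vf 0 by simp
    next
      case (Suc j)
      have zj: "z \<in> below ?L (Suc j) {..d}" using z Suc by simp
      have "bdry P (Suc j) (hlift P (Suc j) d z) = hlift P j d (ldiff ?L j z)"
        by (rule hlift_ldiff[OF P zj])
      also have "\<dots> = 0" using lc Suc by (simp add: hlift_def fun_eq_iff)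
      finally show ?thesis unfolding Suc exS using Vf Suc by simp
    qed
    then obtain W where W: "?V = bdry P (Suc i) W" by blast
    have "ldiff ?L i (hcomp P (Suc i) d W) = hcomp P i d ?V"
      unfolding W by (rule hcomp_bdry[OF P, symmetric])
    also have "\<dots> = z" by (simp add: hcomp_hlift[OF z])
    finally show ?thesis using hcomp_below[of P "Suc i" d W] by blast
  qed
  show ?thesis
    unfolding labelled_resolution_def
    by (intro conjI allI ballI impI; (rule df_labelled_of_below 2 3 4 5; assumption)?) simp_all
qed

text \<open>Conversely, exactness of all graded pieces gives exactness, since every vector is the sum of
  its finitely many homogeneous components.\<close>

lemma bdry_sum:
  "finite A \<Longrightarrow> bdry P (Suc i) (\<lambda>p. \<Sum>d\<in>A. v d p) = (\<lambda>p. \<Sum>d\<in>A. bdry P (Suc i) (v d) p)"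
proof
  fix p
  show "bdry P (Suc i) (\<lambda>p. \<Sum>d\<in>A. v d p) p = (\<Sum>d\<in>A. bdry P (Suc i) (v d) p)"
    by (simp add: sum_distrib_left sum.swap[of _ A])
qed

lemma resolution_of_labelled_resolution:
  assumes P: "graded_complex P" and L: "labelled_resolution (labelled_of P)"
  shows "graded_free_resolution P"
proof -
  let ?L = "labelled_of P"
  have exact: "v \<in> bdry P (Suc i) ` free_mod P (Suc i)"
    if v: "v \<in> free_mod P i" and lc: "\<And>d. lcycle ?L d i (hcomp P i d v)" for v i
  proof -
    have "\<forall>d. \<exists>w. w \<in> below ?L (Suc i) {..d} \<and> ldiff ?L i w = hcomp P i d v"
      using L hcomp_below[of P i _ v] lc unfolding labelled_resolution_def by meson
    from choice[OF this] obtain w where w: "\<And>d. w d \<in> below ?L (Suc i) {..d}"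
      "\<And>d. ldiff ?L i (w d) = hcomp P i d v"
      by blast
    define W where "W = (\<lambda>p. \<Sum>d\<in>degrees P i v. hlift P (Suc i) d (w d) p)"
    have "hlift P (Suc i) d (w d) p = 0" if "rk P (Suc i) \<le> p" for d p
      using hlift_free_mod[OF w(1)[of d]] that by (simp add: free_mod_def)
    then have "W \<in> free_mod P (Suc i)" by (simp add: free_mod_def W_def)
    moreover have "bdry P (Suc i) W = v"
    proof
      fix p
      have "bdry P (Suc i) W p = (\<Sum>d\<in>degrees P i v. bdry P (Suc i) (hlift P (Suc i) d (w d)) p)"
        unfolding W_def bdry_sum[OF finite_degrees] ..
      also have "\<dots> = (\<Sum>d\<in>degrees P i v. hlift P i d (hcomp P i d v) p)"
        by (rule sum.cong[OF refl]) (simp only: hlift_ldiff[OF P w(1)] w(2))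
      also have "\<dots> = v p" by (rule sum_components[OF v, symmetric])
      finally show "bdry P (Suc i) W p = v p" .
    qed
    ultimately show ?thesis by (intro image_eqI[of _ _ W]) simp_all
  qed
  obtain u where u: "u \<in> below ?L 0 {..0}" "leps ?L u = 1"
    using L unfolding labelled_resolution_def by blast
  have "c \<in> aug_map P ` free_mod P 0" for c
  proof
    have cu: "fscale c u \<in> below ?L 0 {..0}" by (rule fs.subspace_scale[OF subspace_below u(1)])
    show "hlift P 0 0 (fscale c u) \<in> free_mod P 0" by (rule hlift_free_mod[OF cu])
    have "leps ?L (fscale c u) = c * leps ?L u"
      by (simp add: leps_def sum_distrib_left mult.assoc)
    then show "c = aug_map P (hlift P 0 0 (fscale c u))"
      unfolding aug_map_comp[OF P] hcomp_hlift[OF cu] u(2) by simp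
  qed
  then have surj: "aug_map P ` free_mod P 0 = UNIV" by blast
  have aug_bdry: "aug_map P (bdry P (Suc 0) v) = 0" for v
  proof -
    have "hcomp P (Suc 0) 0 v q * leps ?L (df ?L 0 q) = 0" if q: "q \<in> gens ?L (Suc 0)" for q
    proof (cases "lab ?L (Suc 0) q = 0")
      case True
      have "lcycle ?L (lab ?L (Suc 0) q) 0 (df ?L 0 q)"
        using L q unfolding labelled_resolution_def by blast
      then show ?thesis using True by simp
    next
      case False
      show ?thesis
      proof (cases "hcomp P (Suc 0) 0 v q = 0")
        case nz: False
        have le: "lab ?L (Suc 0) q \<le> 0"
          using conjunct2[OF belowD[OF hcomp_below nz]] by (simp only: atMost_iff)
        have "df ?L 0 q p * ep ?L p = 0" if "p \<in> gens ?L 0" for p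
        proof (rule ccontr)
          assume "df ?L 0 q p * ep ?L p \<noteq> 0"
          then have nz': "df ?L 0 q p \<noteq> 0" and "ep ?L p \<noteq> 0" by auto
          have "lab ?L 0 p \<le> lab ?L (Suc 0) q"
            using conjunct2[OF belowD[OF df_labelled_of_below[OF q] nz']] by (simp only: atMost_iff)
          moreover have "lab ?L 0 p = 0"
            using P that \<open>ep ?L p \<noteq> 0\<close> by (simp add: graded_complex_def)
          ultimately have "lab ?L (Suc 0) q = 0" using le by (metis order.antisym)
          then show False using False by simp
        qed
        then have "leps ?L (df ?L 0 q) = 0" unfolding leps_def by (rule sum.neutral[rule_format])
        then show ?thesis by (simp only: mult_zero_right)
      qed simp
    qed
    then have "leps ?L (ldiff ?L 0 (hcomp P (Suc 0) 0 v)) = 0"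
      unfolding ldiff_def leps_comb by (rule sum.neutral[rule_format])
    then show ?thesis by (simp only: aug_map_comp[OF P] hcomp_bdry[OF P])
  qed
  have bdry_bdry: "bdry P (Suc i) (bdry P (Suc (Suc i)) v) = 0" for i v
  proof (rule free_mod_eq_0[OF bdry_free_mod])
    fix d
    have "hcomp P i d (bdry P (Suc i) (bdry P (Suc (Suc i)) v))
        = ldiff ?L i (ldiff ?L (Suc i) (hcomp P (Suc (Suc i)) d v))"
      by (simp only: hcomp_bdry[OF P])
    also have "\<dots> = comb (gens ?L (Suc (Suc i))) (\<lambda>q. ldiff ?L i (df ?L (Suc i) q))
        (hcomp P (Suc (Suc i)) d v)"
      unfolding ldiff_def[of ?L "Suc i"] by (rule ldiff_comb)
    also have "\<dots> = comb (gens ?L (Suc (Suc i))) (\<lambda>q. 0) (hcomp P (Suc (Suc i)) d v)"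
      by (rule comb_cong) (rule ldiff_df[OF L])
    also have "\<dots> = 0" by (simp add: comb_def fun_eq_iff)
    finally show "hcomp P i d (bdry P (Suc i) (bdry P (Suc (Suc i)) v)) = 0" .
  qed
  have ex0: "bdry P 1 ` free_mod P 1 = {v \<in> free_mod P 0. aug_map P v = 0}"
  proof (intro subset_antisym subsetI)
    fix v assume "v \<in> bdry P 1 ` free_mod P 1"
    then show "v \<in> {v \<in> free_mod P 0. aug_map P v = 0}"
      using aug_bdry bdry_free_mod[of P 0] by auto
  next
    fix v assume "v \<in> {v \<in> free_mod P 0. aug_map P v = 0}"
    then have v: "v \<in> free_mod P 0" "aug_map P v = 0" by auto
    have "lcycle ?L d 0 (hcomp P 0 d v)" for d using v(2) aug_map_comp[OF P, of v] by simp
    then have "v \<in> bdry P (Suc 0) ` free_mod P (Suc 0)" by (rule exact[OF v(1)])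
    then show "v \<in> bdry P 1 ` free_mod P 1" by simp
  qed
  have exS: "bdry P (Suc i) ` free_mod P (Suc i) = {v \<in> free_mod P i. bdry P i v = 0}" if "i \<ge> 1" for i
  proof -
    obtain j where j: "i = Suc j" using not0_implies_Suc[of i] \<open>i \<ge> 1\<close> by auto
    show ?thesis
    proof (intro subset_antisym subsetI)
      fix v assume "v \<in> bdry P (Suc i) ` free_mod P (Suc i)"
      then show "v \<in> {v \<in> free_mod P i. bdry P i v = 0}"
        using bdry_bdry bdry_free_mod j by blast
    next
      fix v assume "v \<in> {v \<in> free_mod P i. bdry P i v = 0}"
      then have v: "v \<in> free_mod P i" "bdry P (Suc j) v = 0" using j by auto
      have "ldiff ?L j (hcomp P (Suc j) d v) = 0" for d
        unfolding hcomp_bdry[OF P, symmetric] v(2) by (rule hcomp_zero)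
      then have "lcycle ?L d i (hcomp P i d v)" for d using j by simp
      then show "v \<in> bdry P (Suc i) ` free_mod P (Suc i)" by (rule exact[OF v(1)])
    qed
  qed
  show ?thesis
    using P surj ex0 exS unfolding graded_free_resolution_def graded_complex_def by blast
qed

section \<open>Existence of a graded free resolution\<close>

lemma labelled_resolution_transport:
  fixes K :: "('a, 'n, 'k::field) labelled_complex" and L :: "('b, 'n, 'k) labelled_complex"
  assumes K: "labelled_resolution K"
    and e: "\<And>i. bij_betw (e i) (gens L i) (gens K i)"
    and lab: "\<And>i p. p \<in> gens L i \<Longrightarrow> lab L i p = lab K i (e i p)"
    and df: "\<And>i p q. p \<in> gens L i \<Longrightarrow> q \<in> gens L (Suc i)
      \<Longrightarrow> df L i q p = df K i (e (Suc i) q) (e i p)"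
    and df0: "\<And>i p q. p \<notin> gens L i \<Longrightarrow> df L i q p = 0"
    and ep: "\<And>p. p \<in> gens L 0 \<Longrightarrow> ep L p = ep K (e 0 p)"
  shows "labelled_resolution L"
proof -
  define push where "push i f = (\<lambda>x. if x \<in> gens K i then f (inv_into (gens L i) (e i) x) else 0)"
    for i and f :: "'b \<Rightarrow> 'k"
  define pull where "pull i g = (\<lambda>p. if p \<in> gens L i then g (e i p) else 0)"
    for i and g :: "'a \<Rightarrow> 'k"
  have eK: "e i p \<in> gens K i" if "p \<in> gens L i" for i p
    using bij_betwE[OF e] that by blast
  have inv: "inv_into (gens L i) (e i) (e i p) = p" if "p \<in> gens L i" for i p
    by (rule bij_betw_inv_into_left[OF e that])
  have inv': "inv_into (gens L i) (e i) x \<in> gens L i" "e i (inv_into (gens L i) (e i) x) = x"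
    if "x \<in> gens K i" for i x
    using bij_betw_inv_into_right[OF e that] bij_betwE[OF bij_betw_inv_into[OF e]] that by blast+
  have pull_push: "pull i (push i f) = f" if "f \<in> supp_in (gens L i)" for i f
    using that eK inv by (auto simp: pull_def push_def supp_in_def fun_eq_iff)
  have push_below: "push i f \<in> below K i D" if f: "f \<in> below L i D" for i f D
  proof -
    have "x \<in> gens K i \<and> lab K i x \<in> D" if "push i f x \<noteq> 0" for x
    proof -
      have x: "x \<in> gens K i" "f (inv_into (gens L i) (e i) x) \<noteq> 0"
        using that by (auto simp: push_def split: if_splits)
      then show ?thesis using belowD[OF f x(2)] lab inv'[OF x(1)] by auto
    qed
    then show ?thesis unfolding below_def supp_in_def by blast
  qed
  have pull_below: "pull i g \<in> below L i D" if g: "g \<in> below K i D" for i g D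
  proof -
    have "p \<in> gens L i \<and> lab L i p \<in> D" if "pull i g p \<noteq> 0" for p
    proof -
      have p: "p \<in> gens L i" "g (e i p) \<noteq> 0"
        using that by (auto simp: pull_def split: if_splits)
      then show ?thesis using belowD[OF g p(2)] lab[OF p(1)] by simp
    qed
    then show ?thesis unfolding below_def supp_in_def by blast
  qed
  have pull_ldiff: "ldiff L i (pull (Suc i) g) = pull i (ldiff K i g)" for i g
  proof
    fix p
    show "ldiff L i (pull (Suc i) g) p = pull i (ldiff K i g) p"
    proof (cases "p \<in> gens L i")
      case True
      have "ldiff L i (pull (Suc i) g) p
          = (\<Sum>q\<in>gens L (Suc i). g (e (Suc i) q) * df K i (e (Suc i) q) (e i p))"
        unfolding ldiff_def comb_def
        by (rule sum.cong[OF refl]) (simp add: pull_def df[OF True])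
      also have "\<dots> = (\<Sum>x\<in>gens K (Suc i). g x * df K i x (e i p))"
        by (rule sum.reindex_bij_betw[OF e])
      finally show ?thesis using True by (simp add: pull_def ldiff_def comb_def)
    next
      case False
      then show ?thesis by (simp add: pull_def ldiff_def comb_def df0)
    qed
  qed
  have pull_df: "df L i q = pull i (df K i (e (Suc i) q))" if "q \<in> gens L (Suc i)" for i q
    using df[OF _ that] df0 by (auto simp: pull_def fun_eq_iff)
  have leps_pull: "leps L (pull 0 g) = leps K g" for g
  proof -
    have "leps L (pull 0 g) = (\<Sum>p\<in>gens L 0. g (e 0 p) * ep K (e 0 p))"
      unfolding leps_def by (rule sum.cong[OF refl]) (simp add: pull_def ep)
    also have "\<dots> = leps K g" unfolding leps_def by (rule sum.reindex_bij_betw[OF e])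
    finally show ?thesis .
  qed
  have pull0: "pull i 0 = 0" for i by (simp add: pull_def fun_eq_iff)
  have lcycle_pull: "lcycle L d i (pull i g)" if "lcycle K d i g" for d i g
  proof (cases i)
    case 0
    then show ?thesis using that leps_pull by simp
  next
    case (Suc j)
    then show ?thesis using that by (simp add: pull_ldiff pull0)
  qed
  have lcycle_push: "lcycle K d i (push i f)" if f: "f \<in> supp_in (gens L i)" and lc: "lcycle L d i f"
    for d i f
  proof (cases i)
    case 0
    then show ?thesis using lc leps_pull[of "push 0 f"] pull_push[OF f] by simp
  next
    case (Suc j)
    have "pull j (ldiff K j (push i f)) = 0"
      using lc pull_ldiff[of j "push i f"] pull_push[OF f] Suc by simp
    then have z: "(if p \<in> gens L j then ldiff K j (push i f) (e j p) else 0) = 0" for p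
      by (simp add: pull_def fun_eq_iff)
    have "ldiff K j (push i f) x = 0" for x
    proof (cases "x \<in> gens K j")
      case True
      then show ?thesis using z[of "inv_into (gens L j) (e j) x"] inv'[OF True] by simp
    next
      case False
      have "df K j q x = 0" if "q \<in> gens K (Suc j)" for q
        using belowD[OF df_below[OF K that], of x] False by blast
      then show ?thesis by (simp add: ldiff_def comb_def)
    qed
    then show ?thesis using Suc by (simp add: fun_eq_iff)
  qed
  have 0: "finite (gens L i)" for i
    using bij_betw_finite[OF e] finite_gens[OF K] by blast
  have 1: "df L i q \<in> below L i {..lab L (Suc i) q}" if q: "q \<in> gens L (Suc i)" for i q
    unfolding pull_df[OF q] lab[OF q] by (rule pull_below[OF df_below[OF K eK[OF q]]])
  have 2: "ep L p \<noteq> 0 \<Longrightarrow> lab L 0 p = 0" if p: "p \<in> gens L 0" for p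
    unfolding ep[OF p] lab[OF p] using K eK[OF p] unfolding labelled_resolution_def by blast
  have 3: "lcycle L (lab L (Suc i) q) i (df L i q)" if q: "q \<in> gens L (Suc i)" for i q
    unfolding pull_df[OF q] lab[OF q]
    by (rule lcycle_pull) (use K eK[OF q] in \<open>simp add: labelled_resolution_def\<close>)
  have 4: "\<exists>u\<in>below L 0 {..0}. leps L u = 1"
  proof -
    obtain u where u: "u \<in> below K 0 {..0}" "leps K u = 1"
      using K unfolding labelled_resolution_def by blast
    then show ?thesis using pull_below leps_pull by metis
  qed
  have 5: "\<exists>w\<in>below L (Suc i) {..d}. ldiff L i w = z"
    if z: "z \<in> below L i {..d}" and lc: "lcycle L d i z" for d i z
  proof -
    have "lcycle K d i (push i z)" by (rule lcycle_push[OF below_gens[OF z] lc])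
    then obtain w where w: "w \<in> below K (Suc i) {..d}" "ldiff K i w = push i z"
      using K push_below[OF z] unfolding labelled_resolution_def by meson
    have "ldiff L i (pull (Suc i) w) = z"
      unfolding pull_ldiff w(2) by (rule pull_push[OF below_gens[OF z]])
    then show ?thesis using pull_below[OF w(1)] by blast
  qed
  show ?thesis
    unfolding labelled_resolution_def
    by (intro conjI allI ballI impI; (rule 0 1 2 3 4 5; assumption)?)
qed

text \<open>The Koszul complex, with the faces of each cardinality enumerated.\<close>

lemma graded_free_resolution_exists:
  "\<exists>P :: ('n::finite, 'k::field) free_complex. graded_free_resolution P"
proof -
  let ?K = "koszul :: ('n set, 'n, 'k) labelled_complex"
  define r where "r i = card {s :: 'n set. card s = i}" for i
  have "\<exists>e. bij_betw e {..<r i} {s :: 'n set. card s = i}" for i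
    using ex_bij_betw_nat_finite[of "{s :: 'n set. card s = i}"] by (simp add: r_def atLeast0LessThan)
  then have "\<forall>i. \<exists>e. bij_betw e {..<r i} {s :: 'n set. card s = i}" by blast
  from choice[OF this] obtain e where e: "\<And>i. bij_betw (e i) {..<r i} {s :: 'n set. card s = i}"
    by blast
  define P :: "('n, 'k) free_complex" where
    "P = \<lparr>rk = r, gdeg = \<lambda>i p. indic (e i p),
       mat = \<lambda>i p q. if indic (e i p) \<le> indic (e (Suc i) q)
         then hsingle (indic (e (Suc i) q) - indic (e i p)) (bd (unit_at (e (Suc i) q)) (e i p)) else 0,
       aug = \<lambda>p. 1\<rparr>"
  have e_card: "card (e i p) = i" if "p < r i" for i p
    using bij_betwE[OF e[of i]] that by blast
  have "homogeneous (gdeg P (Suc i) q - gdeg P i p) (mat P i p q)" for i p q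
    by (auto simp: P_def homogeneous_hsingle) (simp add: homogeneous_def)
  moreover have "gdeg P 0 p = 0" if "p < rk P 0" for p
    using e_card[of p 0] that by (simp add: P_def indic_eq_0_iff)
  ultimately have gP: "graded_complex P" by (simp add: graded_complex_def)
  have "labelled_resolution (labelled_of P)"
  proof (rule labelled_resolution_transport[OF koszul_resolution, where e = e])
    show "bij_betw (e i) (gens (labelled_of P) i) (gens ?K i)" for i
      using e[of i] by (simp add: P_def)
    show "lab (labelled_of P) i p = lab ?K i (e i p)" for i p by (simp add: P_def)
    show "ep (labelled_of P) p = ep ?K (e 0 p)" for p by (simp add: P_def)
    show "df (labelled_of P) i q p = 0" if "p \<notin> gens (labelled_of P) i" for i p q
      using that by (simp add: labelled_of_def)
    show "df (labelled_of P) i q p = df ?K i (e (Suc i) q) (e i p)"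
      if p: "p \<in> gens (labelled_of P) i" and q: "q \<in> gens (labelled_of P) (Suc i)" for i p q
    proof (cases "indic (e i p) \<le> indic (e (Suc i) q)")
      case True
      then have "0 \<le> indic (e (Suc i) q) - indic (e i p)" by simp
      then show ?thesis using p True by (simp add: labelled_of_def P_def pcoeff_hsingle)
    next
      case False
      have "card (e (Suc i) q) = Suc i" using e_card q by (simp add: P_def)
      from bd_unit_below[OF this] have "bd (unit_at (e (Suc i) q)) (e i p) = (0 :: 'k)"
        using schainsD[of "bd (unit_at (e (Suc i) q))" _ i "e i p"] False by blast
      then show ?thesis using p False by (simp add: labelled_of_def P_def)
    qed
  qed
  then show ?thesis using resolution_of_labelled_resolution[OF gP] by blast
qed

section \<open>Betti numbers of monomial ideals as simplicial homology\<close>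

text \<open>Monomial ideals, described by their monomials.\<close>

definition monomial_closed :: "('n::finite, 'k::field) mpoly set \<Rightarrow> bool" where
  "monomial_closed N \<longleftrightarrow> (\<forall>f. f \<in> N \<longleftrightarrow> (\<forall>u\<in>Poly_Mapping.keys f. monom u \<in> N)) \<and>
     (\<forall>u v. monom u \<in> N \<longrightarrow> u \<le> v \<longrightarrow> monom v \<in> N)"

definition degs :: "('n::finite, 'k::field) mpoly set \<Rightarrow> ('n \<Rightarrow> int) set" where
  "degs N = {e. 0 \<le> e \<and> monom (nat \<circ> e) \<in> N}"

lemma monomial_closed_single:
  "monomial_closed N \<Longrightarrow> Poly_Mapping.single u c \<in> N \<longleftrightarrow> c = 0 \<or> monom u \<in> N"
proof -
  assume "monomial_closed N"
  then have "Poly_Mapping.single u c \<in> N \<longleftrightarrow> (\<forall>w\<in>Poly_Mapping.keys (Poly_Mapping.single u c). monom w \<in> N)"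
    unfolding monomial_closed_def by blast
  then show ?thesis by auto
qed

lemma degs_upward: "monomial_closed N \<Longrightarrow> e \<in> degs N \<Longrightarrow> e \<le> e' \<Longrightarrow> e' \<in> degs N"
proof -
  assume N: "monomial_closed N" and e: "e \<in> degs N" and le: "e \<le> e'"
  have "nat \<circ> e \<le> nat \<circ> e'" using le by (auto simp: le_fun_def intro: nat_mono)
  moreover have "0 \<le> e'" using e le by (auto simp: degs_def)
  ultimately show ?thesis using N e unfolding degs_def monomial_closed_def by blast
qed

lemma downset_degs: "monomial_closed N \<Longrightarrow> downset {g. d - g \<in> degs N}"
  unfolding downset_def
proof (intro ballI allI impI)
  fix g g' assume "monomial_closed N" "g \<in> {g. d - g \<in> degs N}" "g' \<le> g"
  moreover from this have "d - g \<le> d - g'" by (simp add: diff_left_mono)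
  ultimately show "g' \<in> {g. d - g \<in> degs N}" using degs_upward by blast
qed

text \<open>A copy of \<open>N\<close> shifted by \<open>g\<close> contributes to degree \<open>d\<close> exactly if the monomial of degree \<open>d - g\<close>
  lies in \<open>N\<close>, and this is a down-closed condition on the label \<open>g\<close>.\<close>

lemma tensor_deg_eq:
  assumes N: "monomial_closed N"
  shows "tensor_deg P N i d = hlift P i d ` below (labelled_of P) i {g. d - g \<in> degs N}"
proof (intro subset_antisym subsetI)
  let ?D = "{g. d - g \<in> degs N}"
  fix v assume "v \<in> tensor_deg P N i d"
  then have vf: "v \<in> free_mod P i" and vN: "\<And>p. p < rk P i \<Longrightarrow> v p \<in> N"
    and vh: "\<And>p. p < rk P i \<Longrightarrow> homogeneous (d - gdeg P i p) (v p)"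
    by (auto simp: tensor_deg_def)
  have "p \<in> gens (labelled_of P) i \<and> lab (labelled_of P) i p \<in> ?D" if nz: "hcomp P i d v p \<noteq> 0" for p
  proof -
    have p: "p < rk P i" and c: "pcoeff (v p) (d - gdeg P i p) \<noteq> 0"
      using nz by (auto simp: hcomp_def split: if_splits)
    have e: "0 \<le> d - gdeg P i p" using c unfolding pcoeff_def by metis
    have "v p = hsingle (d - gdeg P i p) (pcoeff (v p) (d - gdeg P i p))"
      using homogeneous_eq_hsingle[OF vh[OF p]] e by simp
    then have "Poly_Mapping.single (nat \<circ> (d - gdeg P i p)) (pcoeff (v p) (d - gdeg P i p)) \<in> N"
      using vN[OF p] unfolding hsingle_def by simp
    then show ?thesis using c e p monomial_closed_single[OF N] by (simp add: degs_def)
  qed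
  then have "hcomp P i d v \<in> below (labelled_of P) i ?D" unfolding below_def supp_in_def by blast
  moreover have "v = hlift P i d (hcomp P i d v)" by (rule hlift_comp[OF vf vh, symmetric])
  ultimately show "v \<in> hlift P i d ` below (labelled_of P) i ?D" unfolding image_iff by blast
next
  let ?D = "{g. d - g \<in> degs N}"
  fix v assume "v \<in> hlift P i d ` below (labelled_of P) i ?D"
  then obtain f where f: "f \<in> below (labelled_of P) i ?D" "v = hlift P i d f" by blast
  have "?D \<subseteq> {..d}"
  proof
    fix g assume "g \<in> ?D"
    then have "0 \<le> d - g" by (simp add: degs_def)
    then show "g \<in> {..d}" by simp
  qed
  then have f': "f \<in> below (labelled_of P) i {..d}" using below_mono f(1) by blast
  have "v p \<in> N" for p
  proof (cases "f p = 0")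
    case True
    then have "v p = Poly_Mapping.single 0 0" using f(2) by (simp add: hlift_def)
    then show ?thesis using monomial_closed_single[OF N, of 0 0] by simp
  next
    case False
    then have "d - gdeg P i p \<in> degs N" using belowD[OF f(1)] by auto
    then show ?thesis using f(2) monomial_closed_single[OF N]
      by (simp add: hlift_def hsingle_def degs_def)
  qed
  then show "v \<in> tensor_deg P N i d"
    using hlift_free_mod[OF f(1), of d] hlift_homogeneous[OF f'] f(2) by (simp add: tensor_deg_def)
qed

lemma dim_linear_image:
  assumes f: "Vector_Spaces.linear s1 s2 f" and Z: "module.subspace s1 Z" and inj: "inj_on f Z"
  shows "vector_space.dim s2 (f ` Z) = vector_space.dim s1 Z"
proof -
  interpret f: Vector_Spaces.linear s1 s2 f by fact
  obtain b where b: "b \<subseteq> Z" "f.vs1.independent b" "Z \<subseteq> f.vs1.span b"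
    using f.vs1.maximal_independent_subset by blast
  have span: "f.vs1.span b = Z" using b f.vs1.span_minimal[OF b(1) Z] by blast
  have "f.vs2.independent (f ` b)"
    by (rule f.independent_injective_image[OF b(2)]) (simp only: span inj)
  moreover have "f ` Z \<subseteq> f.vs2.span (f ` b)" unfolding f.span_image span ..
  moreover have "f ` b \<subseteq> f ` Z" using b(1) by blast
  ultimately have "card (f ` b) = f.vs2.dim (f ` Z)"
    by (intro f.vs2.basis_card_eq_dim)
  moreover have "card (f ` b) = card b" by (rule card_image[OF inj_on_subset[OF inj b(1)]])
  moreover have "card b = f.vs1.dim Z" by (rule f.vs1.basis_card_eq_dim[OF b(1,3,2)])
  ultimately show ?thesis by simp
qed

lemma vector_space_scale_k: "vector_space (scale_k :: 'k::field \<Rightarrow> (nat \<Rightarrow> ('n::finite, 'k) mpoly) \<Rightarrow> _)"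
proof unfold_locales
  fix a b :: 'k and x y :: "nat \<Rightarrow> ('n, 'k) mpoly"
  show "scale_k a (x + y) = scale_k a x + scale_k a y"
    by (simp add: scale_k_def fun_eq_iff distrib_left)
  show "scale_k (a + b) x = scale_k a x + scale_k b x"
    by (simp add: scale_k_def fun_eq_iff single_add distrib_right)
  show "scale_k a (scale_k b x) = scale_k (a * b) x"
    by (simp add: scale_k_def fun_eq_iff mult.assoc[symmetric] mult_single)
  show "scale_k 1 x = x"
    by (simp add: scale_k_def fun_eq_iff)
qed

lemma linear_hlift: "Vector_Spaces.linear fscale scale_k (hlift P i d)"
proof -
  interpret s: vector_space scale_k by (rule vector_space_scale_k)
  show ?thesis
    by unfold_locales
      (simp_all add: hlift_def hsingle_def scale_k_def fun_eq_iff single_add mult_single)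
qed

lemma tor_dim_eq_lhom:
  assumes res: "graded_free_resolution P" and N: "monomial_closed N"
  shows "tor_dim P i d N = lhom (labelled_of P) {g. d - g \<in> degs N} i"
proof -
  let ?L = "labelled_of P" and ?D = "{g. d - g \<in> degs N}"
  note P = graded_complex_of_resolution[OF res]
  note L = labelled_resolution_of_resolution[OF res]
  have D: "?D \<subseteq> {..d}"
  proof
    fix g assume "g \<in> ?D"
    then have "0 \<le> d - g" by (simp add: degs_def)
    then show "g \<in> {..d}" by simp
  qed
  have inj: "inj_on (hlift P j d) (below ?L j {..d})" for j
  proof (rule inj_on_inverseI)
    fix f assume "f \<in> below ?L j {..d}"
    then show "hcomp P j d (hlift P j d f) = f" by (simp add: hcomp_hlift)
  qed
  have bD: "below ?L j ?D \<subseteq> below ?L j {..d}" for j using below_mono[OF D] by blast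
  define Z where "Z = {z \<in> below ?L i ?D. \<forall>j. i = Suc j \<longrightarrow> ldiff ?L j z = 0}"
  define B where "B = ldiff ?L i ` below ?L (Suc i) ?D"
  have ldiff_below: "ldiff ?L j f \<in> below ?L j E" if "f \<in> below ?L (Suc j) E" "downset E" for j f E
    unfolding ldiff_def by (rule comb_below[OF that(2,1) df_below[OF L]])
  have cyc: "bdry P i (hlift P i d z) = 0 \<longleftrightarrow> (\<forall>j. i = Suc j \<longrightarrow> ldiff ?L j z = 0)"
    if z: "z \<in> below ?L i ?D" for z
  proof (cases i)
    case 0
    then show ?thesis by (simp add: fun_eq_iff)
  next
    case (Suc j)
    have zd: "z \<in> below ?L (Suc j) {..d}" using z bD Suc by blast
    have "hlift P j d (ldiff ?L j z) = 0 \<longleftrightarrow> ldiff ?L j z = 0"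
    proof
      assume "hlift P j d (ldiff ?L j z) = 0"
      then have "hlift P j d (ldiff ?L j z) = hlift P j d 0" by (simp add: hlift_def fun_eq_iff)
      then show "ldiff ?L j z = 0"
        by (rule inj_onD[OF inj _ ldiff_below[OF zd downset_atMost] fs.subspace_0[OF subspace_below]])
    qed (simp add: hlift_def fun_eq_iff)
    then show ?thesis using hlift_ldiff[OF P zd] Suc by (simp del: bdry.simps)
  qed
  have "tor_cycles P N i d = hlift P i d ` Z"
    unfolding tor_cycles_def tensor_deg_eq[OF N] Z_def using cyc by blast
  moreover have "tor_boundaries P N i d = hlift P i d ` B"
    unfolding tor_boundaries_def tensor_deg_eq[OF N] B_def image_image
  proof (rule image_cong[OF refl])
    fix f assume "f \<in> below ?L (Suc i) ?D"
    then have "f \<in> below ?L (Suc i) {..d}" using bD by blast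
    then show "bdry P (Suc i) (hlift P (Suc i) d f) = hlift P i d (ldiff ?L i f)"
      by (rule hlift_ldiff[OF P])
  qed
  moreover have "dim_k (hlift P i d ` Z) = fs.dim Z"
  proof (rule dim_linear_image[OF linear_hlift])
    show "fs.subspace Z"
      unfolding Z_def fs.subspace_def using subspace_below[of ?L i ?D]
      by (auto simp: fs.subspace_def ldiff_def comb_add comb_scale comb_zero)
    show "inj_on (hlift P i d) Z"
      by (rule inj_on_subset[OF inj]) (use bD in \<open>auto simp: Z_def\<close>)
  qed
  moreover have "dim_k (hlift P i d ` B) = fs.dim B"
  proof (rule dim_linear_image[OF linear_hlift])
    interpret l: Vector_Spaces.linear fscale fscale "ldiff ?L i"
      unfolding ldiff_def by (rule linear_comb)
    show "fs.subspace B" unfolding B_def by (rule l.subspace_image[OF subspace_below])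
    have "B \<subseteq> below ?L i {..d}"
      unfolding B_def by (rule image_subsetI) (rule ldiff_below[OF subsetD[OF bD] downset_atMost])
    then show "inj_on (hlift P i d) B" by (rule inj_on_subset[OF inj])
  qed
  ultimately show ?thesis by (simp only: tor_dim_def lhom_def Z_def B_def)
qed

text \<open>For any resolution \<open>Tor\<close> is the homology of a labelled resolution on a down-closed set of
  labels. By the comparison theorem the Koszul complex computes it as well, and there the basis
  elements are the faces of a simplicial complex.\<close>

lemma betti_eq_hdim:
  assumes N: "monomial_closed (N :: ('n::finite, 'k::field) mpoly set)"
  shows "betti (int i) d N = hdim TYPE('k) {s. d - indic s \<in> degs N} i"
proof -
  define P :: "('n, 'k) free_complex" where "P = (SOME P. graded_free_resolution P)"
  have res: "graded_free_resolution P"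
    unfolding P_def by (rule someI_ex[OF graded_free_resolution_exists])
  let ?D = "{g. d - g \<in> degs N}"
  note L = labelled_resolution_of_resolution[OF res]
  have "lhom (labelled_of P) ?D i = lhom (koszul :: ('n set, 'n, 'k) labelled_complex) ?D i"
    by (rule order.antisym[OF lhom_le[OF L koszul_resolution downset_degs[OF N]]
          lhom_le[OF koszul_resolution L downset_degs[OF N]]])
  also have "\<dots> = hdim TYPE('k) {s. indic s \<in> ?D} i" by (rule lhom_koszul[OF downset_degs[OF N]])
  finally show ?thesis
    using tor_dim_eq_lhom[OF res N, of i d] by (simp add: betti_def P_def[symmetric])
qed

section \<open>Monomial ideals and their irreducible components\<close>

definition mono_set :: "('n::finite \<Rightarrow> nat) set \<Rightarrow> ('n, 'k::field) mpoly set" where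
  "mono_set W = {f. Poly_Mapping.keys f \<subseteq> W}"

definition upset :: "('n \<Rightarrow> nat) set \<Rightarrow> bool" where
  "upset W \<longleftrightarrow> (\<forall>u\<in>W. \<forall>v\<ge>u. v \<in> W)"

lemma upsetD: "upset W \<Longrightarrow> u \<in> W \<Longrightarrow> u \<le> v \<Longrightarrow> v \<in> W"
  by (auto simp: upset_def)

lemma monom_mono_set [simp]: "monom u \<in> mono_set W \<longleftrightarrow> u \<in> W"
  by (simp add: mono_set_def monom_def)

lemma mono_set_subset_iff: "mono_set W \<subseteq> (mono_set W' :: ('n::finite, 'k::field) mpoly set) \<longleftrightarrow> W \<subseteq> W'"
proof
  assume le: "mono_set W \<subseteq> (mono_set W' :: ('n, 'k) mpoly set)"
  show "W \<subseteq> W'"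
  proof
    fix u assume "u \<in> W"
    then show "u \<in> W'" using subsetD[OF le, of "monom u"] by simp
  qed
qed (auto simp: mono_set_def)

lemma mono_set_UNIV: "mono_set UNIV = UNIV"
  by (simp add: mono_set_def)

lemma monomial_closed_mono_set: "upset W \<Longrightarrow> monomial_closed (mono_set W :: ('n::finite, 'k::field) mpoly set)"
  unfolding monomial_closed_def monom_mono_set by (auto simp: mono_set_def upset_def)

interpretation mp: module "(*) :: ('n::finite, 'k::field) mpoly \<Rightarrow> ('n, 'k) mpoly \<Rightarrow> ('n, 'k) mpoly"
  by unfold_locales (auto simp: algebra_simps)

lemma ideal_gen_monom:
  "ideal_gen (monom ` U) = (mono_set {u. \<exists>g\<in>U. g \<le> u} :: ('n::finite, 'k::field) mpoly set)"
proof (intro subset_antisym)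
  let ?M = "mono_set {u. \<exists>g\<in>U. g \<le> u} :: ('n, 'k) mpoly set"
  have "mp.subspace ?M"
    unfolding mp.subspace_def
  proof (intro conjI ballI allI)
    show "0 \<in> ?M" by (simp add: mono_set_def)
    fix x y assume x: "x \<in> ?M"
    {
      assume "y \<in> ?M"
      then show "x + y \<in> ?M" using x keys_add[of x y] by (auto simp: mono_set_def)
    }
    fix c :: "('n, 'k) mpoly"
    show "c * x \<in> ?M"
      unfolding mono_set_def
    proof (intro CollectI subsetI)
      fix u assume "u \<in> Poly_Mapping.keys (c * x)"
      then obtain v w where u: "u = v + w" "w \<in> Poly_Mapping.keys x" using keys_mult[of c x] by blast
      then obtain g where "g \<in> U" "g \<le> w" using x by (auto simp: mono_set_def)
      moreover have "w \<le> u" using u(1) by (simp add: le_fun_def)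
      ultimately show "\<exists>g\<in>U. g \<le> u" using order_trans by blast
    qed
  qed
  moreover have "monom ` U \<subseteq> ?M" by (simp add: image_subset_iff) blast
  ultimately show "ideal_gen (monom ` U) \<subseteq> ?M" by (intro mp.span_minimal)
  show "?M \<subseteq> ideal_gen (monom ` U)"
  proof
    fix f assume f: "f \<in> ?M"
    have "Poly_Mapping.single u (Poly_Mapping.lookup f u) \<in> ideal_gen (monom ` U)"
      if u: "u \<in> Poly_Mapping.keys f" for u
    proof -
      obtain g where g: "g \<in> U" "g \<le> u" using f u by (auto simp: mono_set_def)
      have "(\<lambda>j. u j - g j) + g = u" using g(2) by (simp add: fun_eq_iff le_fun_def)
      then have "Poly_Mapping.single u (Poly_Mapping.lookup f u)
          = Poly_Mapping.single (\<lambda>j. u j - g j) (Poly_Mapping.lookup f u) * (monom g :: ('n, 'k) mpoly)"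
        by (simp only: monom_def mult_single mult_1_right)
      moreover have "\<dots> \<in> ideal_gen (monom ` U)"
        by (intro mp.span_scale mp.span_base imageI g(1))
      ultimately show ?thesis by (simp only:)
    qed
    then have "(\<Sum>u\<in>Poly_Mapping.keys f. Poly_Mapping.single u (Poly_Mapping.lookup f u))
        \<in> ideal_gen (monom ` U)"
      by (rule mp.span_sum)
    then show "f \<in> ideal_gen (monom ` U)" using poly_mapping_sum_single[of f] by simp
  qed
qed

lemma upset_generated: "upset {u :: 'n \<Rightarrow> nat. \<exists>g\<in>U. g \<le> u}"
  unfolding upset_def
proof (intro ballI allI impI CollectI)
  fix u v :: "'n \<Rightarrow> nat" assume "u \<in> {u. \<exists>g\<in>U. g \<le> u}" and uv: "u \<le> v"
  then obtain g where "g \<in> U" "g \<le> u" by blast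
  then show "\<exists>g\<in>U. g \<le> v" using order_trans[OF _ uv] by blast
qed

lemma monomial_ideal_mono_set:
  assumes "monomial_ideal I"
  obtains W where "upset W" "I = mono_set W"
proof -
  obtain U where "I = ideal_gen (monom ` U)" using assms[unfolded monomial_ideal_def] by (rule exE)
  then have "I = mono_set {u. \<exists>g\<in>U. g \<le> u}" unfolding ideal_gen_monom .
  then show ?thesis by (rule that[OF upset_generated])
qed

definition irr_exps :: "('n::finite \<Rightarrow> nat) \<Rightarrow> ('n \<Rightarrow> nat) set" where
  "irr_exps b = {u. \<exists>j. 1 \<le> b j \<and> b j \<le> u j}"

lemma var_power: "(var i :: ('n::finite, 'k::field) mpoly) ^ k = monom (\<lambda>j. if j = i then k else 0)"
proof (induction k)
  case 0
  have "(\<lambda>j. if j = i then 0 else 0) = (0 :: 'n \<Rightarrow> nat)" by (simp add: fun_eq_iff)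
  then show ?case by (simp add: monom_def)
next
  case (Suc k)
  have "(\<lambda>j. if j = i then 1 else 0) + (\<lambda>j. if j = i then k else 0)
      = (\<lambda>j :: 'n. if j = i then Suc k else 0)"
    by (simp add: fun_eq_iff)
  then show ?case
    using Suc by (simp only: power_Suc var_def monom_def mult_single mult_1_right)
qed

lemma irr_ideal_eq: "irr_ideal b = (mono_set (irr_exps b) :: ('n::finite, 'k::field) mpoly set)"
proof -
  let ?U = "{(\<lambda>j. if j = i then b i else 0) | i. 1 \<le> b i}"
  have "{var i ^ b i | i. b i \<ge> 1} = (monom ` ?U :: ('n, 'k) mpoly set)"
    unfolding var_power by blast
  moreover have "{u. \<exists>g\<in>?U. g \<le> u} = irr_exps b"
  proof (rule set_eqI)
    fix u :: "'n \<Rightarrow> nat"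
    have "(\<lambda>j. if j = i then b i else 0) \<le> u \<longleftrightarrow> b i \<le> u i" for i
    proof
      assume "(\<lambda>j. if j = i then b i else 0) \<le> u"
      then show "b i \<le> u i" using le_funD[of _ u i] by fastforce
    qed (simp add: le_fun_def)
    then show "u \<in> {u. \<exists>g\<in>?U. g \<le> u} \<longleftrightarrow> u \<in> irr_exps b"
      unfolding irr_exps_def by blast
  qed
  ultimately show ?thesis by (simp only: irr_ideal_def ideal_gen_monom)
qed

lemma nat_seq_nondecreasing:
  fixes x :: "nat \<Rightarrow> nat"
  obtains r :: "nat \<Rightarrow> nat" where "strict_mono r" "mono (\<lambda>n. x (r n))"
proof -
  obtain r where r: "strict_mono r" "monoseq (\<lambda>n. x (r n))" using seq_monosub[of x] by blast
  show ?thesis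
  proof (cases "\<forall>m n. m \<le> n \<longrightarrow> x (r m) \<le> x (r n)")
    case True
    then show ?thesis by (intro that[OF r(1)] monoI) blast
  next
    case False
    then have dec: "x (r n) \<le> x (r m)" if "m \<le> n" for m n
      using r(2) that unfolding monoseq_def by blast
    obtain N where N: "\<And>n. x (r N) \<le> x (r n)"
      using ex_has_least_nat[of "\<lambda>_. True" 0 "\<lambda>n. x (r n)"] by auto
    have "x (r (n + N)) = x (r N)" for n
      using dec[of N "n + N"] N[of "n + N"] by simp
    moreover have "strict_mono (\<lambda>n. r (n + N))"
      using r(1) by (simp add: strict_mono_def)
    ultimately show ?thesis using that[of "\<lambda>n. r (n + N)"] by (simp add: mono_def)
  qed
qed

text \<open>Dickson's lemma, in the form that the elements of an upward closed set are recognised after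
  truncation at a suitable bound.\<close>

lemma Dickson:
  fixes W :: "('n::finite \<Rightarrow> nat) set"
  assumes W: "upset W"
  obtains e where "\<And>u. u \<in> W \<Longrightarrow> (\<lambda>j. min (u j) (e j)) \<in> W"
proof -
  define Mn where "Mn = {u \<in> W. \<forall>v\<in>W. v \<le> u \<longrightarrow> v = u}"
  have below: "\<exists>m\<in>Mn. m \<le> u" if u: "u \<in> W" for u
  proof -
    obtain m where m: "m \<in> W \<and> m \<le> u"
      and least: "\<And>v. v \<in> W \<and> v \<le> u \<Longrightarrow> (\<Sum>j\<in>UNIV. m j) \<le> (\<Sum>j\<in>UNIV. v j)"
      using ex_has_least_nat[of "\<lambda>v. v \<in> W \<and> v \<le> u" u "\<lambda>v. \<Sum>j\<in>UNIV. v j"] u by auto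
    have "v = m" if v: "v \<in> W" "v \<le> m" for v
    proof (rule ccontr)
      assume "v \<noteq> m"
      then obtain j where "v j \<noteq> m j" by blast
      then have "v j < m j" using le_funD[OF v(2), of j] by simp
      then have "(\<Sum>j\<in>UNIV. v j) < (\<Sum>j\<in>UNIV. m j)"
        using le_funD[OF v(2)] by (intro sum_strict_mono_ex1) auto
      moreover have "v \<le> u" using v(2) m order_trans by blast
      ultimately show False using least[of v] v(1) by simp
    qed
    then show ?thesis using m by (auto simp: Mn_def)
  qed
  have "finite Mn"
  proof (rule ccontr)
    assume "infinite Mn"
    then obtain x :: "nat \<Rightarrow> 'n \<Rightarrow> nat" where x: "inj x" "range x \<subseteq> Mn"
      using infinite_countable_subset by blast
    have "\<exists>r :: nat \<Rightarrow> nat. strict_mono r \<and> (\<forall>j\<in>J. mono (\<lambda>n. x (r n) j))" if "finite J" for J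
      using that
    proof (induction J rule: finite_induct)
      case empty
      show ?case by (rule exI[of _ id]) (simp add: strict_mono_def)
    next
      case (insert i J)
      then obtain r :: "nat \<Rightarrow> nat" where r: "strict_mono r" "\<forall>j\<in>J. mono (\<lambda>n. x (r n) j)" by blast
      obtain r' :: "nat \<Rightarrow> nat" where r': "strict_mono r'" "mono (\<lambda>n. x (r (r' n)) i)"
        by (rule nat_seq_nondecreasing[of "\<lambda>n. x (r n) i"])
      have "strict_mono (\<lambda>n. r (r' n))" using r(1) r'(1) by (simp add: strict_mono_def)
      moreover have "mono (\<lambda>n. x (r (r' n)) j)" if "j \<in> J" for j
      proof (rule monoI)
        fix m n :: nat assume "m \<le> n"
        then have "r' m \<le> r' n" using strict_mono_mono[OF r'(1)] by (simp add: monoD)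
        moreover have "mono (\<lambda>n. x (r n) j)" using r(2) that by blast
        ultimately show "x (r (r' m)) j \<le> x (r (r' n)) j" by (rule monoD[rotated])
      qed
      ultimately show ?case using r'(2) by (intro exI[of _ "\<lambda>n. r (r' n)"]) simp
    qed
    from this[OF finite[of UNIV]] obtain r :: "nat \<Rightarrow> nat"
      where r: "strict_mono r" "\<And>j. mono (\<lambda>n. x (r n) j)" by blast
    have "x (r 0) \<le> x (r 1)" using monoD[OF r(2), of 0 1] by (simp add: le_fun_def)
    moreover have "x (r 0) \<in> Mn" "x (r 1) \<in> Mn" using x(2) by blast+
    ultimately have "x (r 0) = x (r 1)" by (simp add: Mn_def)
    then have "r 0 = r 1" by (rule injD[OF x(1)])
    then show False using strict_monoD[OF r(1), of 0 1] by simp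
  qed
  define e where "e j = (\<Sum>m\<in>Mn. m j)" for j
  have "(\<lambda>j. min (u j) (e j)) \<in> W" if u: "u \<in> W" for u
  proof -
    obtain m where m: "m \<in> Mn" "m \<le> u" using below[OF u] by blast
    have "m j \<le> e j" for j
      unfolding e_def by (rule member_le_sum[OF m(1) _ \<open>finite Mn\<close>]) simp
    then have "m \<le> (\<lambda>j. min (u j) (e j))" using m(2) by (simp add: le_fun_def)
    moreover have "m \<in> W" using m(1) by (simp add: Mn_def)
    ultimately show ?thesis using upsetD[OF W] by blast
  qed
  then show ?thesis using that by blast
qed

lemma finite_below: "finite {v :: 'n::finite \<Rightarrow> nat. v \<le> e}"
proof -
  have "{v. v \<le> e} = PiE UNIV (\<lambda>j. {..e j})" by (auto simp: PiE_def le_fun_def)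
  then show ?thesis by (simp add: finite_PiE)
qed

text \<open>Let \<open>e\<close> be a truncation bound for \<open>W\<close>. A monomial outside \<open>W\<close> is excluded by the irreducible ideal
  that belongs to its truncation \<open>v\<close>: the powers \<open>x\<^sub>j\<close> to the \<open>v\<^sub>j + 1\<close> for the coordinates in which \<open>v\<close> is
  strictly below \<open>e\<close>. A family of least cardinality is irredundant.\<close>

lemma irr_decomp_exists:
  assumes W: "upset W"
  shows "\<exists>\<Q>. irredundant_irr_decomp (mono_set W :: ('n::finite, 'k::field) mpoly set) \<Q>"
proof -
  let ?I = "mono_set W :: ('n, 'k) mpoly set"
  define good :: "('n, 'k) mpoly set set \<Rightarrow> bool" where
    "good \<Q> \<longleftrightarrow> finite \<Q> \<and> \<Q> \<subseteq> range irr_ideal \<and> ?I = \<Inter>\<Q>" for \<Q>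
  obtain e where e: "\<And>u. u \<in> W \<Longrightarrow> (\<lambda>j. min (u j) (e j)) \<in> W" using Dickson[OF W] by blast
  define B where "B v = (\<lambda>j. if v j < e j then v j + 1 else 0)" for v :: "'n \<Rightarrow> nat"
  define V where "V = {v. v \<le> e \<and> v \<notin> W}"
  have "(\<Inter>v\<in>V. irr_exps (B v)) = W"
  proof (intro subset_antisym subsetI)
    fix u assume u: "u \<in> (\<Inter>v\<in>V. irr_exps (B v))"
    show "u \<in> W"
    proof (rule ccontr)
      assume nW: "u \<notin> W"
      define v where "v = (\<lambda>j. min (u j) (e j))"
      have "v \<le> u" by (simp add: v_def le_fun_def)
      then have "v \<in> V" using nW upsetD[OF W] by (auto simp: V_def v_def le_fun_def)
      then have "u \<in> irr_exps (B v)" using u by blast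
      then show False by (auto simp: irr_exps_def B_def v_def split: if_splits)
    qed
  next
    fix u assume u: "u \<in> W"
    have "u \<in> irr_exps (B v)" if v: "v \<in> V" for v
    proof (rule ccontr)
      assume n: "u \<notin> irr_exps (B v)"
      have "min (u j) (e j) \<le> v j" for j
      proof (cases "v j < e j")
        case True
        then have B: "B v j = v j + 1" by (simp add: B_def)
        have "\<not> (1 \<le> B v j \<and> B v j \<le> u j)" using n by (simp add: irr_exps_def)
        then show ?thesis using B by simp
      qed simp
      then have "(\<lambda>j. min (u j) (e j)) \<le> v" by (simp add: le_fun_def)
      then have "v \<in> W" using upsetD[OF W e[OF u]] by blast
      then show False using v by (simp add: V_def)
    qed
    then show "u \<in> (\<Inter>v\<in>V. irr_exps (B v))" by blast
  qed
  moreover have "(\<Inter>v\<in>V. mono_set (irr_exps (B v))) = (mono_set (\<Inter>v\<in>V. irr_exps (B v)) :: ('n, 'k) mpoly set)"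
    by (auto simp: mono_set_def)
  ultimately have "?I = \<Inter> ((\<lambda>v. irr_ideal (B v)) ` V)" by (simp only: irr_ideal_eq)
  moreover have "finite V" unfolding V_def using finite_below[of e] by simp
  ultimately have "good ((\<lambda>v. irr_ideal (B v)) ` V)" by (auto simp: good_def)
  then obtain \<Q> where \<Q>: "good \<Q>" and least: "\<And>\<Q>'. good \<Q>' \<Longrightarrow> card \<Q> \<le> card \<Q>'"
    using ex_has_least_nat[of good _ card] by blast
  have "\<Inter>(\<Q> - {Q}) \<noteq> ?I" if Q: "Q \<in> \<Q>" for Q
  proof
    assume "\<Inter>(\<Q> - {Q}) = ?I"
    then have "good (\<Q> - {Q})" using \<Q> by (auto simp: good_def)
    then have "card \<Q> \<le> card (\<Q> - {Q})" by (rule least)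
    moreover have "card (\<Q> - {Q}) < card \<Q>"
      using \<Q> Q by (intro card_Diff1_less) (simp_all add: good_def)
    ultimately show False by simp
  qed
  then have "irredundant_irr_decomp ?I \<Q>"
    using \<Q> unfolding irredundant_irr_decomp_def good_def by blast
  then show ?thesis ..
qed

text \<open>If an irreducible monomial ideal contains a finite intersection of monomial ideals, it contains
  one of them: monomials outside of it have their least common multiple outside of it.\<close>

lemma irr_ideal_prime:
  assumes fin: "finite \<Q>" and \<Q>: "\<Q> \<subseteq> range irr_ideal"
    and le: "\<Inter>\<Q> \<subseteq> (irr_ideal b :: ('n::finite, 'k::field) mpoly set)"
  shows "\<exists>Q\<in>\<Q>. Q \<subseteq> irr_ideal b"
proof (rule ccontr)
  assume no: "\<not> (\<exists>Q\<in>\<Q>. Q \<subseteq> irr_ideal b)"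
  have "\<forall>Q\<in>\<Q>. \<exists>u. monom u \<in> Q \<and> u \<notin> irr_exps b"
  proof
    fix Q assume Q: "Q \<in> \<Q>"
    then obtain c where c: "Q = mono_set (irr_exps c)" using \<Q> by (auto simp: irr_ideal_eq)
    have "\<not> Q \<subseteq> irr_ideal b" using no Q by blast
    then have "\<not> irr_exps c \<subseteq> irr_exps b"
      by (simp only: c irr_ideal_eq mono_set_subset_iff simp_thms)
    then show "\<exists>u. monom u \<in> Q \<and> u \<notin> irr_exps b" using c by auto
  qed
  from bchoice[OF this] obtain u where u: "\<And>Q. Q \<in> \<Q> \<Longrightarrow> monom (u Q) \<in> Q"
    "\<And>Q. Q \<in> \<Q> \<Longrightarrow> u Q \<notin> irr_exps b" by blast
  define w where "w j = (if \<Q> = {} then 0 else Max ((\<lambda>Q. u Q j) ` \<Q>))" for j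
  have "monom w \<in> Q" if Q: "Q \<in> \<Q>" for Q
  proof -
    obtain c where c: "Q = mono_set (irr_exps c)" using \<Q> Q by (auto simp: irr_ideal_eq)
    then have "u Q \<in> irr_exps c" using u(1)[OF Q] by simp
    moreover have "u Q j \<le> w j" for j using Q fin by (auto simp: w_def)
    ultimately have "w \<in> irr_exps c" unfolding irr_exps_def using order_trans by blast
    then show ?thesis using c by simp
  qed
  then have "(monom w :: ('n, 'k) mpoly) \<in> irr_ideal b" using le by blast
  then obtain j where j: "1 \<le> b j" "b j \<le> w j" by (auto simp: irr_ideal_eq irr_exps_def)
  show False
  proof (cases "\<Q> = {}")
    case True
    then show False using j by (simp add: w_def)
  next
    case False
    then have "w j \<in> (\<lambda>Q. u Q j) ` \<Q>" unfolding w_def using fin by (simp add: Max_in)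
    then obtain Q where "Q \<in> \<Q>" "w j = u Q j" by blast
    then show False using u(2) j by (auto simp: irr_exps_def)
  qed
qed

lemma
  assumes "irredundant_irr_decomp I \<Q>"
  shows irr_decomp_finite: "finite \<Q>" and irr_decomp_irr: "\<Q> \<subseteq> range irr_ideal"
    and irr_decomp_Inter: "I = \<Inter>\<Q>"
    and irr_decomp_irredundant: "Q \<in> \<Q> \<Longrightarrow> \<Inter>(\<Q> - {Q}) \<noteq> I"
proof -
  note d = assms[unfolded irredundant_irr_decomp_def]
  show "finite \<Q>" using d by (elim conjE)
  show "\<Q> \<subseteq> range irr_ideal" using d by (elim conjE)
  show "I = \<Inter>\<Q>" using d by (elim conjE)
  show "\<Inter>(\<Q> - {Q}) \<noteq> I" if "Q \<in> \<Q>" using d that by (elim conjE) (rule bspec)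
qed

lemma irr_decomp_subset:
  assumes "irredundant_irr_decomp I \<Q>" "irredundant_irr_decomp I \<Q>'"
  shows "\<Q> \<subseteq> \<Q>'"
proof
  fix Q assume Q: "Q \<in> \<Q>"
  note f = irr_decomp_finite[OF assms(1)] irr_decomp_irr[OF assms(1)] irr_decomp_Inter[OF assms(1)]
    irr_decomp_irredundant[OF assms(1) Q]
  note f' = irr_decomp_finite[OF assms(2)] irr_decomp_irr[OF assms(2)] irr_decomp_Inter[OF assms(2)]
  obtain b where b: "Q = irr_ideal b" using Q f(2) by blast
  have "\<Inter>\<Q>' \<subseteq> irr_ideal b" using f(3) f'(3) Q b by blast
  then obtain Q' where Q': "Q' \<in> \<Q>'" "Q' \<subseteq> Q" using irr_ideal_prime[OF f'(1,2)] b by blast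
  obtain b' where b': "Q' = irr_ideal b'" using Q' f'(2) by blast
  have "\<Inter>\<Q> \<subseteq> irr_ideal b'" using f(3) f'(3) Q'(1) b' by blast
  then obtain Q'' where Q'': "Q'' \<in> \<Q>" "Q'' \<subseteq> Q'" using irr_ideal_prime[OF f(1,2)] b' by blast
  have "Q'' = Q"
  proof (rule ccontr)
    assume "Q'' \<noteq> Q"
    then have "\<Inter>(\<Q> - {Q}) \<subseteq> Q" using Q'' Q'(2) by blast
    then have "\<Inter>(\<Q> - {Q}) = \<Inter>\<Q>" using Q by blast
    then show False using f(3,4) by simp
  qed
  then show "Q \<in> \<Q>'" using Q' Q''(2) by (metis subset_antisym)
qed

text \<open>By \<open>irr_decomp_subset\<close> the irredundant decomposition is unique, so the definite description
  in \<open>Irr\<close> denotes it.\<close>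

lemma Irr_decomp:
  assumes "upset W"
  shows "irredundant_irr_decomp (mono_set W :: ('n::finite, 'k::field) mpoly set) (Irr (mono_set W))"
proof -
  obtain \<Q> where \<Q>: "irredundant_irr_decomp (mono_set W :: ('n, 'k) mpoly set) \<Q>"
    using irr_decomp_exists[OF assms] by blast
  show ?thesis unfolding Irr_def
    by (rule theI[of "irredundant_irr_decomp (mono_set W)", OF \<Q>])
      (rule subset_antisym[OF irr_decomp_subset[OF _ \<Q>] irr_decomp_subset[OF \<Q>]])
qed

text \<open>In exponents Alexander duality is the complement of the reflection \<open>u \<mapsto> a - u\<close>. Truncated
  subtraction makes this correct for all \<open>u\<close>, also where \<open>u\<close> exceeds \<open>a\<close>.\<close>

lemma alexander_dual_eq:
  assumes W: "upset W"
  shows "alexander_dual a (mono_set W :: ('n::finite, 'k::field) mpoly set)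
    = mono_set {u. (\<lambda>j. a j - u j) \<notin> W}"
proof -
  let ?I = "mono_set W :: ('n, 'k) mpoly set"
  let ?U = "{dual_exp a b | b. irr_ideal b \<in> Irr ?I}"
  note dec = Irr_decomp[OF W, where 'k = 'k]
  have W_iff: "v \<in> W \<longleftrightarrow> (\<forall>b. irr_ideal b \<in> Irr ?I \<longrightarrow> v \<in> irr_exps b)" for v
  proof -
    have "v \<in> W \<longleftrightarrow> (monom v :: ('n, 'k) mpoly) \<in> ?I" by simp
    also have "\<dots> \<longleftrightarrow> (\<forall>Q\<in>Irr ?I. monom v \<in> Q)"
      by (subst irr_decomp_Inter[OF dec]) simp
    also have "\<dots> \<longleftrightarrow> (\<forall>b. irr_ideal b \<in> Irr ?I \<longrightarrow> (monom v :: ('n, 'k) mpoly) \<in> irr_ideal b)"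
    proof -
      have "Irr ?I \<subseteq> range irr_ideal" by (rule irr_decomp_irr[OF dec])
      then show ?thesis by blast
    qed
    finally show ?thesis by (simp only: irr_ideal_eq monom_mono_set)
  qed
  have dual: "dual_exp a b \<le> u \<longleftrightarrow> (\<lambda>j. a j - u j) \<notin> irr_exps b" for b u :: "'n \<Rightarrow> nat"
  proof -
    have "(if 1 \<le> b j then a j + 1 - b j else 0) \<le> u j \<longleftrightarrow> \<not> (1 \<le> b j \<and> b j \<le> a j - u j)" for j
      by (cases "1 \<le> b j") (simp, arith, simp)
    then show ?thesis by (simp add: dual_exp_def irr_exps_def le_fun_def)
  qed
  have "{u. \<exists>g\<in>?U. g \<le> u} = {u. (\<lambda>j. a j - u j) \<notin> W}"
  proof (rule set_eqI)
    fix u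
    have "(\<exists>g\<in>?U. g \<le> u) \<longleftrightarrow> (\<exists>b. irr_ideal b \<in> Irr ?I \<and> dual_exp a b \<le> u)" by blast
    then show "u \<in> {u. \<exists>g\<in>?U. g \<le> u} \<longleftrightarrow> u \<in> {u. (\<lambda>j. a j - u j) \<notin> W}"
      by (simp only: mem_Collect_eq dual W_iff not_all not_imp)
  qed
  moreover have "{monom (dual_exp a b) | b. irr_ideal b \<in> Irr ?I} = (monom ` ?U :: ('n, 'k) mpoly set)"
    by blast
  ultimately show ?thesis by (simp only: alexander_dual_def ideal_gen_monom)
qed

section \<open>Betti numbers of the Alexander dual\<close>

text \<open>If \<open>A\<close> is the set of degrees of a monomial ideal and \<open>G = UNIV\<close>, the homology of this complex
  gives the Betti numbers in degree \<open>c\<close>.\<close>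

definition faces :: "('n \<Rightarrow> int) set \<Rightarrow> 'n set \<Rightarrow> ('n \<Rightarrow> int) \<Rightarrow> 'n set set" where
  "faces A G c = {s. s \<subseteq> G \<and> c - indic s \<in> A}"

definition upward :: "('n \<Rightarrow> int) set \<Rightarrow> bool" where
  "upward A \<longleftrightarrow> (\<forall>d\<in>A. 0 \<le> d \<and> (\<forall>d'\<ge>d. d' \<in> A))"

lemma upwardD: "upward A \<Longrightarrow> d \<in> A \<Longrightarrow> d \<le> d' \<Longrightarrow> d' \<in> A"
  and upward_nonneg: "upward A \<Longrightarrow> d \<in> A \<Longrightarrow> 0 \<le> d"
  by (simp_all add: upward_def)

lemma upward_degs: "monomial_closed N \<Longrightarrow> upward (degs N)"
  unfolding upward_def
proof (intro ballI conjI allI impI)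
  fix d d' assume N: "monomial_closed N" and d: "d \<in> degs N"
  then show "0 \<le> d" by (simp add: degs_def)
  assume "d \<le> d'"
  then show "d' \<in> degs N" by (rule degs_upward[OF N d])
qed

lemma simplicial_faces: "upward A \<Longrightarrow> simplicial (faces A G c)"
  unfolding simplicial_def
proof (intro ballI allI impI)
  fix s t assume A: "upward A" and s: "s \<in> faces A G c" and ts: "t \<subseteq> s"
  have "c - indic s \<le> c - indic t" using indic_mono[OF ts] by (simp add: diff_left_mono)
  moreover have "c - indic s \<in> A" using s by (simp add: faces_def)
  ultimately have "c - indic t \<in> A" using upwardD[OF A] by blast
  then show "t \<in> faces A G c" using s ts by (auto simp: faces_def)
qed

lemma faces_le: "upward A \<Longrightarrow> s \<in> faces A G c \<Longrightarrow> indic s \<le> c"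
proof -
  assume A: "upward A" and s: "s \<in> faces A G c"
  have "c - indic s \<in> A" using s by (simp add: faces_def)
  then have "0 \<le> c - indic s" by (rule upward_nonneg[OF A])
  then show "indic s \<le> c" by simp
qed

lemma indic_insert: "m \<notin> s \<Longrightarrow> c - indic (insert m s) = c(m := c m - 1) - indic s"
  by (auto simp: indic_def fun_eq_iff)

text \<open>The faces that contain \<open>m\<close> are, without \<open>m\<close>, the faces of the complex in the degree lowered by
  one at \<open>m\<close>.\<close>

lemma hdim_faces_step:
  fixes c :: "'n::finite \<Rightarrow> int"
  assumes A: "upward A" and m: "m \<notin> G"
  shows "hdim TYPE('k::field) (faces A G c) j
    \<le> hdim TYPE('k) (faces A G (c(m := c m - 1))) j + hdim TYPE('k) (faces A (insert m G) c) j"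
proof (rule hdim_add_vertex[OF simplicial_faces[OF A] simplicial_faces[OF A] _ _ simplicial_faces[OF A],
      where m = m])
  let ?c = "c(m := c m - 1)"
  show "faces A G ?c \<subseteq> faces A G c"
  proof
    fix s assume s: "s \<in> faces A G ?c"
    have "?c - indic s \<le> c - indic s" by (simp add: le_fun_def)
    moreover have "?c - indic s \<in> A" using s by (simp add: faces_def)
    ultimately have "c - indic s \<in> A" using upwardD[OF A] by blast
    then show "s \<in> faces A G c" using s by (simp add: faces_def)
  qed
  show "m \<notin> s" if "s \<in> faces A G c" for s using that m by (auto simp: faces_def)
  show "faces A (insert m G) c = faces A G c \<union> insert m ` faces A G ?c"
  proof (rule set_eqI)
    fix s
    show "s \<in> faces A (insert m G) c \<longleftrightarrow> s \<in> faces A G c \<union> insert m ` faces A G ?c"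
    proof (cases "m \<in> s")
      case True
      define r where "r = s - {m}"
      have s: "s = insert m r" "m \<notin> r" using True by (auto simp: r_def)
      have "s \<notin> faces A G c" using True m by (auto simp: faces_def)
      moreover have "s \<in> insert m ` faces A G ?c \<longleftrightarrow> r \<in> faces A G ?c"
      proof
        assume "s \<in> insert m ` faces A G ?c"
        then obtain t where t: "t \<in> faces A G ?c" "s = insert m t" by blast
        moreover have "m \<notin> t" using t(1) m by (auto simp: faces_def)
        ultimately show "r \<in> faces A G ?c" using s insert_ident[of m r t] by simp
      qed (use s in blast)
      moreover have "s \<in> faces A (insert m G) c \<longleftrightarrow> r \<in> faces A G ?c"
        using s m indic_insert[OF s(2), of c] by (auto simp: faces_def)
      ultimately show ?thesis by simp
    next
      case False
      then show ?thesis by (auto simp: faces_def)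
    qed
  qed
qed

lemma hdim_faces_negative:
  assumes A: "upward A" and c: "c m < 0"
  shows "hdim TYPE('k::field) (faces A G c) j = 0"
proof (rule hdim_no_faces)
  fix s assume "s \<in> faces A G c"
  then have "indic s m \<le> c m" by (rule le_funD[OF faces_le[OF A]])
  moreover have "0 \<le> indic s m" by (simp add: indic_def)
  ultimately show "card s \<noteq> j" using c by simp
qed

lemma hdim_faces_telescope:
  fixes c :: "'n::finite \<Rightarrow> int"
  assumes A: "upward A" and m: "m \<notin> G"
  shows "c m = int k - 1 \<Longrightarrow> hdim TYPE('k::field) (faces A G c) j
    \<le> (\<Sum>t<k. hdim TYPE('k) (faces A (insert m G) (c(m := int t))) j)"
proof (induction k arbitrary: c)
  case 0
  then show ?case using hdim_faces_negative[OF A, of c m] by simp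
next
  case (Suc k)
  let ?c = "c(m := c m - 1)"
  have "?c m = int k - 1" using Suc.prems by simp
  from Suc.IH[of ?c, OF this] have "hdim TYPE('k) (faces A G ?c) j
      \<le> (\<Sum>t<k. hdim TYPE('k) (faces A (insert m G) (c(m := int t))) j)"
    by (simp only: fun_upd_upd)
  moreover have "c(m := int k) = c" using Suc.prems by (simp add: fun_eq_iff)
  ultimately show ?case
    using hdim_faces_step[OF A m, of c j, where 'k = 'k] by (simp only: sum.lessThan_Suc)
qed

definition box :: "'n set \<Rightarrow> ('n \<Rightarrow> int) \<Rightarrow> ('n \<Rightarrow> int) set" where
  "box R c = {c'. (\<forall>m. m \<notin> R \<longrightarrow> c' m = c m) \<and> (\<forall>m\<in>R. 0 \<le> c' m \<and> c' m \<le> c m)}"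

lemma box_insert:
  assumes m: "m \<notin> R" and k: "c m = int k - 1"
  shows "box (insert m R) c = (\<lambda>(c', t). c'(m := int t)) ` (box R c \<times> {..<k})"
    and "inj_on (\<lambda>(c', t). c'(m := int t)) (box R c \<times> {..<k})"
proof -
  show "box (insert m R) c = (\<lambda>(c', t). c'(m := int t)) ` (box R c \<times> {..<k})"
  proof (intro subset_antisym subsetI)
    fix d assume d: "d \<in> box (insert m R) c"
    then have dm: "0 \<le> d m" "d m \<le> c m" by (simp_all add: box_def)
    have "d(m := c m) \<in> box R c" using d m by (auto simp: box_def)
    moreover have "nat (d m) \<in> {..<k}" using dm k by simp
    moreover have "d = (\<lambda>(c', t). c'(m := int t)) (d(m := c m), nat (d m))" using dm by simp
    ultimately show "d \<in> (\<lambda>(c', t). c'(m := int t)) ` (box R c \<times> {..<k})" by blast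
  next
    fix d assume "d \<in> (\<lambda>(c', t). c'(m := int t)) ` (box R c \<times> {..<k})"
    then obtain c' t where "c' \<in> box R c" "t < k" "d = c'(m := int t)" by auto
    then show "d \<in> box (insert m R) c" using m k by (auto simp: box_def)
  qed
  show "inj_on (\<lambda>(c', t). c'(m := int t)) (box R c \<times> {..<k})"
  proof (rule inj_onI)
    fix p q assume p: "p \<in> box R c \<times> {..<k}" and q: "q \<in> box R c \<times> {..<k}"
      and eq: "(\<lambda>(c', t). c'(m := int t)) p = (\<lambda>(c', t). c'(m := int t)) q"
    obtain c1 t1 c2 t2 where pq: "p = (c1, t1)" "q = (c2, t2)" by fastforce
    have cm: "c1 m = c m" "c2 m = c m" using p q pq m by (auto simp: box_def)
    have e: "c1(m := int t1) = c2(m := int t2)" using eq pq by simp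
    have "c1 x = c2 x" for x
    proof (cases "x = m")
      case False
      have "(c1(m := int t1)) x = (c2(m := int t2)) x" by (simp only: e)
      then show ?thesis using False by simp
    qed (simp only: cm)
    moreover have "t1 = t2" using fun_cong[OF e, of m] by simp
    ultimately show "p = q" using pq by (simp add: fun_eq_iff)
  qed
qed

text \<open>Enlarging the vertex set one vertex at a time replaces the homology in degree \<open>c\<close> by homology
  in the degrees obtained by lowering the new coordinate to all values down to zero.\<close>

lemma hdim_faces_le_box:
  fixes c :: "'n::finite \<Rightarrow> int"
  assumes A: "upward A" and "finite R" "R \<inter> G = {}" "\<And>m. m \<in> R \<Longrightarrow> 0 \<le> c m"
  shows "finite (box R c) \<and> hdim TYPE('k::field) (faces A G c) j
    \<le> (\<Sum>d\<in>box R c. hdim TYPE('k) (faces A (R \<union> G) d) j)"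
  using assms(2-4)
proof (induction R rule: finite_induct)
  case empty
  have "box {} c = {c}" by (auto simp: box_def)
  then show ?case by simp
next
  case (insert m R)
  define k where "k = nat (c m + 1)"
  have k: "c m = int k - 1" using insert.prems(2)[of m] by (simp add: k_def)
  have IH: "finite (box R c)" "hdim TYPE('k) (faces A G c) j
      \<le> (\<Sum>d\<in>box R c. hdim TYPE('k) (faces A (R \<union> G) d) j)"
    using insert.IH insert.prems by auto
  note b = box_insert[where c = c, OF insert.hyps(2) k]
  have m: "m \<notin> R \<union> G" using insert.hyps(2) insert.prems(1) by blast
  have "hdim TYPE('k) (faces A (R \<union> G) d) j
      \<le> (\<Sum>t<k. hdim TYPE('k) (faces A (insert m (R \<union> G)) (d(m := int t))) j)"
    if d: "d \<in> box R c" for d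
  proof (rule hdim_faces_telescope[OF A m])
    show "d m = int k - 1" using d insert.hyps(2) k by (simp add: box_def)
  qed
  then have "(\<Sum>d\<in>box R c. hdim TYPE('k) (faces A (R \<union> G) d) j)
      \<le> (\<Sum>d\<in>box R c. \<Sum>t<k. hdim TYPE('k) (faces A (insert m (R \<union> G)) (d(m := int t))) j)"
    by (rule sum_mono)
  also have "\<dots> = (\<Sum>(d, t)\<in>box R c \<times> {..<k}.
      hdim TYPE('k) (faces A (insert m (R \<union> G)) (d(m := int t))) j)"
    by (rule sum.cartesian_product)
  also have "\<dots> = (\<Sum>d\<in>box (insert m R) c. hdim TYPE('k) (faces A (insert m (R \<union> G)) d) j)"
    unfolding b(1) by (subst sum.reindex[OF b(2)]) (simp add: case_prod_unfold)
  finally show ?case using IH b(1) by (simp add: Un_insert_left)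
qed

lemma degs_mono_set: "degs (mono_set W :: ('n::finite, 'k::field) mpoly set) = {d. 0 \<le> d \<and> nat \<circ> d \<in> W}"
  by (simp add: degs_def)

theorem theorem4p13:
  fixes I :: "('n::finite, 'k::field) mpoly set"
    and F :: "'n set" and a :: "'n \<Rightarrow> nat" and b :: "'n \<Rightarrow> int" and i :: int
  assumes "CARD('n) \<ge> 2"
    and "monomial_ideal I" and "I \<noteq> UNIV"
    and "lcm_exp I \<le> a"
    and "indicator F \<le> b" and "b \<le> (int \<circ> a) \<cdot> F"
  shows "betti i b I \<le>
    (\<Sum>\<^sub>\<infinity>c\<in>{c. c \<cdot> F = dual_exp (int \<circ> a) b}. betti (int (card F) - i - 1) c (alexander_dual a I))"
proof (cases "i < 0")
  case True
  then show ?thesis by (simp add: betti_def)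
next
  case False
  define l where "l = nat i"
  have i: "i = int l" using False by (simp add: l_def)
  obtain W where W: "upset W" and I: "I = mono_set W"
    using monomial_ideal_mono_set[OF assms(2)] by blast
  define W' where "W' = {u. (\<lambda>j. a j - u j) \<notin> W}"
  have dual: "alexander_dual a I = mono_set W'"
    unfolding I W'_def by (rule alexander_dual_eq[OF W])
  have W': "upset W'"
    unfolding upset_def
  proof (intro ballI allI impI)
    fix u v assume u: "u \<in> W'" and uv: "u \<le> v"
    have "(\<lambda>j. a j - v j) \<le> (\<lambda>j. a j - u j)" using uv by (auto simp: le_fun_def intro: diff_le_mono2)
    then show "v \<in> W'" using u upsetD[OF W] by (auto simp: W'_def)
  qed
  have closed: "monomial_closed I" "monomial_closed (mono_set W' :: ('n, 'k) mpoly set)"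
    unfolding I by (rule monomial_closed_mono_set[OF W], rule monomial_closed_mono_set[OF W'])
  define A where "A = degs I"
  define A' where "A' = degs (mono_set W' :: ('n, 'k) mpoly set)"
  have A: "upward A" and A': "upward A'"
    unfolding A_def A'_def by (rule upward_degs[OF closed(1)], rule upward_degs[OF closed(2)])
  have A_iff: "d \<in> A \<longleftrightarrow> 0 \<le> d \<and> nat \<circ> d \<in> W" for d
    by (simp add: A_def I degs_mono_set)
  have A'_iff: "d \<in> A' \<longleftrightarrow> 0 \<le> d \<and> (\<lambda>j. a j - nat (d j)) \<notin> W" for d
    by (simp add: A'_def degs_mono_set W'_def)
  have bF: "1 \<le> b j" "b j \<le> int (a j)" if "j \<in> F" for j
    using le_funD[OF assms(5), of j] le_funD[OF assms(6), of j] that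
    by (simp_all add: restrict_deg_def)
  have b0: "b j = 0" if "j \<notin> F" for j
    using le_funD[OF assms(5), of j] le_funD[OF assms(6), of j] that
    by (simp add: restrict_deg_def)
  have b_nonneg: "0 \<le> b j" for j
    using bF(1)[of j] b0[of j] by (cases "j \<in> F") simp_all
  define K where "K = faces A UNIV b"
  have lhs: "betti i b I = hdim TYPE('k) K l"
    unfolding i K_def faces_def A_def by (simp add: betti_eq_hdim[OF closed(1)])
  have K: "simplicial K" unfolding K_def by (rule simplicial_faces[OF A])
  have KF: "K \<subseteq> Pow F"
  proof
    fix s assume "s \<in> K"
    then have "indic s j \<le> b j" for j unfolding K_def by (rule le_funD[OF faces_le[OF A]])
    note le = this
    have "j \<in> F" if "j \<in> s" for j
    proof (rule ccontr)
      assume "j \<notin> F"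
      then show False using le[of j] b0[of j] that by (simp add: indic_def)
    qed
    then show "s \<in> Pow F" by blast
  qed
  \<comment> \<open>In the first case the Betti numbers on the right have negative index.\<close>
  show ?thesis
  proof (cases "F = {} \<or> card F \<le> l")
    case True
    have "hdim TYPE('k) K l = 0"
    proof (cases "F = {}")
      case True
      have "K = {}"
      proof (rule ccontr)
        assume "K \<noteq> {}"
        then obtain s where s: "s \<in> K" by blast
        then have "{} \<in> K" using simplicialD[OF K] by blast
        then have "b \<in> A" by (simp add: K_def faces_def indic_def zero_fun_def[symmetric])
        moreover have "b = 0" using b0 True by (simp add: fun_eq_iff)
        moreover have "nat \<circ> (0 :: 'n \<Rightarrow> int) = 0" by (simp add: fun_eq_iff)
        ultimately have "0 \<in> W" by (simp add: A_iff)
        then have "W = UNIV" using upsetD[OF W, of 0] by (auto simp: le_fun_def)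
        then show False using assms(3) by (simp add: I mono_set_UNIV)
      qed
      then show ?thesis by (intro hdim_no_faces) simp
    next
      case False
      then obtain v where v: "v \<in> F" by blast
      have "hdim TYPE('k) (Pow F - K) (Suc l) = 0"
      proof (rule hdim_no_faces)
        fix s assume "s \<in> Pow F - K"
        then have "card s \<le> card F" by (intro card_mono) auto
        then show "card s \<noteq> Suc l" using \<open>F = {} \<or> card F \<le> l\<close> False by simp
      qed
      then show ?thesis using hdim_le_relative[OF K KF v, of l, where 'k = 'k] by simp
    qed
    then show ?thesis using lhs by simp
  next
    case False
    define j where "j = card F - Suc l"
    have ij: "Suc l + j = card F" and nat_j: "int (card F) - i - 1 = int j"
      using False by (auto simp: j_def i)
    \<comment> \<open>On \<open>F\<close> this is the degree \<open>b\<^sup>a\<close>. Outside \<open>F\<close> the value \<open>a\<close> reflects to \<open>0\<close>, the value of \<open>b\<close>.\<close>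
    define c0 where "c0 = (\<lambda>m. if m \<in> F then int (a m) + 1 - b m else int (a m))"
    have "{t. t \<subseteq> F \<and> F - t \<notin> K} = faces A' F c0"
    proof (rule set_eqI)
      fix t
      have "F - t \<notin> K \<longleftrightarrow> c0 - indic t \<in> A'" if t: "t \<subseteq> F"
      proof -
        have 1: "0 \<le> b - indic (F - t)"
          using bF b_nonneg by (auto simp: le_fun_def indic_def)
        have 2: "0 \<le> c0 - indic t"
        proof (rule le_funI)
          fix x show "0 x \<le> (c0 - indic t) x"
            using bF(2)[of x] by (cases "x \<in> F") (use t in \<open>auto simp: indic_def c0_def\<close>)
        qed
        have "a m - nat ((c0 - indic t) m) = (nat \<circ> (b - indic (F - t))) m" for m
        proof (cases "m \<in> F")
          case True
          then show ?thesis using bF[OF True] by (auto simp: c0_def indic_def)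
        next
          case False
          then show ?thesis using b0[OF False] t by (auto simp: c0_def indic_def)
        qed
        then have "(\<lambda>m. a m - nat ((c0 - indic t) m)) = nat \<circ> (b - indic (F - t))" by (rule ext)
        then show ?thesis using 1 2 by (simp add: K_def faces_def A_iff A'_iff)
      qed
      then show "t \<in> {t. t \<subseteq> F \<and> F - t \<notin> K} \<longleftrightarrow> t \<in> faces A' F c0" by (auto simp: faces_def)
    qed
    then have "hdim TYPE('k) K l \<le> hdim TYPE('k) (faces A' F c0) j"
      using Alexander_duality[OF K KF _ ij, where 'k = 'k] False by simp
    also have "finite (box (-F) c0) \<and> hdim TYPE('k) (faces A' F c0) j
        \<le> (\<Sum>d\<in>box (-F) c0. hdim TYPE('k) (faces A' (-F \<union> F) d) j)"
      by (rule hdim_faces_le_box[OF A']) (auto simp: c0_def)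
    then have fin: "finite (box (-F) c0)" and "hdim TYPE('k) (faces A' F c0) j
        \<le> (\<Sum>d\<in>box (-F) c0. hdim TYPE('k) (faces A' UNIV d) j)"
      by simp_all
    note this(2)
    also have "(\<Sum>d\<in>box (-F) c0. hdim TYPE('k) (faces A' UNIV d) j)
        = (\<Sum>d\<in>box (-F) c0. betti (int j) d (alexander_dual a I))"
      unfolding dual betti_eq_hdim[OF closed(2)] faces_def A'_def by simp
    also have "\<dots> = (\<Sum>\<^sub>\<infinity>d\<in>box (-F) c0. betti (int j) d (alexander_dual a I))"
      by (rule infsum_finite[OF fin, symmetric])
    also have "\<dots> = (\<Sum>\<^sub>\<infinity>c\<in>{c. c \<cdot> F = dual_exp (int \<circ> a) b}. betti (int j) c (alexander_dual a I))"
    proof (rule infsum_cong_neutral)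
      have dual_b: "dual_exp (int \<circ> a) b m = (if m \<in> F then c0 m else 0)" for m
        using bF[of m] b0[of m] by (simp add: dual_exp_def c0_def)
      fix c
      {
        assume "c \<in> box (-F) c0 - {c. c \<cdot> F = dual_exp (int \<circ> a) b}"
        then show "betti (int j) c (alexander_dual a I) = 0"
          using dual_b by (auto simp: box_def restrict_deg_def fun_eq_iff split: if_splits)
      }
      assume c: "c \<in> {c. c \<cdot> F = dual_exp (int \<circ> a) b} - box (-F) c0"
      have cF: "c m = c0 m" if "m \<in> F" for m
      proof -
        have "(c \<cdot> F) m = dual_exp (int \<circ> a) b m" using c by simp
        then show ?thesis using that dual_b by (simp add: restrict_deg_def)
      qed
      \<comment> \<open>Negative coordinates leave no faces. If \<open>c\<^sub>m\<close> exceeds \<open>a\<^sub>m\<close>, truncation at \<open>a\<close> does not see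
        whether \<open>c\<^sub>m\<close> is lowered by one, so the complex is a cone with apex \<open>m\<close>.\<close>
      then obtain m where m: "m \<notin> F" "c m < 0 \<or> int (a m) < c m"
        using c by (force simp: box_def c0_def)
      have "hdim TYPE('k) (faces A' UNIV c) j = 0"
      proof (cases "c m < 0")
        case True
        then show ?thesis by (rule hdim_faces_negative[OF A'])
      next
        case False
        then have am: "int (a m) < c m" using m by blast
        show ?thesis
        proof (rule hdim_cone[OF simplicial_faces[OF A'], where v = m])
          fix s assume s: "s \<in> faces A' UNIV c"
          show "insert m s \<in> faces A' UNIV c"
          proof (cases "m \<in> s")
            case True
            then show ?thesis using s by (simp add: insert_absorb)
          next
            case False
            define d where "d = c - indic s"
            define d' where "d' = c - indic (insert m s)"
            have dm: "d m = c m" "d' m = c m - 1" and dx: "\<And>x. x \<noteq> m \<Longrightarrow> d' x = d x"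
              using False by (auto simp: d_def d'_def indic_def)
            have "0 \<le> d" "(\<lambda>j. a j - nat (d j)) \<notin> W"
              using s by (simp_all add: faces_def A'_iff d_def)
            moreover have "a x - nat (d x) = a x - nat (d' x)" for x
              using dm dx am by (cases "x = m") auto
            moreover have "0 \<le> d'"
              unfolding le_fun_def
            proof
              fix x show "0 x \<le> d' x"
                using dm dx[of x] am le_funD[OF \<open>0 \<le> d\<close>, of x] by (cases "x = m") auto
            qed
            ultimately have "d' \<in> A'" by (simp add: A'_iff)
            then show ?thesis by (simp add: faces_def d'_def)
          qed
        qed
      qed
      then show "betti (int j) c (alexander_dual a I) = 0"
        unfolding dual betti_eq_hdim[OF closed(2)] faces_def A'_def by simp
    qed simp
    finally show ?thesis by (simp only: lhs nat_j)
  qed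
qed

end
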